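(* Let $u_0\in L^\infty(\mathbb R^N)$, $u_0\ge0$, $u_0\not\equiv0$, be supported in a ball of radius $R$, let $u$ be the solution of $\partial_t u+\mathcal L_{s,p}u=0$ with $u(\cdot,0)=u_0$, and let $M(u_0)=\int_{\mathbb R^N}u_0\,dx$. For every $\tau>0$ there exist constants $M_1,M_2>0$ and $c_2>0$ (possibly depending on $\tau$) such that $$U_{M_1}(x,t)\le u(x,t)\le U_{M_2}(x,t+c_2)\qquad\text{for all }x\in\mathbb R^N,\ t\ge\tau,$$ and moreover $M_1\le M(u_0)\le M_2$.
   Context: Fix $N\ge1$, $0<s<1$, $p>2$, $\Phi(z)=|z|^{p-2}z$, $\mathcal L_{s,p}u(x)=\mathrm{P.V.}\int_{\mathbb R^N}\Phi(u(x)-u(y))|x-y|^{-(N+sp)}dy$, $\beta=1/(N(p-2)+sp)$, $\alpha=N\beta$. "The solution" with datum $u_0\in L^q(\mathbb R^N)$, $1\le q<\infty$, is the semigroup strong solution (gradient flow in $L^2$ of $\mathcal J(u)=\frac1p\iint|u(x)-u(y)|^p|x-y|^{-(N+sp)}dxdy$, extended to ordered contraction semigroups in all $L^q$). For $M>0$, $U_M(x,t)=M^{sp\beta}t^{-\alpha}F(M^{-(p-2)\beta}|x|t^{-\beta})$ is the unique self-similar solution with initial trace $M\delta_0$ (i.e. $\int U_M(x,t)\varphi(x)dx\to M\varphi(0)$ as $t\to0$ for smooth compactly supported $\varphi\ge0$), $F$ being its positive, radially nonincreasing profile of unit mass. *)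

theory Defs
  imports "HOL-Analysis.Analysis"
begin

definition in_L2 :: "('a::euclidean_space \<Rightarrow> real) \<Rightarrow> bool" where
  "in_L2 f \<longleftrightarrow> f \<in> borel_measurable lborel \<and> integrable lborel (\<lambda>x. (f x)\<^sup>2)"

definition L2norm :: "('a::euclidean_space \<Rightarrow> real) \<Rightarrow> real" where
  "L2norm f = sqrt (\<integral>x. (f x)\<^sup>2 \<partial>lborel)"

definition in_Linf :: "('a::euclidean_space \<Rightarrow> real) \<Rightarrow> bool" where
  "in_Linf f \<longleftrightarrow> f \<in> borel_measurable lborel \<and> (\<exists>C. AE x in lborel. \<bar>f x\<bar> \<le> C)"

definition Jfun :: "real \<Rightarrow> real \<Rightarrow> ('a::euclidean_space \<Rightarrow> real) \<Rightarrow> ennreal" where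
  "Jfun s p v = ennreal (1 / p) *
     (\<integral>\<^sup>+x. \<integral>\<^sup>+y. ennreal (\<bar>v x - v y\<bar> powr p / norm (x - y) powr (real DIM('a) + s * p)) \<partial>lborel \<partial>lborel)"

definition subdiffJ :: "real \<Rightarrow> real \<Rightarrow> ('a::euclidean_space \<Rightarrow> real) \<Rightarrow> ('a \<Rightarrow> real) \<Rightarrow> bool" where
  "subdiffJ s p v w \<longleftrightarrow> in_L2 v \<and> in_L2 w \<and> Jfun s p v < \<infinity> \<and>
     (\<forall>\<phi>. in_L2 \<phi> \<and> Jfun s p \<phi> < \<infinity> \<longrightarrow>
        enn2real (Jfun s p \<phi>) \<ge> enn2real (Jfun s p v) + (\<integral>x. w x * (\<phi> x - v x) \<partial>lborel))"

text \<open>Strong solution of the L^2 gradient flow u' = - dJ(u), u(0) = u0 (Brezis-Komura):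
  u(t) in L^2, continuous at t=0 in L^2, Lipschitz in L^2 on every [delta,T] with delta>0,
  and for a.e. t>0 the L^2-derivative u'(t) exists and -u'(t) belongs to the subdifferential.\<close>
definition is_solution :: "real \<Rightarrow> real \<Rightarrow> ('a::euclidean_space \<Rightarrow> real) \<Rightarrow> (real \<Rightarrow> 'a \<Rightarrow> real) \<Rightarrow> bool" where
  "is_solution s p u0 u \<longleftrightarrow>
     (\<forall>t\<ge>0. in_L2 (u t)) \<and>
     ((\<lambda>t. L2norm (\<lambda>x. u t x - u0 x)) \<longlongrightarrow> 0) (at_right 0) \<and>
     (\<forall>\<delta> T. 0 < \<delta> \<longrightarrow> (\<exists>L. \<forall>t1\<in>{\<delta>..T}. \<forall>t2\<in>{\<delta>..T}.
          L2norm (\<lambda>x. u t1 x - u t2 x) \<le> L * \<bar>t1 - t2\<bar>)) \<and>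
     (AE t in lborel. 0 < t \<longrightarrow>
        (\<exists>w. ((\<lambda>h. L2norm (\<lambda>x. (u (t + h) x - u t x) / h + w x)) \<longlongrightarrow> 0) (at 0)
             \<and> subdiffJ s p (u t) w))"

definition is_solution_pos :: "real \<Rightarrow> real \<Rightarrow> (real \<Rightarrow> 'a::euclidean_space \<Rightarrow> real) \<Rightarrow> bool" where
  "is_solution_pos s p U \<longleftrightarrow> (\<forall>t0>0. in_L2 (U t0) \<and> is_solution s p (U t0) (\<lambda>t. U (t0 + t)))"

coinductive smooth_fun :: "('a::euclidean_space \<Rightarrow> real) \<Rightarrow> bool" where
  "(\<forall>x. f differentiable (at x)) \<Longrightarrow>
   (\<forall>b\<in>Basis. smooth_fun (\<lambda>x. frechet_derivative f (at x) b)) \<Longrightarrow> smooth_fun f"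

definition nonneg_test_fun :: "('a::euclidean_space \<Rightarrow> real) \<Rightarrow> bool" where
  "nonneg_test_fun \<phi> \<longleftrightarrow> smooth_fun \<phi> \<and> bounded {x. \<phi> x \<noteq> 0} \<and> (\<forall>x. \<phi> x \<ge> 0)"

definition has_trace_delta :: "(real \<Rightarrow> 'a::euclidean_space \<Rightarrow> real) \<Rightarrow> real \<Rightarrow> bool" where
  "has_trace_delta U M \<longleftrightarrow>
     (\<forall>\<phi>. nonneg_test_fun \<phi> \<longrightarrow> ((\<lambda>t. \<integral>x. U t x * \<phi> x \<partial>lborel) \<longlongrightarrow> M * \<phi> 0) (at_right 0))"

definition betaE :: "real \<Rightarrow> real \<Rightarrow> nat \<Rightarrow> real" where
  "betaE s p N = 1 / (real N * (p - 2) + s * p)"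

definition alphaE :: "real \<Rightarrow> real \<Rightarrow> nat \<Rightarrow> real" where
  "alphaE s p N = real N * betaE s p N"

definition Ubar :: "real \<Rightarrow> real \<Rightarrow> (real \<Rightarrow> real) \<Rightarrow> real \<Rightarrow> real \<Rightarrow> 'a::euclidean_space \<Rightarrow> real" where
  "Ubar s p F M t x =
     M powr (s * p * betaE s p DIM('a)) * t powr (- alphaE s p DIM('a)) *
     F (M powr (- (p - 2) * betaE s p DIM('a)) * norm x * t powr (- betaE s p DIM('a)))"

definition is_profile :: "real \<Rightarrow> real \<Rightarrow> 'a::euclidean_space itself \<Rightarrow> (real \<Rightarrow> real) \<Rightarrow> bool" where
  "is_profile s p _ F \<longleftrightarrow>
     continuous_on {0..} F \<and> (\<forall>r\<ge>0. F r > 0) \<and>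
     (\<forall>r1 r2. 0 \<le> r1 \<and> r1 \<le> r2 \<longrightarrow> F r2 \<le> F r1) \<and>
     integrable lborel (\<lambda>x::'a. F (norm x)) \<and> (\<integral>x. F (norm (x::'a)) \<partial>lborel) = 1 \<and>
     is_solution_pos s p (Ubar s p F 1 :: real \<Rightarrow> 'a \<Rightarrow> real) \<and>
     has_trace_delta (Ubar s p F 1 :: real \<Rightarrow> 'a \<Rightarrow> real) 1"

end

theory Submission
  imports Defs
begin

text \<open>
  Testing the difference of the two gradient-flow inclusions with the positive part of the
  difference of two solutions shows that the \<open>L\<^sup>2\<close> norm of this positive part does not increase.
  Hence \<open>u\<close> stays below \<open>U\<^sub>M\<close>, started at time 1, as soon as \<open>M\<close> is so large that \<open>u\<^sub>0 \<le> U\<^sub>M(\<cdot>, 1)\<close>;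
  and it stays above \<open>U\<^sub>M\<close> as soon as \<open>U\<^sub>M(\<cdot>, t\<^sub>1) \<le> u(\<cdot>, t\<^sub>1)\<close> at a single time \<open>t\<^sub>1\<close>.

  For the latter let \<open>bar x = (1 + |x|\<^sup>2)\<close> to the power \<open>- (N + sp) / 2\<close>, on which the operator is
  bounded by a multiple of \<open>bar\<close>. A set of positive measure on which \<open>u\<close> is not small acts on every
  point \<open>x\<close> as a source of strength at least a multiple of \<open>bar x\<close>, so \<open>\<eta> t bar\<close> is a lower barrier for
  \<open>u\<close> at small times. Conversely \<open>F(|x|) \<le> K bar x\<close>, by comparing the self-similar solution outside the
  unit ball with a multiple of \<open>bar\<close> that grows in time. As \<open>U\<^sub>M(x, t) = M U\<^sub>1(x, M\<^bsup>p-2\<^esup> t)\<close>, it then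
  suffices to take \<open>M\<close> small.
\<close>

section \<open>Lipschitz functions with nonpositive derivative almost everywhere\<close>

text \<open>A solution is only a curve in \<open>L2\<close>, Lipschitz away from time 0, that
  satisfies its inclusion at almost every time. Hence super- and subsolution properties appear only
  as inequalities for \<open>eform\<close> tested with a positive part, and solutions are ordered
  only almost everywhere. The exponent N + sp is that of the kernel: a bounded source seen from far
  away has exactly this decay, and the profile inherits the same rate, so one function serves as
  lower barrier for \<open>u\<close> and as upper bound for F. The obstacle is to bound the operator
  on \<open>bar\<close> by \<open>bar\<close> itself. Near the diagonal a single term has size |h|
  to the power p - 1, which is not integrable against the kernel when s is close to 1. Pairing h
  with -h improves this to |h| to the power p, and s < 1 is exactly what makes that integrable. The
  upper comparison starts \<open>U_M\<close> at time 1 because at time 0 it concentrates to a Dirac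
  mass and cannot dominate a bounded datum. The inequalities with the mass of \<open>u0\<close> are
  built into the choice of M1 and M2, as a minimum and a maximum with that mass.\<close>

lemma local_decrease_imp_le:
  fixes G :: "real \<Rightarrow> real"
  assumes ab: "a \<le> b" and cont: "continuous_on {a..b} G"
    and loc: "\<And>t. a \<le> t \<Longrightarrow> t < b \<Longrightarrow> \<exists>d>0. \<forall>h\<in>{0<..<d}. G (t + h) \<le> G t"
  shows "G b \<le> G a"
proof -
  define S where "S = {t \<in> {a..b}. G t \<le> G a}"
  have cl: "closed S"
  proof -
    have "S = {a..b} \<inter> G -` {..G a}" by (auto simp: S_def)
    then show ?thesis using continuous_closed_preimage[OF cont] by auto
  qed
  have aS: "a \<in> S" using ab by (auto simp: S_def)
  have bdd: "bdd_above S" by (auto simp: S_def bdd_above_def)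
  have m: "Sup S \<in> S" using closed_contains_Sup[OF _ bdd cl] aS by auto
  \<comment> \<open>Otherwise the local decrease to the right of the supremum would put a larger
    point into \<open>S\<close>.\<close>
  have "Sup S = b"
  proof (rule ccontr)
    assume "Sup S \<noteq> b"
    with m have lt: "Sup S < b" "a \<le> Sup S" by (auto simp: S_def)
    obtain d where d: "d > 0" "\<forall>h\<in>{0<..<d}. G (Sup S + h) \<le> G (Sup S)"
      using loc[OF lt(2,1)] by auto
    define h where "h = min (d/2) (b - Sup S)"
    have h: "0 < h" "h < d" "Sup S + h \<le> b" using d lt by (auto simp: h_def min_def)
    have "Sup S + h \<in> S" using h d m lt by (force simp: S_def)
    then have "Sup S + h \<le> Sup S" by (rule cSup_upper[OF _ bdd])
    with h show False by simp
  qed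
  with m show ?thesis by (auto simp: S_def)
qed

text \<open>The exceptional null set is covered by an open set \<open>U\<close> of small measure, and the
  measure of \<open>U \<inter> [a, t]\<close> compensates the increments of \<open>g\<close> there.\<close>
lemma Lipschitz_AE_deriv_nonpos_imp_le:
  fixes g :: "real \<Rightarrow> real"
  assumes ab: "a \<le> b"
    and lip: "\<And>x y. x \<in> {a..b} \<Longrightarrow> y \<in> {a..b} \<Longrightarrow> \<bar>g x - g y\<bar> \<le> L * \<bar>x - y\<bar>"
    and ae: "AE t in lborel. t \<in> {a<..<b} \<longrightarrow> (\<exists>D\<le>0. (g has_real_derivative D) (at t))"
  shows "g b \<le> g a"
proof -
  define L' where "L' = max L 0"
  have lip': "\<bar>g x - g y\<bar> \<le> L' * \<bar>x - y\<bar>" if "x \<in> {a..b}" "y \<in> {a..b}" for x y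
    using lip[OF that] mult_right_mono[of L L' "\<bar>x - y\<bar>"] by (auto simp: L'_def)
  have L'0: "L' \<ge> 0" by (simp add: L'_def)
  have *: "g b \<le> g a + L' * e + e * (b - a)" if e: "e > 0" for e
  proof -
    from ae obtain N where N: "{t \<in> space lborel. \<not> (t \<in> {a<..<b} \<longrightarrow> (\<exists>D\<le>0. (g has_real_derivative D) (at t)))} \<subseteq> N"
      "emeasure lborel N = 0" "N \<in> sets lborel"
      by (auto elim: AE_E)
    \<comment> \<open>The left endpoint joins the exceptional set: the derivative is known only on
      the open interval, whereas \<open>local_decrease_imp_le\<close> also asks about
      \<open>t = a\<close>.\<close>
    have Nb: "insert a N \<in> sets borel" using N by auto
    have N0: "emeasure lborel (insert a N) = 0"
    proof -
      have "N \<in> null_sets lborel" "{a} \<in> null_sets lborel" using N by auto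
      then have "{a} \<union> N \<in> null_sets lborel" by (rule null_sets.Un[rotated])
      then show ?thesis by auto
    qed
    obtain U where U: "open U" "insert a N \<subseteq> U" "emeasure lborel (U - insert a N) < ennreal e"
      using outer_regular_lborel[OF Nb e] by auto
    have Ub[measurable]: "U \<in> sets borel" using U by auto
    have mU: "emeasure lborel U \<le> ennreal e"
    proof -
      have "emeasure lborel U \<le> emeasure lborel ((U - insert a N) \<union> insert a N)"
        by (rule emeasure_mono) (use sets.Un[OF sets.Diff[OF Ub Nb] Nb] in auto)
      also have "\<dots> \<le> emeasure lborel (U - insert a N) + emeasure lborel (insert a N)"
        by (rule emeasure_subadditive) (use Nb in auto)
      finally show ?thesis using U N0 by (auto simp: less_imp_le)
    qed
    define m where "m t = measure lborel (U \<inter> {a..t})" for t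
    have fin: "U \<inter> {x..y} \<in> fmeasurable lborel" for x y
      by (rule fmeasurableI2[of "{x..y}"]) (auto simp: fmeasurable_def emeasure_lborel_Icc_eq)
    have mm: "m y - m x = measure lborel (U \<inter> {x<..y})" if "a \<le> x" "x \<le> y" for x y
    proof -
      have sub: "U \<inter> {a..x} \<subseteq> U \<inter> {a..y}" using that by auto
      have "U \<inter> {x<..y} = (U \<inter> {a..y}) - (U \<inter> {a..x})" using that by auto
      then have "measure lborel (U \<inter> {x<..y}) = measure lborel (U \<inter> {a..y}) - measure lborel (U \<inter> {a..x})"
        using measurable_measure_Diff[OF fin _ sub] fin[of a x] by (simp add: fmeasurableD)
      then show ?thesis by (simp add: m_def)
    qed
    have m1: "0 \<le> m y - m x \<and> m y - m x \<le> y - x" if "a \<le> x" "x \<le> y" for x y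
    proof -
      have "measure lborel (U \<inter> {x<..y}) \<le> measure lborel {x<..y}"
        by (rule measure_mono_fmeasurable) (use that in \<open>auto simp: fmeasurable_def\<close>)
      then show ?thesis using mm[OF that] that by simp
    qed
    \<comment> \<open>Two penalties, one for each kind of point. Inside the open set
      \<open>U\<close> the function \<open>m\<close> grows at unit rate, so \<open>L' * m\<close>
      pays for the Lipschitz growth of \<open>g\<close>; outside \<open>U\<close> the derivative of
      \<open>g\<close> is nonpositive and \<open>e * t\<close> pays for the error of the difference
      quotient.\<close>
    define G where "G t = g t - L' * m t - e * t" for t
    have cont_g: "continuous_on {a..b} g"
    proof (rule continuous_onI)
      fix x d assume x: "x \<in> {a..b}" and d: "(d::real) > 0"
      show "\<exists>da>0. \<forall>x'\<in>{a..b}. dist x' x < da \<longrightarrow> dist (g x') (g x) \<le> d"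
      proof (intro exI[of _ "d / (L' + 1)"] conjI ballI impI)
        show "0 < d / (L' + 1)" using d L'0 by simp
        fix x' assume x': "x' \<in> {a..b}" "dist x' x < d / (L' + 1)"
        have "\<bar>g x' - g x\<bar> \<le> L' * \<bar>x' - x\<bar>" using lip'[OF x'(1) x] .
        also have "\<dots> \<le> L' * (d / (L' + 1))" using x' L'0 by (intro mult_left_mono) (auto simp: dist_real_def)
        also have "\<dots> \<le> d" using d L'0 by (simp add: field_simps)
        finally show "dist (g x') (g x) \<le> d" by (simp add: dist_real_def)
      qed
    qed
    have cont_m: "continuous_on {a..b} m"
    proof (rule continuous_onI)
      fix x d assume x: "x \<in> {a..b}" and d: "(d::real) > 0"
      show "\<exists>da>0. \<forall>x'\<in>{a..b}. dist x' x < da \<longrightarrow> dist (m x') (m x) \<le> d"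
      proof (intro exI[of _ d] conjI ballI impI d)
        fix x' assume x': "x' \<in> {a..b}" "dist x' x < d"
        show "dist (m x') (m x) \<le> d"
          using m1[of x x'] m1[of x' x] x x' by (cases "x \<le> x'") (auto simp: dist_real_def)
      qed
    qed
    have "G b \<le> G a"
    proof (rule local_decrease_imp_le[OF ab])
      show "continuous_on {a..b} G" unfolding G_def using cont_g cont_m by (auto intro!: continuous_intros)
      fix t assume t: "a \<le> t" "t < b"
      show "\<exists>d>0. \<forall>h\<in>{0<..<d}. G (t + h) \<le> G t"
      proof (cases "t \<in> U")
        case True
        then obtain r where r: "r > 0" "ball t r \<subseteq> U" using U by (meson open_contains_ball)
        show ?thesis
        proof (intro exI[of _ "min r (b - t)"] conjI ballI)
          show "0 < min r (b - t)" using r t by auto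
          fix h assume h: "h \<in> {0<..<min r (b - t)}"
          have "{t<..t+h} \<subseteq> U" using r h by (force simp: subset_iff dist_real_def)
          then have "U \<inter> {t<..t+h} = {t<..t+h}" by auto
          then have "m (t + h) - m t = h" using mm[of t "t + h"] t h by simp
          moreover have "g (t + h) - g t \<le> L' * h" using lip'[of "t + h" t] t h by auto
          ultimately have "g (t + h) - g t \<le> L' * (m (t + h) - m t)" by simp
          moreover have "e * (t + h) \<ge> e * t" using e h by simp
          ultimately show "G (t + h) \<le> G t" unfolding G_def by (simp add: algebra_simps)
        qed
      next
        case False
        then have "t \<notin> insert a N" using U by auto
        then have "t \<in> {a<..<b}" "t \<notin> N" using t by auto
        then obtain D where D: "D \<le> 0" "(g has_real_derivative D) (at t)" using N by auto
        have "\<forall>\<^sub>F h in at 0. \<bar>(g (t + h) - g t) / h - D\<bar> < e"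
          using D(2) e unfolding DERIV_def tendsto_iff dist_real_def by auto
        then obtain r where r: "r > 0" "\<And>h. h \<noteq> 0 \<Longrightarrow> \<bar>h\<bar> < r \<Longrightarrow> \<bar>(g (t + h) - g t) / h - D\<bar> < e"
          by (auto simp: eventually_at dist_real_def)
        show ?thesis
        proof (intro exI[of _ r] conjI ballI r(1))
          fix h assume h: "h \<in> {0<..<r}"
          have "(g (t + h) - g t) / h < e" using r(2)[of h] h D by auto
          then have "g (t + h) - g t \<le> e * h" using h by (simp add: field_simps)
          moreover have "L' * (m (t + h) - m t) \<ge> 0" using m1[of t "t + h"] L'0 t h by auto
          ultimately show "G (t + h) \<le> G t" unfolding G_def by (simp add: algebra_simps)
        qed
      qed
    qed
    moreover have "m b \<le> e"
    proof -
      have "emeasure lborel (U \<inter> {a..b}) \<le> ennreal e"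
        using mU by (rule order_trans[OF emeasure_mono, rotated -1]) auto
      then show ?thesis unfolding m_def measure_def using e by (simp add: enn2real_leI)
    qed
    then have "L' * m b \<le> L' * e" using L'0 by (rule mult_left_mono)
    moreover have "0 \<le> L' * m a" using L'0 by (simp add: m_def)
    ultimately show ?thesis
      unfolding G_def by (simp add: right_diff_distrib)
  qed
  have "g b \<le> g a + e" if e: "e > 0" for e
  proof -
    \<comment> \<open>The total error is \<open>(c - 1)\<close> times the chosen accuracy, so
      accuracy \<open>e / c\<close> leaves less than \<open>e\<close>; the summand 1 keeps
      \<open>c\<close> positive.\<close>
    define c where "c = L' + (b - a) + 1"
    have c: "c > 0" using L'0 ab by (simp add: c_def)
    then have "g b \<le> g a + (c - 1) * (e / c)"
      using *[of "e / c"] e by (simp add: c_def algebra_simps add_divide_distrib diff_divide_distrib)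
    also have "(c - 1) * (e / c) \<le> e" using c e by (simp add: field_simps)
    finally show ?thesis by simp
  qed
  then show ?thesis by (rule field_le_epsilon)
qed

section \<open>Square-integrable functions and their positive parts\<close>

lemma in_L2_borel [measurable_dest]: "in_L2 f \<Longrightarrow> f \<in> borel_measurable lborel"
  by (simp add: in_L2_def)

lemma in_L2_dominated:
  assumes "in_L2 f" and [measurable]: "g \<in> borel_measurable lborel" and "\<And>x. \<bar>g x\<bar> \<le> \<bar>f x\<bar>"
  shows "in_L2 g"
proof -
  have "integrable lborel (\<lambda>x. (g x)\<^sup>2)"
    by (rule Bochner_Integration.integrable_bound[of _ "\<lambda>x. (f x)\<^sup>2"])
      (use assms in \<open>auto simp: in_L2_def abs_le_square_iff intro!: AE_I2\<close>)
  then show ?thesis by (simp add: in_L2_def)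
qed

lemma in_L2_cmult: "in_L2 f \<Longrightarrow> in_L2 (\<lambda>x. c * f x)"
  by (auto simp: in_L2_def power_mult_distrib)

lemma in_L2_uminus: "in_L2 f \<Longrightarrow> in_L2 (\<lambda>x. - f x)"
  by (auto simp: in_L2_def)

lemma in_L2_mult_integrable:
  assumes f: "in_L2 f" and g: "in_L2 g"
  shows "integrable lborel (\<lambda>x. f x * g x)"
proof (rule Bochner_Integration.integrable_bound[of _ "\<lambda>x. (f x)\<^sup>2 + (g x)\<^sup>2"])
  show "integrable lborel (\<lambda>x. (f x)\<^sup>2 + (g x)\<^sup>2)" using f g by (auto simp: in_L2_def)
  show "(\<lambda>x. f x * g x) \<in> borel_measurable lborel" using f g by (auto simp: in_L2_def)
  show "AE x in lborel. norm (f x * g x) \<le> norm ((f x)\<^sup>2 + (g x)\<^sup>2)"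
  proof (rule AE_I2)
    fix x
    have "2 * \<bar>f x * g x\<bar> \<le> (f x)\<^sup>2 + (g x)\<^sup>2"
      using sum_squares_bound[of "\<bar>f x\<bar>" "\<bar>g x\<bar>"] by (simp add: abs_mult)
    then show "norm (f x * g x) \<le> norm ((f x)\<^sup>2 + (g x)\<^sup>2)" by auto
  qed
qed

lemma in_L2_add:
  assumes f: "in_L2 f" and g: "in_L2 g"
  shows "in_L2 (\<lambda>x. f x + g x)"
proof -
  have "integrable lborel (\<lambda>x. (f x)\<^sup>2 + (g x)\<^sup>2 + 2 * (f x * g x))"
    using in_L2_mult_integrable[OF f g] f g by (auto simp: in_L2_def)
  then show ?thesis using f g by (auto simp: in_L2_def power2_sum algebra_simps)
qed

lemma in_L2_diff:
  assumes f: "in_L2 f" and g: "in_L2 g"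
  shows "in_L2 (\<lambda>x. f x - g x)"
  using in_L2_add[OF f in_L2_uminus[OF g]] by simp

lemma L2norm_nonneg [simp]: "0 \<le> L2norm f"
  by (simp add: L2norm_def)

lemma L2norm_power2: "(L2norm f)\<^sup>2 = (\<integral>x. (f x)\<^sup>2 \<partial>lborel)"
  by (simp add: L2norm_def)

text \<open>Discriminant argument for a nonnegative quadratic in \<open>l\<close>. The absolute
  value stays inside the integral because the remainder in \<open>pos_part_sq_has_derivative\<close>
  is estimated in this form.\<close>

lemma L2_Cauchy_Schwarz_abs:
  assumes f: "in_L2 f" and g: "in_L2 g"
  shows "(\<integral>x. \<bar>f x * g x\<bar> \<partial>lborel) \<le> L2norm f * L2norm g"
proof -
  define A B C where "A = (\<integral>x. (f x)\<^sup>2 \<partial>lborel)" and "B = (\<integral>x. (g x)\<^sup>2 \<partial>lborel)"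
    and "C = (\<integral>x. \<bar>f x * g x\<bar> \<partial>lborel)"
  have pos: "A \<ge> 0" "B \<ge> 0" "C \<ge> 0" by (auto simp: A_def B_def C_def)
  have i: "integrable lborel (\<lambda>x. (f x)\<^sup>2)" "integrable lborel (\<lambda>x. (g x)\<^sup>2)"
    "integrable lborel (\<lambda>x. \<bar>f x * g x\<bar>)"
    using f g in_L2_mult_integrable[OF f g] by (auto simp: in_L2_def)
  have q: "0 \<le> A - 2 * l * C + l\<^sup>2 * B" for l
  proof -
    have "0 \<le> (\<integral>x. (\<bar>f x\<bar> - l * \<bar>g x\<bar>)\<^sup>2 \<partial>lborel)" by simp
    also have "\<dots> = (\<integral>x. (f x)\<^sup>2 - 2 * l * \<bar>f x * g x\<bar> + l\<^sup>2 * (g x)\<^sup>2 \<partial>lborel)"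
      by (intro Bochner_Integration.integral_cong) (auto simp: power2_eq_square algebra_simps abs_mult)
    also have "\<dots> = A - 2 * l * C + l\<^sup>2 * B" using i by (simp add: A_def B_def C_def)
    finally show ?thesis .
  qed
  have "C\<^sup>2 \<le> A * B"
  proof (cases "B = 0")
    case True
    have "C = 0"
    proof (rule ccontr)
      assume "C \<noteq> 0"
      then have "C > 0" using pos by auto
      \<comment> \<open>With \<open>B = 0\<close> the quadratic is affine in \<open>l\<close>; this
        value of \<open>l\<close> makes it equal to -1.\<close>
      then show False using q[of "(A + 1) / (2 * C)"] True pos by (simp add: field_simps)
    qed
    then show ?thesis using True by simp
  next
    case False
    then have "B > 0" using pos by auto
    then show ?thesis using q[of "C / B"] by (simp add: field_simps power2_eq_square)
  qed
  then have "C \<le> sqrt (A * B)" using real_le_rsqrt by blast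
  then show ?thesis by (simp add: L2norm_def A_def B_def C_def real_sqrt_mult)
qed

lemma L2_Cauchy_Schwarz:
  assumes f: "in_L2 f" and g: "in_L2 g"
  shows "\<bar>\<integral>x. f x * g x \<partial>lborel\<bar> \<le> L2norm f * L2norm g"
  using L2_Cauchy_Schwarz_abs[OF f g] integral_abs_bound[of lborel "\<lambda>x. f x * g x"] by linarith

lemma L2norm_triangle:
  assumes f: "in_L2 f" and g: "in_L2 g"
  shows "L2norm (\<lambda>x. f x + g x) \<le> L2norm f + L2norm g"
proof -
  have "(L2norm (\<lambda>x. f x + g x))\<^sup>2 = (\<integral>x. (f x)\<^sup>2 + 2 * (f x * g x) + (g x)\<^sup>2 \<partial>lborel)"
    unfolding L2norm_power2 by (intro Bochner_Integration.integral_cong) (auto simp: power2_eq_square algebra_simps)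
  also have "\<dots> = (L2norm f)\<^sup>2 + 2 * (\<integral>x. f x * g x \<partial>lborel) + (L2norm g)\<^sup>2"
    using f g in_L2_mult_integrable[OF f g] by (simp add: L2norm_power2 in_L2_def)
  also have "\<dots> \<le> (L2norm f + L2norm g)\<^sup>2"
    using L2_Cauchy_Schwarz[OF f g] by (simp add: power2_sum)
  finally show ?thesis by (rule power2_le_imp_le) simp
qed

lemma L2norm_uminus: "L2norm (\<lambda>x. - f x) = L2norm f"
  by (simp add: L2norm_def)

lemma L2norm_minus_commute: "L2norm (\<lambda>x. f x - g x) = L2norm (\<lambda>x. g x - f x)"
  by (simp add: L2norm_def power2_commute)

lemma L2norm_cmult: "L2norm (\<lambda>x. c * f x) = \<bar>c\<bar> * L2norm f"
  by (simp add: L2norm_def power_mult_distrib real_sqrt_mult)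

lemma L2norm_triangle_diff:
  assumes f: "in_L2 f" and g: "in_L2 g"
  shows "L2norm (\<lambda>x. f x - g x) \<le> L2norm f + L2norm g"
  using L2norm_triangle[OF f in_L2_uminus[OF g]] by (simp add: L2norm_uminus)

lemma L2norm_mono:
  assumes f: "in_L2 f" and g: "in_L2 g" and "AE x in lborel. \<bar>g x\<bar> \<le> \<bar>f x\<bar>"
  shows "L2norm g \<le> L2norm f"
  unfolding L2norm_def
  by (intro real_sqrt_le_mono integral_mono_AE) (use assms in \<open>auto simp: in_L2_def abs_le_square_iff\<close>)

lemma in_L2_pos_part: "in_L2 f \<Longrightarrow> in_L2 (\<lambda>x. max 0 (f x))"
  by (rule in_L2_dominated[of f]) (auto simp: in_L2_def)

lemma in_L2_indicator_mult: "in_L2 f \<Longrightarrow> S \<in> sets borel \<Longrightarrow> in_L2 (\<lambda>x. indicator S x * f x)"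
  by (rule in_L2_dominated[of f]) (auto simp: in_L2_def indicator_def)

lemma in_L2_indicator_pos_part: "in_L2 f \<Longrightarrow> S \<in> sets borel \<Longrightarrow> in_L2 (\<lambda>x. indicator S x * max 0 (f x))"
  by (intro in_L2_indicator_mult in_L2_pos_part)

section \<open>The squared \<open>L2\<close> norm of a positive part on a set, and its evolution in
  time\<close>

definition pos_part_sq :: "'a::euclidean_space set \<Rightarrow> ('a \<Rightarrow> real) \<Rightarrow> real" where
  "pos_part_sq S f = (\<integral>x. indicator S x * (max 0 (f x))\<^sup>2 \<partial>lborel)"

lemma pos_part_sq_eq_L2norm: "pos_part_sq S f = (L2norm (\<lambda>x. indicator S x * max 0 (f x)))\<^sup>2"
  unfolding pos_part_sq_def L2norm_power2
  by (intro Bochner_Integration.integral_cong) (auto simp: indicator_def)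

lemma pos_part_sq_integrable:
  assumes "in_L2 f" "S \<in> sets borel"
  shows "integrable lborel (\<lambda>x. indicator S x * (max 0 (f x))\<^sup>2)"
proof -
  have "(\<lambda>x. indicator S x * (max 0 (f x))\<^sup>2) = (\<lambda>x. (indicator S x * max 0 (f x))\<^sup>2 :: real)"
    by (auto simp: indicator_def)
  then show ?thesis using in_L2_indicator_pos_part[OF assms] by (simp add: in_L2_def)
qed

lemma pos_part_sq_eq_0:
  assumes "in_L2 f" "S \<in> sets borel" "pos_part_sq S f = 0"
  shows "AE x in lborel. x \<in> S \<longrightarrow> f x \<le> 0"
proof -
  have "AE x in lborel. indicator S x * (max 0 (f x))\<^sup>2 = (0::real)"
    using assms(3) pos_part_sq_integrable[OF assms(1,2)] unfolding pos_part_sq_def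
    by (subst (asm) integral_nonneg_eq_0_iff_AE) auto
  then show ?thesis by eventually_elim (auto simp: indicator_def max_def split: if_splits)
qed

text \<open>Taking the positive part and restricting to \<open>S\<close> is 1-Lipschitz pointwise,
  hence in \<open>L2\<close>; the second factor comes from writing a difference of squares as a
  product.\<close>

lemma pos_part_sq_Lipschitz:
  assumes f: "in_L2 f" and g: "in_L2 g" and S: "S \<in> sets borel"
  shows "\<bar>pos_part_sq S f - pos_part_sq S g\<bar> \<le> L2norm (\<lambda>x. f x - g x) * (L2norm f + L2norm g)"
proof -
  let ?f = "\<lambda>x. indicator S x * max 0 (f x) :: real" and ?g = "\<lambda>x. indicator S x * max 0 (g x) :: real"
  have L: "in_L2 ?f" "in_L2 ?g" using in_L2_indicator_pos_part f g S by blast+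
  have a: "\<bar>L2norm ?f - L2norm ?g\<bar> \<le> L2norm (\<lambda>x. f x - g x)"
  proof -
    have m: "L2norm (\<lambda>x. ?f x - ?g x) \<le> L2norm (\<lambda>x. f x - g x)"
      by (rule L2norm_mono[OF in_L2_diff[OF f g] in_L2_diff[OF L]]) (auto simp: indicator_def)
    have "L2norm ?f \<le> L2norm (\<lambda>x. ?f x - ?g x) + L2norm ?g"
      using L2norm_triangle[OF in_L2_diff[OF L] L(2)] by simp
    moreover have "L2norm ?g \<le> L2norm (\<lambda>x. ?f x - ?g x) + L2norm ?f"
      using L2norm_triangle[OF in_L2_diff[OF L(2,1)] L(1)] by (simp add: L2norm_minus_commute[of ?g])
    ultimately show ?thesis using m by linarith
  qed
  have b: "L2norm ?f \<le> L2norm f" "L2norm ?g \<le> L2norm g"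
    by (intro L2norm_mono f g L AE_I2; auto simp: indicator_def)+
  have "\<bar>pos_part_sq S f - pos_part_sq S g\<bar> = \<bar>L2norm ?f - L2norm ?g\<bar> * (L2norm ?f + L2norm ?g)"
  proof -
    have "pos_part_sq S f - pos_part_sq S g = (L2norm ?f - L2norm ?g) * (L2norm ?f + L2norm ?g)"
      by (simp add: pos_part_sq_eq_L2norm power2_eq_square algebra_simps)
    then show ?thesis by (simp add: abs_mult)
  qed
  also have "\<dots> \<le> L2norm (\<lambda>x. f x - g x) * (L2norm f + L2norm g)"
    using a b by (intro mult_mono) auto
  finally show ?thesis .
qed

text \<open>The function \<open>(max 0 a)\<^sup>2\<close> is continuously differentiable with
  Lipschitz derivative \<open>2 * max 0 a\<close>, so its first-order Taylor remainder is at most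
  the square of the increment. In the application \<open>q\<close> is the difference quotient in
  time and \<open>d\<close> its limit.\<close>

lemma pos_part_sq_quotient_bound:
  fixes a q d h :: real
  assumes "h \<noteq> 0"
  shows "\<bar>((max 0 (a + h * q))\<^sup>2 - (max 0 a)\<^sup>2) / h - 2 * max 0 a * d\<bar> \<le> \<bar>h\<bar> * q\<^sup>2 + 2 * (max 0 a * \<bar>q - d\<bar>)"
proof -
  let ?b = "h * q"
  have 1: "\<bar>(max 0 (a + b))\<^sup>2 - (max 0 a)\<^sup>2 - 2 * max 0 a * b\<bar> \<le> b\<^sup>2" for b :: real
  proof (cases "a \<ge> 0"; cases "a + b \<ge> 0")
    assume "a \<ge> 0" "a + b \<ge> 0"
    then show ?thesis by (simp add: power2_eq_square algebra_simps)
  next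
    assume *: "a \<ge> 0" "\<not> a + b \<ge> 0"
    have "\<bar>- (a\<^sup>2) - 2 * a * b\<bar> \<le> b\<^sup>2"
    proof -
      have "0 \<le> a * (- (2 * b) - a)" using * by (intro mult_nonneg_nonneg) auto
      moreover have "0 \<le> (a + b)\<^sup>2" by simp
      ultimately show ?thesis by (auto simp: power2_eq_square algebra_simps abs_le_iff)
    qed
    then show ?thesis using * by simp
  next
    assume *: "\<not> a \<ge> 0" "a + b \<ge> 0"
    then have "(a + b)\<^sup>2 \<le> b\<^sup>2" by (intro power_mono) auto
    then show ?thesis using * by simp
  qed auto
  have 2: "((max 0 (a + ?b))\<^sup>2 - (max 0 a)\<^sup>2) / h - 2 * max 0 a * d
     = ((max 0 (a + ?b))\<^sup>2 - (max 0 a)\<^sup>2 - 2 * max 0 a * ?b) / h + 2 * max 0 a * (q - d)"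
    using assms by (simp add: field_simps)
  have "\<bar>((max 0 (a + ?b))\<^sup>2 - (max 0 a)\<^sup>2 - 2 * max 0 a * ?b) / h\<bar> \<le> ?b\<^sup>2 / \<bar>h\<bar>"
    using 1[of ?b] assms by (simp add: abs_divide divide_right_mono)
  also have "\<dots> = \<bar>h\<bar> * q\<^sup>2" using assms
    by (cases "h > 0") (auto simp: power_mult_distrib power2_eq_square field_simps)
  finally have 3: "\<bar>((max 0 (a + ?b))\<^sup>2 - (max 0 a)\<^sup>2 - 2 * max 0 a * ?b) / h\<bar> \<le> \<bar>h\<bar> * q\<^sup>2" .
  have 4: "\<bar>2 * max 0 a * (q - d)\<bar> = 2 * (max 0 a * \<bar>q - d\<bar>)" by (simp add: abs_mult)
  show ?thesis unfolding 2 by (rule order_trans[OF abs_triangle_ineq]) (use 3 4 in linarith)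
qed

text \<open>Integrating the pointwise remainder leaves \<open>\<bar>h\<bar>\<close> times the
  squared norm of the difference quotient, which stays bounded because the quotient converges, plus
  a term linear in its distance \<open>e h\<close> to the limit. Both vanish with
  \<open>h\<close>.\<close>

lemma pos_part_sq_has_derivative:
  fixes f :: "real \<Rightarrow> 'a::euclidean_space \<Rightarrow> real"
  assumes S: "S \<in> sets borel" and f: "\<forall>\<^sub>F h in at 0. in_L2 (f (t + h))" and ft: "in_L2 (f t)" and d: "in_L2 d"
    and lim: "((\<lambda>h. L2norm (\<lambda>x. (f (t + h) x - f t x) / h - d x)) \<longlongrightarrow> 0) (at 0)"
  shows "((\<lambda>t. pos_part_sq S (f t)) has_real_derivative
     2 * (\<integral>x. indicator S x * max 0 (f t x) * d x \<partial>lborel)) (at t)"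
proof -
  let ?D = "2 * (\<integral>x. indicator S x * max 0 (f t x) * d x \<partial>lborel)"
  define e where "e h = L2norm (\<lambda>x. (f (t + h) x - f t x) / h - d x)" for h
  have bound: "\<forall>\<^sub>F h in at 0. norm ((pos_part_sq S (f (t + h)) - pos_part_sq S (f t)) / h - ?D)
     \<le> \<bar>h\<bar> * (e h + L2norm d)\<^sup>2 + 2 * (L2norm (f t) * e h)"
    using f eventually_neq_at_within[of 0 0 UNIV]
  proof eventually_elim
    case (elim h)
    have h0: "h \<noteq> 0" using elim by auto
    define q where "q x = (f (t + h) x - f t x) / h" for x
    have q: "in_L2 q" unfolding q_def
      using in_L2_cmult[OF in_L2_diff[OF elim(1) ft], of "1/h"] by simp
    have fq: "f (t + h) x = f t x + h * q x" for x using h0 by (simp add: q_def)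
    have qd: "in_L2 (\<lambda>x. q x - d x)" using in_L2_diff[OF q d] .
    have eq: "e h = L2norm (\<lambda>x. q x - d x)" by (simp add: e_def q_def)
    have i1: "integrable lborel (\<lambda>x. indicator S x * (max 0 (f (t+h) x))\<^sup>2)"
      "integrable lborel (\<lambda>x. indicator S x * (max 0 (f t x))\<^sup>2)"
      using pos_part_sq_integrable[OF _ S] elim ft by auto
    have i2: "integrable lborel (\<lambda>x. indicator S x * max 0 (f t x) * d x)"
      using in_L2_mult_integrable[OF in_L2_indicator_pos_part[OF ft S] d] .
    have abs: "in_L2 (\<lambda>x. \<bar>q x - d x\<bar>)" using qd by (auto simp: in_L2_def)
    have i3: "integrable lborel (\<lambda>x. max 0 (f t x) * \<bar>q x - d x\<bar>)"
      using in_L2_mult_integrable[OF in_L2_pos_part[OF ft] abs] .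
    have I: "(pos_part_sq S (f (t + h)) - pos_part_sq S (f t)) / h - ?D
       = (\<integral>x. (indicator S x * (max 0 (f (t+h) x))\<^sup>2 - indicator S x * (max 0 (f t x))\<^sup>2) / h
           - 2 * (indicator S x * max 0 (f t x) * d x) \<partial>lborel)"
      unfolding pos_part_sq_def using i1 i2 by simp
    have "norm ((pos_part_sq S (f (t + h)) - pos_part_sq S (f t)) / h - ?D) \<le> (\<integral>x. \<bar>h\<bar> * (q x)\<^sup>2 + 2 * (max 0 (f t x) * \<bar>q x - d x\<bar>) \<partial>lborel)"
      unfolding I
    proof (rule Bochner_Integration.integral_norm_bound_integral)
      show "integrable lborel (\<lambda>x. (indicator S x * (max 0 (f (t+h) x))\<^sup>2 - indicator S x * (max 0 (f t x))\<^sup>2) / h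
           - 2 * (indicator S x * max 0 (f t x) * d x))" using i1 i2 by auto
      show "integrable lborel (\<lambda>x. \<bar>h\<bar> * (q x)\<^sup>2 + 2 * (max 0 (f t x) * \<bar>q x - d x\<bar>))"
        using q i3 by (auto simp: in_L2_def)
      fix x
      show "norm ((indicator S x * (max 0 (f (t+h) x))\<^sup>2 - indicator S x * (max 0 (f t x))\<^sup>2) / h
           - 2 * (indicator S x * max 0 (f t x) * d x)) \<le> \<bar>h\<bar> * (q x)\<^sup>2 + 2 * (max 0 (f t x) * \<bar>q x - d x\<bar>)"
      proof (cases "x \<in> S")
        case True
        then show ?thesis using pos_part_sq_quotient_bound[OF h0, of "f t x" "q x" "d x"]
          by (simp add: fq mult.assoc)
      qed (auto intro!: add_nonneg_nonneg)
    qed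
    also have "\<dots> = \<bar>h\<bar> * (L2norm q)\<^sup>2 + 2 * (\<integral>x. \<bar>max 0 (f t x) * \<bar>q x - d x\<bar>\<bar> \<partial>lborel)"
      using q i3 by (simp add: in_L2_def L2norm_power2)
    finally have A: "norm ((pos_part_sq S (f (t + h)) - pos_part_sq S (f t)) / h - ?D)
      \<le> \<bar>h\<bar> * (L2norm q)\<^sup>2 + 2 * (\<integral>x. \<bar>max 0 (f t x) * \<bar>q x - d x\<bar>\<bar> \<partial>lborel)" .
    have "(\<integral>x. \<bar>max 0 (f t x) * \<bar>q x - d x\<bar>\<bar> \<partial>lborel) \<le> L2norm (\<lambda>x. max 0 (f t x)) * L2norm (\<lambda>x. \<bar>q x - d x\<bar>)"
      by (rule L2_Cauchy_Schwarz_abs[OF in_L2_pos_part[OF ft] abs])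
    also have "L2norm (\<lambda>x. \<bar>q x - d x\<bar>) = e h" by (simp add: eq L2norm_def)
    also have "L2norm (\<lambda>x. max 0 (f t x)) * e h \<le> L2norm (f t) * e h"
      by (intro mult_right_mono L2norm_mono in_L2_pos_part ft) (auto simp: e_def)
    finally have B: "(\<integral>x. \<bar>max 0 (f t x) * \<bar>q x - d x\<bar>\<bar> \<partial>lborel) \<le> L2norm (f t) * e h" .
    have "(L2norm q)\<^sup>2 \<le> (e h + L2norm d)\<^sup>2"
      using L2norm_triangle[OF qd d] by (intro power_mono) (auto simp: eq)
    then have "\<bar>h\<bar> * (L2norm q)\<^sup>2 \<le> \<bar>h\<bar> * (e h + L2norm d)\<^sup>2" by (rule mult_left_mono) simp
    with A B show ?case by linarith
  qed
  have "((\<lambda>h. \<bar>h\<bar> * (e h + L2norm d)\<^sup>2 + 2 * (L2norm (f t) * e h)) \<longlongrightarrow> \<bar>0\<bar> * (0 + L2norm d)\<^sup>2 + 2 * (L2norm (f t) * 0)) (at 0)"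
    using lim unfolding e_def[symmetric] by (intro tendsto_intros)
  then have e0: "((\<lambda>h. \<bar>h\<bar> * (e h + L2norm d)\<^sup>2 + 2 * (L2norm (f t) * e h)) \<longlongrightarrow> 0) (at 0)"
    by simp
  have "((\<lambda>h. (pos_part_sq S (f (t + h)) - pos_part_sq S (f t)) / h - ?D) \<longlongrightarrow> 0) (at 0)"
    by (rule Lim_null_comparison[OF bound e0])
  then show ?thesis unfolding DERIV_def by (rule LIM_zero_cancel)
qed

text \<open>Monotonicity is first shown on \<open>{a..b}\<close> for each \<open>a > 0\<close>,
  where the curve is Lipschitz, and then \<open>a\<close> tends to 0. The set \<open>S\<close> is
  the whole space when comparing flows and the exterior of the unit ball for the tail of the
  profile.\<close>

lemma pos_part_sq_decay:
  fixes f :: "real \<Rightarrow> 'a::euclidean_space \<Rightarrow> real"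
  assumes S: "S \<in> sets borel" and f: "\<And>t. 0 < t \<Longrightarrow> in_L2 (f t)"
    and lip: "\<And>a. 0 < a \<Longrightarrow> a \<le> b \<Longrightarrow> \<exists>L. \<forall>t1\<in>{a..b}. \<forall>t2\<in>{a..b}. L2norm (\<lambda>x. f t1 x - f t2 x) \<le> L * \<bar>t1 - t2\<bar>"
    and ae: "AE t in lborel. t \<in> {0<..<b} \<longrightarrow> (\<exists>d. in_L2 d \<and>
        ((\<lambda>h. L2norm (\<lambda>x. (f (t + h) x - f t x) / h - d x)) \<longlongrightarrow> 0) (at 0) \<and>
        (\<integral>x. indicator S x * max 0 (f t x) * d x \<partial>lborel) \<le> 0)"
    and lim: "((\<lambda>t. pos_part_sq S (f t)) \<longlongrightarrow> 0) (at_right 0)"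
    and b: "0 < b"
  shows "AE x in lborel. x \<in> S \<longrightarrow> f b x \<le> 0"
proof -
  let ?g = "\<lambda>t. pos_part_sq S (f t)"
  have mono: "?g b \<le> ?g a" if a: "0 < a" "a \<le> b" for a
  proof -
    obtain L where L: "\<forall>t1\<in>{a..b}. \<forall>t2\<in>{a..b}. L2norm (\<lambda>x. f t1 x - f t2 x) \<le> L * \<bar>t1 - t2\<bar>"
      using lip[OF a] by auto
    \<comment> \<open>A Lipschitz curve is bounded on \<open>{a..b}\<close>; this bound turns the
      product in \<open>pos_part_sq_Lipschitz\<close> into a genuine Lipschitz estimate.\<close>
    define K where "K = L2norm (f b) + \<bar>L\<bar> * (b - a)"
    have bd: "L2norm (f t) \<le> K" if t: "t \<in> {a..b}" for t
    proof -
      have "L2norm (f t) \<le> L2norm (\<lambda>x. f t x - f b x) + L2norm (f b)"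
        using L2norm_triangle[OF in_L2_diff[OF f f] f, of t b b] t a by simp
      also have "L2norm (\<lambda>x. f t x - f b x) \<le> L * \<bar>t - b\<bar>" using bspec[OF bspec[OF L t], of b] a by simp
      also have "\<dots> \<le> \<bar>L\<bar> * (b - a)" using t by (intro mult_mono) auto
      finally show ?thesis by (simp add: K_def)
    qed
    show ?thesis
    proof (rule Lipschitz_AE_deriv_nonpos_imp_le[OF a(2), of _ "\<bar>L\<bar> * (2 * K)"])
      fix x y assume xy: "x \<in> {a..b}" "y \<in> {a..b}"
      have "\<bar>?g x - ?g y\<bar> \<le> L2norm (\<lambda>z. f x z - f y z) * (L2norm (f x) + L2norm (f y))"
        using xy a by (intro pos_part_sq_Lipschitz S f) auto
      also have "\<dots> \<le> (\<bar>L\<bar> * \<bar>x - y\<bar>) * (K + K)"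
      proof (intro mult_mono add_mono bd xy)
        have "L2norm (\<lambda>z. f x z - f y z) \<le> L * \<bar>x - y\<bar>" using L xy by auto
        also have "\<dots> \<le> \<bar>L\<bar> * \<bar>x - y\<bar>" by (intro mult_right_mono) auto
        finally show "L2norm (\<lambda>z. f x z - f y z) \<le> \<bar>L\<bar> * \<bar>x - y\<bar>" .
      qed auto
      finally show "\<bar>?g x - ?g y\<bar> \<le> \<bar>L\<bar> * (2 * K) * \<bar>x - y\<bar>" by (simp add: algebra_simps)
    next
      show "AE t in lborel. t \<in> {a<..<b} \<longrightarrow> (\<exists>D\<le>0. (?g has_real_derivative D) (at t))"
        using ae
      proof eventually_elim
        case (elim t)
        show ?case
        proof
          assume t: "t \<in> {a<..<b}"
          then obtain d where d: "in_L2 d" "((\<lambda>h. L2norm (\<lambda>x. (f (t + h) x - f t x) / h - d x)) \<longlongrightarrow> 0) (at 0)"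
            "(\<integral>x. indicator S x * max 0 (f t x) * d x \<partial>lborel) \<le> 0" using elim a by auto
          have "\<forall>\<^sub>F h in at 0. in_L2 (f (t + h))"
            unfolding eventually_at using t a by (intro exI[of _ t]) (auto simp: dist_real_def intro!: f)
          from pos_part_sq_has_derivative[OF S this _ d(1,2)] d(3) t a f[of t]
          show "\<exists>D\<le>0. (?g has_real_derivative D) (at t)" by (intro exI conjI) auto
        qed
      qed
    qed
  qed
  have "?g b \<le> 0"
  proof (rule tendsto_lowerbound[OF lim])
    show "\<forall>\<^sub>F a in at_right 0. ?g b \<le> ?g a"
      unfolding eventually_at_right_field using mono b by (intro exI[of _ b]) auto
  qed auto
  moreover have "?g b \<ge> 0" by (simp add: pos_part_sq_eq_L2norm)
  ultimately show ?thesis using pos_part_sq_eq_0[OF f[OF b] S] by linarith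
qed

section \<open>The energy form and the subdifferential\<close>

definition Phi :: "real \<Rightarrow> real \<Rightarrow> real" where
  "Phi p z = \<bar>z\<bar> powr (p - 2) * z"

lemma Phi_0 [simp]: "Phi p 0 = 0" by (simp add: Phi_def)

lemma Phi_uminus [simp]: "Phi p (- z) = - Phi p z" by (simp add: Phi_def)

lemma Phi_nonneg: "0 \<le> z \<Longrightarrow> Phi p z = z powr (p - 1)"
  using powr_mult_base[of z "p - 2"] by (cases "z = 0") (auto simp: Phi_def mult.commute algebra_simps)

lemma abs_Phi: "\<bar>Phi p z\<bar> = \<bar>z\<bar> powr (p - 1)"
  using Phi_nonneg[of "\<bar>z\<bar>" p] by (simp add: Phi_def abs_mult)

lemma Phi_mult_self: "Phi p z * z = \<bar>z\<bar> powr p"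
proof -
  have "Phi p z * z = \<bar>z\<bar> * (\<bar>z\<bar> * \<bar>z\<bar> powr (p - 2))" by (simp add: Phi_def abs_mult_self_eq algebra_simps)
  also have "\<dots> = \<bar>z\<bar> powr p" by (cases "z = 0") (auto simp: powr_mult_base)
  finally show ?thesis .
qed

lemma Phi_scale: "0 < c \<Longrightarrow> Phi p (c * z) = c powr (p - 1) * Phi p z"
  using Phi_nonneg[of c p] by (simp add: Phi_def abs_mult powr_mult)

lemma Phi_mono:
  assumes p: "p > 2" and ab: "a \<le> b"
  shows "Phi p a \<le> Phi p b"
proof -
  have *: "Phi p a \<le> Phi p b" if "0 \<le> a" "a \<le> b" for a b
    using that p by (simp add: Phi_nonneg powr_mono2)
  consider "0 \<le> a" | "b \<le> 0" | "a < 0" "0 < b" by linarith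
  then show ?thesis
  proof cases
    case 1 then show ?thesis using * ab by auto
  next
    case 2 then show ?thesis using *[of "-b" "-a"] ab by auto
  next
    case 3 
    then have "Phi p b \<ge> 0" "Phi p (-a) \<ge> 0" using Phi_nonneg[of b p] Phi_nonneg[of "-a" p] by auto
    then show ?thesis by simp
  qed
qed

lemma Phi_le_abs:
  assumes "p > 2" "\<bar>z\<bar> \<le> 1" shows "\<bar>Phi p z\<bar> \<le> \<bar>z\<bar>"
proof (cases "z = 0")
  case False
  then show ?thesis using assms powr_mono'[of 1 "p - 1" "\<bar>z\<bar>"] by (simp add: abs_Phi)
qed simp

lemma continuous_Phi: "p > 2 \<Longrightarrow> isCont (Phi p) z"
  unfolding Phi_def continuous_at
  by (intro tendsto_intros tendsto_powr') auto

lemma Phi_measurable [measurable]: "Phi p \<in> borel_measurable borel"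
  unfolding Phi_def by measurable

text \<open>Mean value theorem for arguments of equal sign; for opposite signs the path goes through
  0, where \<open>\<bar>a - b\<bar>\<close> splits into
  \<open>\<bar>a\<bar> + \<bar>b\<bar>\<close>. The degenerate factor \<open>m powr (p - 2)\<close>
  matters: near the diagonal it supplies the power p - 2 of |h|.\<close>

lemma Phi_Lipschitz:
  assumes p: "p > 2" and "\<bar>a\<bar> \<le> m" "\<bar>b\<bar> \<le> m"
  shows "\<bar>Phi p a - Phi p b\<bar> \<le> (p - 1) * m powr (p - 2) * \<bar>a - b\<bar>"
proof -
  have pos: "\<bar>Phi p a - Phi p b\<bar> \<le> (p - 1) * m powr (p - 2) * \<bar>a - b\<bar>" if ab: "0 < b" "b \<le> a" "a \<le> m" for a b
  proof (cases "a = b")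
    case False
    then have lt: "b < a" using ab by simp
    have "\<exists>z>b. z < a \<and> a powr (p - 1) - b powr (p - 1) = (a - b) * ((p - 1) * z powr (p - 1 - 1))"
      by (rule MVT2[OF lt], rule has_real_derivative_powr) (use ab in auto)
    then obtain z where z: "b < z" "z < a" "a powr (p - 1) - b powr (p - 1) = (a - b) * ((p - 1) * z powr (p - 2))"
      by auto
    have "z powr (p - 2) \<le> m powr (p - 2)" using z ab p by (intro powr_mono2) auto
    then have "(a - b) * ((p - 1) * z powr (p - 2)) \<le> (a - b) * ((p - 1) * m powr (p - 2))"
      using lt p by (intro mult_left_mono) auto
    moreover have "Phi p b \<le> Phi p a" using Phi_mono[OF p] lt by auto
    ultimately show ?thesis using z ab lt by (simp add: Phi_nonneg algebra_simps)
  qed simp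
  have zero: "\<bar>Phi p a\<bar> \<le> (p - 1) * m powr (p - 2) * \<bar>a\<bar>" if a: "\<bar>a\<bar> \<le> m" for a
  proof -
    have "\<bar>Phi p a\<bar> = \<bar>a\<bar> powr (p - 2) * \<bar>a\<bar>" by (simp add: Phi_def abs_mult)
    also have "\<dots> \<le> m powr (p - 2) * \<bar>a\<bar>" using a p by (intro mult_right_mono powr_mono2) auto
    also have "\<dots> \<le> ((p - 1) * m powr (p - 2)) * \<bar>a\<bar>"
      using p mult_right_mono[of 1 "p - 1" "m powr (p - 2)"] by (intro mult_right_mono) auto
    finally show ?thesis .
  qed
  consider "0 < a" "0 < b" | "a < 0" "b < 0" | "0 \<le> a" "b \<le> 0" | "a \<le> 0" "0 \<le> b" by linarith
  then show ?thesis
  proof cases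
    case 1 then show ?thesis using pos[of a b] pos[of b a] assms by (cases "a \<le> b") (auto simp: abs_minus_commute)
  next
    case 2 then show ?thesis using pos[of "-a" "-b"] pos[of "-b" "-a"] assms by (cases "a \<le> b") (auto simp: abs_minus_commute)
  next
    case 3 
    then have "\<bar>a - b\<bar> = \<bar>a\<bar> + \<bar>b\<bar>" by auto
    then show ?thesis using zero[OF assms(2)] zero[OF assms(3)] abs_triangle_ineq4[of "Phi p a" "Phi p b"] 
      by (simp add: distrib_left)
  next
    case 4
    then have "\<bar>a - b\<bar> = \<bar>a\<bar> + \<bar>b\<bar>" by auto
    then show ?thesis using zero[OF assms(2)] zero[OF assms(3)] abs_triangle_ineq4[of "Phi p a" "Phi p b"] 
      by (simp add: distrib_left)
  qed
qed

text \<open>Tangent inequality of the convex function \<open>\<bar>z\<bar> powr p\<close>, whose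
  derivative is \<open>p * Phi p z\<close>; it is Young's inequality with the conjugate exponents p
  and p / (p - 1).\<close>

lemma Phi_convexity:
  assumes p: "p > 2"
  shows "\<bar>z\<bar> powr p - \<bar>a\<bar> powr p \<le> p * (Phi p z * (z - a))"
proof -
  have "\<bar>a\<bar> * \<bar>z\<bar> powr (p - 1) \<le> \<bar>a\<bar> powr p / p + (\<bar>z\<bar> powr (p - 1)) powr (p / (p - 1)) / (p / (p - 1))"
    by (rule Youngs_inequality) (use p in \<open>auto simp: field_simps\<close>)
  also have "(\<bar>z\<bar> powr (p - 1)) powr (p / (p - 1)) = \<bar>z\<bar> powr p" using p by (simp add: powr_powr)
  finally have "p * (\<bar>a\<bar> * \<bar>z\<bar> powr (p - 1)) \<le> \<bar>a\<bar> powr p + (p - 1) * \<bar>z\<bar> powr p"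
    using p by (simp add: field_simps)
  moreover have "Phi p z * a \<le> \<bar>a\<bar> * \<bar>z\<bar> powr (p - 1)"
    using abs_Phi[of p z] abs_ge_self[of "Phi p z * a"] by (simp add: abs_mult mult.commute)
  then have "p * (Phi p z * a) \<le> p * (\<bar>a\<bar> * \<bar>z\<bar> powr (p - 1))" using p by simp
  ultimately have "p * (Phi p z * a) \<le> \<bar>a\<bar> powr p + (p - 1) * \<bar>z\<bar> powr p" by linarith
  then show ?thesis using Phi_mult_self[of p z] by (simp add: algebra_simps)
qed

text \<open>Both factors are replaced by the larger of the two moduli. This crude form of Young's
  inequality is enough to make \<open>eform\<close> converge absolutely on functions of finite
  energy.\<close>

lemma Phi_mult_bound:
  assumes p: "p > 2"
  shows "\<bar>Phi p a * b\<bar> \<le> \<bar>a\<bar> powr p + \<bar>b\<bar> powr p"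
proof -
  define m where "m = max \<bar>a\<bar> \<bar>b\<bar>"
  have "\<bar>Phi p a * b\<bar> = \<bar>a\<bar> powr (p - 1) * \<bar>b\<bar>" by (simp add: abs_mult abs_Phi)
  also have "\<dots> \<le> m powr (p - 1) * m" using p by (intro mult_mono powr_mono2) (auto simp: m_def)
  also have "\<dots> = m powr p" using powr_mult_base[of m "p - 1"] by (cases "m = 0") (auto simp: m_def mult.commute)
  also have "\<dots> \<le> \<bar>a\<bar> powr p + \<bar>b\<bar> powr p" by (auto simp: m_def max_def)
  finally show ?thesis .
qed

lemma powr_add_bound:
  fixes a b c :: real
  assumes "0 \<le> p" "\<bar>c\<bar> \<le> \<bar>a\<bar> + \<bar>b\<bar>"
  shows "\<bar>c\<bar> powr p \<le> 2 powr p * (\<bar>a\<bar> powr p + \<bar>b\<bar> powr p)"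
proof -
  define m where "m = max \<bar>a\<bar> \<bar>b\<bar>"
  have "\<bar>c\<bar> powr p \<le> (2 * m) powr p" using assms by (intro powr_mono2) (auto simp: m_def)
  also have "\<dots> = 2 powr p * m powr p" by (simp add: powr_mult m_def)
  also have "\<dots> \<le> 2 powr p * (\<bar>a\<bar> powr p + \<bar>b\<bar> powr p)" by (intro mult_left_mono) (auto simp: m_def max_def)
  finally show ?thesis .
qed

text \<open>At \<open>z = 0\<close> the value is 0, because \<open>0 powr a = 0\<close> and division
  by zero gives 0. This agrees with the convention in the quotient of \<open>Jfun\<close>, so the
  diagonal needs no separate treatment.\<close>

definition kern :: "real \<Rightarrow> 'a::euclidean_space \<Rightarrow> real" where
  "kern a z = 1 / norm z powr a"

lemma kern_nonneg [simp]: "0 \<le> kern a z" by (simp add: kern_def)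
lemma kern_0 [simp]: "kern a 0 = 0" by (simp add: kern_def)
lemma kern_minus [simp]: "kern a (- z) = kern a z" by (simp add: kern_def)
lemma kern_commute: "kern a (x - y) = kern a (y - x)" by (simp add: kern_def norm_minus_commute)

lemma kern_measurable [measurable]: "kern a \<in> borel_measurable borel"
  unfolding kern_def by measurable

section \<open>Finite energy and the energy form on pairs of points\<close>

abbreviation lborel2 :: "('a::euclidean_space \<times> 'a) measure" where
  "lborel2 \<equiv> lborel \<Otimes>\<^sub>M lborel"

definition finite_energy :: "real \<Rightarrow> real \<Rightarrow> ('a::euclidean_space \<Rightarrow> real) \<Rightarrow> bool" where
  "finite_energy a p v \<longleftrightarrow> v \<in> borel_measurable lborel \<and>
     integrable lborel2 (\<lambda>z. \<bar>v (fst z) - v (snd z)\<bar> powr p * kern a (fst z - snd z))"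

text \<open>Since \<open>Jfun\<close> integrates over ordered pairs, this is the form of twice the operator \<open>L\<^sub>s\<^sub>,\<^sub>p\<close>.\<close>
definition eform :: "real \<Rightarrow> real \<Rightarrow> ('a::euclidean_space \<Rightarrow> real) \<Rightarrow> ('a \<Rightarrow> real) \<Rightarrow> real" where
  "eform a p u v = (\<integral>z. Phi p (u (fst z) - u (snd z)) * (v (fst z) - v (snd z)) * kern a (fst z - snd z) \<partial>lborel2)"

text \<open>A normal contraction principle for two functions at once: it makes sums, positive parts
  of differences and truncated differences admissible as test functions.\<close>

lemma finite_energy_dominated:
  assumes f: "finite_energy a p f" and g: "finite_energy a p g" and [measurable]: "h \<in> borel_measurable lborel"
    and p: "0 \<le> p" and le: "\<And>x y. \<bar>h x - h y\<bar> \<le> \<bar>f x - f y\<bar> + \<bar>g x - g y\<bar>"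
  shows "finite_energy a p h"
proof -
  have "integrable lborel2 (\<lambda>z. \<bar>h (fst z) - h (snd z)\<bar> powr p * kern a (fst z - snd z))"
  proof (rule Bochner_Integration.integrable_bound)
    show "integrable lborel2 (\<lambda>z. 2 powr p * (\<bar>f (fst z) - f (snd z)\<bar> powr p * kern a (fst z - snd z)
       + \<bar>g (fst z) - g (snd z)\<bar> powr p * kern a (fst z - snd z)))"
      using f g by (intro integrable_mult_right Bochner_Integration.integrable_add) (auto simp: finite_energy_def)
    show "(\<lambda>z. \<bar>h (fst z) - h (snd z)\<bar> powr p * kern a (fst z - snd z)) \<in> borel_measurable lborel2"
      by measurable
    show "AE z in lborel2. norm (\<bar>h (fst z) - h (snd z)\<bar> powr p * kern a (fst z - snd z)) \<le>
      norm (2 powr p * (\<bar>f (fst z) - f (snd z)\<bar> powr p * kern a (fst z - snd z)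
       + \<bar>g (fst z) - g (snd z)\<bar> powr p * kern a (fst z - snd z)))"
    proof (rule AE_I2)
      fix z :: "'a \<times> 'a"
      have "\<bar>h (fst z) - h (snd z)\<bar> powr p * kern a (fst z - snd z) \<le>
        2 powr p * (\<bar>f (fst z) - f (snd z)\<bar> powr p + \<bar>g (fst z) - g (snd z)\<bar> powr p) * kern a (fst z - snd z)"
        by (intro mult_right_mono powr_add_bound p le) auto
      then show "norm (\<bar>h (fst z) - h (snd z)\<bar> powr p * kern a (fst z - snd z)) \<le>
      norm (2 powr p * (\<bar>f (fst z) - f (snd z)\<bar> powr p * kern a (fst z - snd z)
       + \<bar>g (fst z) - g (snd z)\<bar> powr p * kern a (fst z - snd z)))"
        by (simp add: algebra_simps)
    qed
  qed
  then show ?thesis by (simp add: finite_energy_def)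
qed

lemma finite_energy_measurable [measurable_dest]: "finite_energy a p f \<Longrightarrow> f \<in> borel_measurable lborel"
  by (simp add: finite_energy_def)

lemma finite_energy_cmult: "finite_energy a p f \<Longrightarrow> finite_energy a p (\<lambda>x. c * f x)"
proof -
  assume f: "finite_energy a p f"
  have "(\<lambda>z. \<bar>c * f (fst z) - c * f (snd z)\<bar> powr p * kern a (fst z - snd z))
    = (\<lambda>z. \<bar>c\<bar> powr p * (\<bar>f (fst z) - f (snd z)\<bar> powr p * kern a (fst z - snd z)))"
    by (auto simp: right_diff_distrib[symmetric] abs_mult powr_mult mult.assoc)
  then show ?thesis using f by (auto simp: finite_energy_def)
qed

lemma finite_energy_add:
  "finite_energy a p f \<Longrightarrow> finite_energy a p g \<Longrightarrow> 0 \<le> p \<Longrightarrow> finite_energy a p (\<lambda>x. f x + g x)"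
  by (rule finite_energy_dominated[of a p f g]) (auto simp: finite_energy_def)

lemma eform_integrable:
  assumes f: "finite_energy a p f" and g: "finite_energy a p g" and p: "p > 2"
  shows "integrable lborel2 (\<lambda>z. Phi p (f (fst z) - f (snd z)) * (g (fst z) - g (snd z)) * kern a (fst z - snd z))"
proof (rule Bochner_Integration.integrable_bound)
  note [measurable] = finite_energy_measurable[OF f] finite_energy_measurable[OF g]
  show "integrable lborel2 (\<lambda>z. \<bar>f (fst z) - f (snd z)\<bar> powr p * kern a (fst z - snd z)
       + \<bar>g (fst z) - g (snd z)\<bar> powr p * kern a (fst z - snd z))"
    using f g by (intro Bochner_Integration.integrable_add) (auto simp: finite_energy_def)
  show "(\<lambda>z. Phi p (f (fst z) - f (snd z)) * (g (fst z) - g (snd z)) * kern a (fst z - snd z)) \<in> borel_measurable lborel2"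
    by measurable
  show "AE z in lborel2. norm (Phi p (f (fst z) - f (snd z)) * (g (fst z) - g (snd z)) * kern a (fst z - snd z))
    \<le> norm (\<bar>f (fst z) - f (snd z)\<bar> powr p * kern a (fst z - snd z)
       + \<bar>g (fst z) - g (snd z)\<bar> powr p * kern a (fst z - snd z))"
  proof (rule AE_I2)
    fix z :: "'a \<times> 'a"
    have "\<bar>Phi p (f (fst z) - f (snd z)) * (g (fst z) - g (snd z))\<bar> * kern a (fst z - snd z) \<le>
     (\<bar>f (fst z) - f (snd z)\<bar> powr p + \<bar>g (fst z) - g (snd z)\<bar> powr p) * kern a (fst z - snd z)"
      by (intro mult_right_mono Phi_mult_bound p) auto
    then show "norm (Phi p (f (fst z) - f (snd z)) * (g (fst z) - g (snd z)) * kern a (fst z - snd z))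
    \<le> norm (\<bar>f (fst z) - f (snd z)\<bar> powr p * kern a (fst z - snd z)
       + \<bar>g (fst z) - g (snd z)\<bar> powr p * kern a (fst z - snd z))"
      by (simp add: abs_mult distrib_right)
  qed
qed

lemma Jfun_eq_energy:
  fixes v :: "'a::euclidean_space \<Rightarrow> real"
  assumes [measurable]: "v \<in> borel_measurable lborel" and p: "p > 0"
  shows "Jfun s p v < \<infinity> \<longleftrightarrow> finite_energy (real DIM('a) + s * p) p v"
    and "finite_energy (real DIM('a) + s * p) p v \<Longrightarrow>
      enn2real (Jfun s p v) = (1 / p) * (\<integral>z. \<bar>v (fst z) - v (snd z)\<bar> powr p * kern (real DIM('a) + s * p) (fst z - snd z) \<partial>lborel2)"
proof -
  let ?a = "real DIM('a) + s * p"
  let ?f = "\<lambda>z. \<bar>v (fst z) - v (snd z)\<bar> powr p * kern ?a (fst z - snd z)"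
  have [measurable]: "?f \<in> borel_measurable lborel2" by measurable
  have "(\<integral>\<^sup>+x. \<integral>\<^sup>+y. ennreal (\<bar>v x - v y\<bar> powr p / norm (x - y) powr ?a) \<partial>lborel \<partial>lborel)
      = (\<integral>\<^sup>+x. \<integral>\<^sup>+y. ennreal (?f (x, y)) \<partial>lborel \<partial>lborel)"
    by (simp add: kern_def)
  also have "\<dots> = (\<integral>\<^sup>+z. ennreal (?f z) \<partial>lborel2)"
    by (rule lborel.nn_integral_fst) measurable
  finally have J: "Jfun s p v = ennreal (1 / p) * (\<integral>\<^sup>+z. ennreal (?f z) \<partial>lborel2)"
    by (simp add: Jfun_def)
  have i: "integrable lborel2 ?f \<longleftrightarrow> (\<integral>\<^sup>+z. ennreal (?f z) \<partial>lborel2) < \<infinity>"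
    by (subst integrable_iff_bounded) (simp add: abs_mult)
  have "ennreal (1 / p) * c < \<infinity> \<longleftrightarrow> c < \<infinity>" for c :: ennreal
    using p by (auto simp: ennreal_mult_less_top ennreal_mult_eq_top_iff top.not_eq_extremum[symmetric])
  then show "Jfun s p v < \<infinity> \<longleftrightarrow> finite_energy ?a p v"
    using i assms by (simp add: J finite_energy_def)
  assume "finite_energy ?a p v"
  then have "integrable lborel2 ?f" by (simp add: finite_energy_def)
  then have "(\<integral>\<^sup>+z. ennreal (?f z) \<partial>lborel2) = ennreal (\<integral>z. ?f z \<partial>lborel2)"
    by (intro nn_integral_eq_integral) auto
  then show "enn2real (Jfun s p v) = (1 / p) * (\<integral>z. ?f z \<partial>lborel2)"
    unfolding J using p by (simp add: ennreal_mult[symmetric] enn2real_mult)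
qed

section \<open>Subgradients of the energy as a weak formulation\<close>

lemma subdiffJ_finite_energy:
  fixes v :: "'a::euclidean_space \<Rightarrow> real"
  assumes "subdiffJ s p v w" "p > 2" shows "finite_energy (real DIM('a) + s * p) p v"
  using assms Jfun_eq_energy(1)[of v p s] by (auto simp: subdiffJ_def in_L2_def)

text \<open>The subgradient inequality is used at \<open>v + e * \<psi>\<close> and divided by
  \<open>e\<close>. Applying \<open>Phi_convexity\<close> at the perturbed point bounds the energy
  increment by the form at that point, so no difference quotient of the energy has to be computed;
  dominated convergence then lets \<open>e\<close> tend to 0.\<close>

lemma subdiffJ_le_eform:
  fixes v :: "'a::euclidean_space \<Rightarrow> real"
  assumes sub: "subdiffJ s p v w" and p: "p > 2"
    and \<psi>: "in_L2 \<psi>" "finite_energy (real DIM('a) + s * p) p \<psi>"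
  shows "(\<integral>x. w x * \<psi> x \<partial>lborel) \<le> eform (real DIM('a) + s * p) p v \<psi>"
proof -
  let ?a = "real DIM('a) + s * p"
  have v: "in_L2 v" "in_L2 w" using sub by (auto simp: subdiffJ_def)
  have fv: "finite_energy ?a p v" by (rule subdiffJ_finite_energy[OF sub p])
  have p0: "0 \<le> p" "0 < p" using p by auto
  note [measurable] = in_L2_borel[OF v(1)] in_L2_borel[OF \<psi>(1)]
  let ?b = "\<lambda>z. \<psi> (fst z) - \<psi> (snd z)" and ?v = "\<lambda>z. v (fst z) - v (snd z)"
  let ?k = "\<lambda>z. kern ?a (fst z - snd z)"
  have step: "(\<integral>x. w x * \<psi> x \<partial>lborel) \<le> (\<integral>z. Phi p (?v z + e * ?b z) * ?b z * ?k z \<partial>lborel2)" if e: "e > 0" for e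
  proof -
    define \<phi> where "\<phi> x = v x + e * \<psi> x" for x
    have \<phi>: "in_L2 \<phi>" "finite_energy ?a p \<phi>" unfolding \<phi>_def
      using in_L2_add[OF v(1) in_L2_cmult[OF \<psi>(1)]] finite_energy_add[OF fv finite_energy_cmult[OF \<psi>(2)] p0(1)] by auto
    have "enn2real (Jfun s p \<phi>) \<ge> enn2real (Jfun s p v) + (\<integral>x. w x * (\<phi> x - v x) \<partial>lborel)"
      using sub \<phi> Jfun_eq_energy(1)[of \<phi> p s] p0 by (auto simp: subdiffJ_def in_L2_def)
    moreover have "(\<integral>x. w x * (\<phi> x - v x) \<partial>lborel) = e * (\<integral>x. w x * \<psi> x \<partial>lborel)"
      by (subst integral_mult_right_zero[symmetric]) (simp add: \<phi>_def mult.left_commute)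
    ultimately have "e * (\<integral>x. w x * \<psi> x \<partial>lborel) \<le> enn2real (Jfun s p \<phi>) - enn2real (Jfun s p v)" by simp
    also have "\<dots> = (1 / p) * ((\<integral>z. \<bar>\<phi> (fst z) - \<phi> (snd z)\<bar> powr p * ?k z \<partial>lborel2) - (\<integral>z. \<bar>?v z\<bar> powr p * ?k z \<partial>lborel2))"
      using Jfun_eq_energy(2)[OF _ p0(2), of \<phi> s] Jfun_eq_energy(2)[OF _ p0(2), of v s] \<phi> fv
      by (simp add: right_diff_distrib in_L2_def v diff_divide_distrib)
    also have "\<dots> = (1 / p) * (\<integral>z. \<bar>\<phi> (fst z) - \<phi> (snd z)\<bar> powr p * ?k z - \<bar>?v z\<bar> powr p * ?k z \<partial>lborel2)"
      using \<phi> fv by (simp add: finite_energy_def)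
    also have "\<dots> \<le> (1 / p) * (\<integral>z. p * e * (Phi p (\<phi> (fst z) - \<phi> (snd z)) * ?b z * ?k z) \<partial>lborel2)"
    proof (intro mult_left_mono integral_mono)
      show "integrable lborel2 (\<lambda>z. \<bar>\<phi> (fst z) - \<phi> (snd z)\<bar> powr p * ?k z - \<bar>?v z\<bar> powr p * ?k z)"
        using \<phi> fv by (simp add: finite_energy_def)
      show "integrable lborel2 (\<lambda>z. p * e * (Phi p (\<phi> (fst z) - \<phi> (snd z)) * ?b z * ?k z))"
        using eform_integrable[OF \<phi>(2) \<psi>(2) p] by auto
      fix z :: "'a \<times> 'a"
      have "(\<bar>\<phi> (fst z) - \<phi> (snd z)\<bar> powr p - \<bar>?v z\<bar> powr p) * ?k z
        \<le> p * (Phi p (\<phi> (fst z) - \<phi> (snd z)) * (\<phi> (fst z) - \<phi> (snd z) - ?v z)) * ?k z"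
        by (intro mult_right_mono Phi_convexity p) auto
      also have "\<phi> (fst z) - \<phi> (snd z) - ?v z = e * ?b z" by (simp add: \<phi>_def algebra_simps)
      finally show "\<bar>\<phi> (fst z) - \<phi> (snd z)\<bar> powr p * ?k z - \<bar>?v z\<bar> powr p * ?k z
         \<le> p * e * (Phi p (\<phi> (fst z) - \<phi> (snd z)) * ?b z * ?k z)"
        by (simp add: algebra_simps)
    qed (use p in auto)
    also have "\<dots> = e * (\<integral>z. Phi p (\<phi> (fst z) - \<phi> (snd z)) * ?b z * ?k z \<partial>lborel2)"
      using p by simp
    finally have "(\<integral>x. w x * \<psi> x \<partial>lborel) \<le> (\<integral>z. Phi p (\<phi> (fst z) - \<phi> (snd z)) * ?b z * ?k z \<partial>lborel2)"
      using e by simp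
    moreover have "\<phi> (fst z) - \<phi> (snd z) = ?v z + e * ?b z" for z by (simp add: \<phi>_def algebra_simps)
    ultimately show ?thesis by simp
  qed
  \<comment> \<open>Steps of size at most 1 keep the perturbed increments below the fixed integrable
    majorant \<open>2 powr p * (...) + ...\<close>.\<close>
  let ?e = "\<lambda>n. 1 / real (Suc n)"
  have "(\<lambda>n. \<integral>z. Phi p (?v z + ?e n * ?b z) * ?b z * ?k z \<partial>lborel2) \<longlonglongrightarrow> (\<integral>z. Phi p (?v z) * ?b z * ?k z \<partial>lborel2)"
  proof (rule integral_dominated_convergence)
    show "integrable lborel2 (\<lambda>z. 2 powr p * (\<bar>?v z\<bar> powr p * ?k z + \<bar>?b z\<bar> powr p * ?k z) + \<bar>?b z\<bar> powr p * ?k z)"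
      using fv \<psi>(2) by (auto simp: finite_energy_def)
    show "AE z in lborel2. (\<lambda>n. Phi p (?v z + ?e n * ?b z) * ?b z * ?k z) \<longlonglongrightarrow> Phi p (?v z) * ?b z * ?k z"
    proof (rule AE_I2)
      fix z :: "'a \<times> 'a"
      have "(\<lambda>n. ?v z + ?e n * ?b z) \<longlonglongrightarrow> ?v z + 0 * ?b z"
        by (intro tendsto_intros LIMSEQ_Suc[OF lim_const_over_n[of 1, simplified]])
      then have "(\<lambda>n. Phi p (?v z + ?e n * ?b z)) \<longlonglongrightarrow> Phi p (?v z)"
        by (intro isCont_tendsto_compose[OF continuous_Phi[OF p]]) simp
      then show "(\<lambda>n. Phi p (?v z + ?e n * ?b z) * ?b z * ?k z) \<longlonglongrightarrow> Phi p (?v z) * ?b z * ?k z"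
        by (intro tendsto_intros)
    qed
    fix n
    show "AE z in lborel2. norm (Phi p (?v z + ?e n * ?b z) * ?b z * ?k z)
       \<le> 2 powr p * (\<bar>?v z\<bar> powr p * ?k z + \<bar>?b z\<bar> powr p * ?k z) + \<bar>?b z\<bar> powr p * ?k z"
    proof (rule AE_I2)
      fix z :: "'a \<times> 'a"
      have "\<bar>?e n * ?b z\<bar> \<le> 1 * \<bar>?b z\<bar>" unfolding abs_mult by (intro mult_right_mono) auto
      then have "\<bar>?v z + ?e n * ?b z\<bar> powr p \<le> 2 powr p * (\<bar>?v z\<bar> powr p + \<bar>?b z\<bar> powr p)"
        by (intro powr_add_bound p0 order_trans[OF abs_triangle_ineq] add_left_mono) simp
      then have "\<bar>Phi p (?v z + ?e n * ?b z) * ?b z\<bar> \<le> 2 powr p * (\<bar>?v z\<bar> powr p + \<bar>?b z\<bar> powr p) + \<bar>?b z\<bar> powr p"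
        using Phi_mult_bound[OF p, of "?v z + ?e n * ?b z" "?b z"] by linarith
      then have "\<bar>Phi p (?v z + ?e n * ?b z) * ?b z\<bar> * ?k z \<le> (2 powr p * (\<bar>?v z\<bar> powr p + \<bar>?b z\<bar> powr p) + \<bar>?b z\<bar> powr p) * ?k z"
        by (rule mult_right_mono) simp
      then show "norm (Phi p (?v z + ?e n * ?b z) * ?b z * ?k z)
       \<le> 2 powr p * (\<bar>?v z\<bar> powr p * ?k z + \<bar>?b z\<bar> powr p * ?k z) + \<bar>?b z\<bar> powr p * ?k z"
        by (simp add: abs_mult distrib_right distrib_left mult.assoc)
    qed
  qed measurable
  then show ?thesis unfolding eform_def
    by (rule LIMSEQ_le_const) (intro exI[of _ 0] allI impI step, simp)
qed

text \<open>The form is linear in its second argument, so the inequality for \<open>- \<psi>\<close>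
  is the reverse one for \<open>\<psi>\<close>.\<close>

lemma subdiffJ_eq_eform:
  fixes v :: "'a::euclidean_space \<Rightarrow> real"
  assumes sub: "subdiffJ s p v w" and p: "p > 2"
    and \<psi>: "in_L2 \<psi>" "finite_energy (real DIM('a) + s * p) p \<psi>"
  shows "(\<integral>x. w x * \<psi> x \<partial>lborel) = eform (real DIM('a) + s * p) p v \<psi>"
proof (rule antisym)
  show "(\<integral>x. w x * \<psi> x \<partial>lborel) \<le> eform (real DIM('a) + s * p) p v \<psi>"
    by (rule subdiffJ_le_eform[OF assms])
  have "(\<integral>x. w x * (- \<psi> x) \<partial>lborel) \<le> eform (real DIM('a) + s * p) p v (\<lambda>x. - \<psi> x)"
    using subdiffJ_le_eform[OF sub p in_L2_uminus[OF \<psi>(1)]] finite_energy_cmult[OF \<psi>(2), of "-1"] by simp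
  also have "eform (real DIM('a) + s * p) p v (\<lambda>x. - \<psi> x) = - eform (real DIM('a) + s * p) p v \<psi>"
    unfolding eform_def by (subst Bochner_Integration.integral_minus[symmetric])
      (auto intro!: Bochner_Integration.integral_cong simp: algebra_simps)
  finally show "eform (real DIM('a) + s * p) p v \<psi> \<le> (\<integral>x. w x * \<psi> x \<partial>lborel)" by simp
qed

section \<open>The algebraic barrier\<close>

lemma nn_integral_lborel_translate:
  fixes f :: "'a::euclidean_space \<Rightarrow> ennreal"
  assumes [measurable]: "f \<in> borel_measurable borel"
  shows "(\<integral>\<^sup>+y. f y \<partial>lborel) = (\<integral>\<^sup>+h. f (x + h) \<partial>lborel)"
proof -
  have "(\<integral>\<^sup>+y. f y \<partial>lborel) = (\<integral>\<^sup>+y. f y \<partial>(distr lborel borel ((+) x)))" by (simp add: lborel_distr_plus)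
  also have "\<dots> = (\<integral>\<^sup>+h. f (x + h) \<partial>lborel)" by (subst nn_integral_distr) auto
  finally show ?thesis .
qed

lemma integral_lborel_translate:
  fixes f :: "'a::euclidean_space \<Rightarrow> real"
  assumes [measurable]: "f \<in> borel_measurable borel"
  shows "(\<integral>y. f y \<partial>lborel) = (\<integral>h. f (x + h) \<partial>lborel)"
proof -
  have "(\<integral>y. f y \<partial>lborel) = (\<integral>y. f y \<partial>(distr lborel borel ((+) x)))" by (simp add: lborel_distr_plus)
  also have "\<dots> = (\<integral>h. f (x + h) \<partial>lborel)" by (subst integral_distr) auto
  finally show ?thesis .
qed

lemma integrable_lborel_translate:
  fixes f :: "'a::euclidean_space \<Rightarrow> real"
  assumes "integrable lborel f"
  shows "integrable lborel (\<lambda>h. f (x + h))"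
proof -
  have [measurable]: "f \<in> borel_measurable borel" using borel_measurable_integrable[OF assms] by simp
  have "integrable (distr lborel borel ((+) x)) f" using assms by (simp add: lborel_distr_plus)
  then show ?thesis by (subst (asm) integrable_distr_eq) auto
qed

lemma lborel_distr_uminus_euclidean: "distr lborel borel uminus = (lborel :: 'a::euclidean_space measure)"
  by (subst lborel_affine[of "-1" 0]) (auto simp: density_1 one_ennreal_def[symmetric])

lemma integral_lborel_reflect:
  fixes f :: "'a::euclidean_space \<Rightarrow> real"
  assumes [measurable]: "f \<in> borel_measurable borel"
  shows "(\<integral>h. f (- h) \<partial>lborel) = (\<integral>h. f h \<partial>lborel)"
proof -
  have "(\<integral>y. f y \<partial>lborel) = (\<integral>y. f y \<partial>(distr lborel borel uminus))" by (simp add: lborel_distr_uminus_euclidean)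
  also have "\<dots> = (\<integral>h. f (- h) \<partial>lborel)" by (subst integral_distr) auto
  finally show ?thesis ..
qed

lemma integrable_lborel_reflect:
  fixes f :: "'a::euclidean_space \<Rightarrow> real"
  assumes "integrable lborel f"
  shows "integrable lborel (\<lambda>h. f (- h))"
proof -
  have [measurable]: "f \<in> borel_measurable borel" using borel_measurable_integrable[OF assms] by simp
  have "integrable (distr lborel borel uminus) f" using assms by (simp add: lborel_distr_uminus_euclidean)
  then show ?thesis by (subst (asm) integrable_distr_eq) auto
qed

text \<open>Comparison with a countable sum of constants on balls. Full balls instead of annuli cost
  only a constant factor and need nothing but the volume of a ball.\<close>

lemma integrable_dyadic:
  fixes f :: "'a::euclidean_space \<Rightarrow> real"
  assumes [measurable]: "f \<in> borel_measurable borel" and f0: "\<And>x. 0 \<le> f x"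
    and le: "\<And>x. f x \<noteq> 0 \<Longrightarrow> \<exists>n. f x \<le> c n \<and> norm x < r n"
    and c: "\<And>n. 0 \<le> c n" and r: "\<And>n. 0 \<le> r n"
    and sum: "summable (\<lambda>n. c n * r n ^ DIM('a))"
  shows "integrable lborel f"
proof (rule integrableI_bounded)
  let ?V = "unit_ball_vol (real DIM('a))"
  have "(\<integral>\<^sup>+x. ennreal (norm (f x)) \<partial>lborel) \<le> (\<integral>\<^sup>+(x::'a). (\<Sum>n. ennreal (c n) * indicator (ball 0 (r n)) x) \<partial>lborel)"
  proof (rule nn_integral_mono)
    fix x :: 'a
    show "ennreal (norm (f x)) \<le> (\<Sum>n. ennreal (c n) * indicator (ball 0 (r n)) x)"
    proof (cases "f x = 0")
      case False
      then obtain n where n: "f x \<le> c n" "norm x < r n" using le by blast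
      define g where "g n = ennreal (c n) * indicator (ball 0 (r n)) x" for n
      have "ennreal (norm (f x)) \<le> g n"
        using n f0 by (auto simp: g_def ennreal_leI)
      also have "\<dots> = sum g {n}" by simp
      also have "\<dots> \<le> suminf g" by (rule sum_le_suminf) auto
      finally show ?thesis by (simp add: g_def[abs_def])
    qed simp
  qed
  also have "\<dots> = (\<Sum>n. \<integral>\<^sup>+(x::'a). ennreal (c n) * indicator (ball 0 (r n)) x \<partial>lborel)"
    by (rule nn_integral_suminf) (intro borel_measurable_times_ennreal borel_measurable_const borel_measurable_indicator, simp)
  also have "\<dots> = (\<Sum>n. ennreal (?V * (c n * r n ^ DIM('a))))"
    using c r by (simp only: nn_integral_cmult_indicator sets_lborel open_ball borel_open emeasure_ball)
      (simp add: ennreal_mult[symmetric] mult.left_commute)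
  also have "\<dots> = ennreal (\<Sum>n. ?V * (c n * r n ^ DIM('a)))"
    by (rule suminf_ennreal2) (use c r sum in \<open>auto intro!: mult_nonneg_nonneg summable_mult\<close>)
  also have "\<dots> < \<infinity>" by simp
  finally show "(\<integral>\<^sup>+x. ennreal (norm (f x)) \<partial>lborel) < \<infinity>" .
qed measurable

text \<open>At the scale |h| of order \<open>2 powr n\<close> the kernel is at most
  \<open>2 powr (- a * n)\<close> and the volume is of order \<open>2 powr (N * n)\<close>; for a >
  N the resulting geometric series converges.\<close>

lemma integrable_kern_outside:
  assumes a: "a > real DIM('a::euclidean_space)"
  shows "integrable lborel (\<lambda>h::'a. indicator {h. 1 \<le> norm h} h * kern a h)"
proof (rule integrable_dyadic[where c = "\<lambda>n. 2 powr (- a * real n)" and r = "\<lambda>n. 2 powr (real n + 1)"])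
  fix h :: 'a
  assume "indicator {h. 1 \<le> norm h} h * kern a h \<noteq> 0"
  then have h: "1 \<le> norm h" by (auto simp: indicator_def split: if_splits)
  define n where "n = nat \<lfloor>log 2 (norm h)\<rfloor>"
  have h0: "0 < norm h" using h by linarith
  have l: "0 \<le> log 2 (norm h)" using h h0 by simp
  then have n: "real n \<le> log 2 (norm h)" "log 2 (norm h) < real n + 1" by (auto simp: n_def)
  have bounds: "2 powr real n \<le> norm h" "norm h < 2 powr (real n + 1)"
    using n h0 powr_mono[OF n(1), of 2] powr_less_mono[OF n(2), of 2] by auto
  moreover have "kern a h \<le> 2 powr (- a * real n)"
  proof -
    have "kern a h = norm h powr (- a)" by (simp add: kern_def powr_minus_divide)
    also have "\<dots> \<le> (2 powr real n) powr (- a)"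
      using bounds a by (intro powr_mono2') auto
    also have "\<dots> = 2 powr (- a * real n)" by (simp add: powr_powr mult.commute)
    finally show ?thesis .
  qed
  ultimately show "\<exists>n. indicator {h. 1 \<le> norm h} h * kern a h \<le> 2 powr (- a * real n) \<and> norm h < 2 powr (real n + 1)"
    using h by auto
next
  have "2 powr (- a * real n) * (2 powr (real n + 1)) ^ DIM('a) = 2 ^ DIM('a) * (2 powr (real DIM('a) - a)) ^ n" for n
    by (simp add: powr_powr powr_add[symmetric] algebra_simps flip: powr_realpow)
  moreover have "summable (\<lambda>n. 2 ^ DIM('a) * (2 powr (real DIM('a) - a)) ^ n)"
    using a powr_less_mono[of "real DIM('a) - a" 0 2] by (intro summable_mult summable_geometric) auto
  ultimately show "summable (\<lambda>n. 2 powr (- a * real n) * (2 powr (real n + 1)) ^ DIM('a))"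
    by (simp only:)
qed (auto simp: indicator_def)

lemma integrable_kern_inside:
  assumes q: "q < real DIM('a::euclidean_space)"
  shows "integrable lborel (\<lambda>h::'a. indicator (ball 0 1) h * kern q h)"
proof -
  \<comment> \<open>The exponent may be negative, as for \<open>a - p\<close> later; the dyadic
    upper bound of the kernel needs a nonnegative one, and inside the unit ball enlarging the
    exponent only enlarges the kernel.\<close>
  define b where "b = max q 0"
  have b: "0 \<le> b" "q \<le> b" "b < real DIM('a)" using q by (auto simp: b_def)
  show ?thesis
  proof (rule integrable_dyadic[where c = "\<lambda>n. 2 powr (b * (real n + 1))" and r = "\<lambda>n. 2 * 2 powr (- real n)"])
    fix h :: 'a
    assume "indicator (ball 0 1) h * kern q h \<noteq> 0"
    then have h: "norm h < 1" "0 < norm h" by (auto simp: indicator_def split: if_splits)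
    define n where "n = nat \<lfloor>- log 2 (norm h)\<rfloor>"
    have l: "0 \<le> - log 2 (norm h)" using h by simp
    then have n: "real n \<le> - log 2 (norm h)" "- log 2 (norm h) < real n + 1"
      unfolding n_def by (simp, linarith)
    have bounds: "norm h \<le> 2 powr (- real n)" "2 powr (- (real n + 1)) \<le> norm h"
      using n h powr_mono[of "log 2 (norm h)" "- real n" 2] powr_mono[of "- (real n + 1)" "log 2 (norm h)" 2] by auto
    \<comment> \<open>The factor 2 in the radii is there only to turn the weak inequality into the
      strict one of an open ball.\<close>
    then have "norm h < 2 * 2 powr (- real n)"
      using powr_gt_zero[of 2 "- real n"] by linarith
    moreover have "kern q h \<le> 2 powr (b * (real n + 1))"
    proof -
      have "kern q h = norm h powr (- q)" by (simp add: kern_def powr_minus_divide)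
      also have "\<dots> \<le> norm h powr (- b)" using h b by (intro powr_mono') auto
      also have "\<dots> \<le> (2 powr (- (real n + 1))) powr (- b)"
        using bounds b by (intro powr_mono2') auto
      also have "\<dots> = 2 powr (b * (real n + 1))" by (simp add: powr_powr algebra_simps)
      finally show ?thesis .
    qed
    ultimately show "\<exists>n. indicator (ball 0 1) h * kern q h \<le> 2 powr (b * (real n + 1)) \<and> norm h < 2 * 2 powr (- real n)"
      using h by (intro exI[of _ n]) (auto simp: indicator_def)
  next
    have "2 powr (b * (real n + 1)) * (2 * 2 powr (- real n)) ^ DIM('a) = (2 powr b * 2 ^ DIM('a)) * (2 powr (b - real DIM('a))) ^ n" for n
      by (simp add: power_mult_distrib powr_powr powr_add[symmetric] algebra_simps flip: powr_realpow)
    moreover have "summable (\<lambda>n. (2 powr b * 2 ^ DIM('a)) * (2 powr (b - real DIM('a))) ^ n)"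
      using b powr_less_mono[of "b - real DIM('a)" 0 2] by (intro summable_mult summable_geometric) auto
    ultimately show "summable (\<lambda>n. 2 powr (b * (real n + 1)) * (2 * 2 powr (- real n)) ^ DIM('a))"
      by (simp only:)
  qed (auto simp: indicator_def)
qed

lemma integrable_kern_truncated:
  assumes a: "a > real DIM('a::euclidean_space)" and e: "e > 0"
  shows "integrable lborel (\<lambda>h::'a. indicator {h. e < norm h} h * kern a h)"
proof (rule Bochner_Integration.integrable_bound)
  show "integrable lborel (\<lambda>h::'a. indicator {h. 1 \<le> norm h} h * kern a h + e powr (- a) * indicator (ball 0 1) h)"
    by (intro Bochner_Integration.integrable_add integrable_kern_outside[OF a] integrable_mult_right)
      (auto simp: integrable_indicator_iff emeasure_ball)
  show "AE h::'a in lborel. norm (indicator {h. e < norm h} h * kern a h)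
     \<le> norm (indicator {h. 1 \<le> norm h} h * kern a h + e powr (- a) * indicator (ball 0 1) h)"
  proof (rule AE_I2)
    fix h :: 'a
    have "kern a h \<le> e powr (- a)" if "e < norm h"
    proof -
      have "kern a h = norm h powr (- a)" by (simp add: kern_def powr_minus_divide)
      also have "\<dots> \<le> e powr (- a)" using that e a by (intro powr_mono2') auto
      finally show ?thesis .
    qed
    then show "norm (indicator {h. e < norm h} h * kern a h)
     \<le> norm (indicator {h. 1 \<le> norm h} h * kern a h + e powr (- a) * indicator (ball 0 1) h)"
      by (auto simp: indicator_def)
  qed
qed measurable

section \<open>The smooth function with the decay of the kernel, and its differences\<close>

definition bar :: "real \<Rightarrow> 'a::euclidean_space \<Rightarrow> real" where
  "bar a x = (1 + (norm x)\<^sup>2) powr (- a / 2)"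

lemma one_plus_norm_sq [simp]: "0 < 1 + (norm x)\<^sup>2" "1 + (norm x)\<^sup>2 \<noteq> 0"
  using add_pos_nonneg[of 1 "(norm x)\<^sup>2"] by auto

lemma bar_pos [simp]: "0 < bar a x"
  by (simp add: bar_def)

lemma bar_nonneg [simp]: "0 \<le> bar a x" by (rule less_imp_le) simp

lemma bar_le_1: "0 \<le> a \<Longrightarrow> bar a x \<le> 1"
  using powr_mono2'[of "- a / 2" 1 "1 + (norm x)\<^sup>2"] by (simp add: bar_def)

lemma bar_measurable [measurable]: "bar a \<in> borel_measurable borel"
  unfolding bar_def by measurable

text \<open>Comparisons of \<open>bar\<close> at two points are reduced to comparing
  \<open>1 + (norm x)\<^sup>2\<close>; a factor \<open>c\<close> there becomes
  \<open>c powr (a / 2)\<close>.\<close>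

lemma bar_compare:
  assumes "0 \<le> a" "0 < c" "1 + (norm x)\<^sup>2 \<le> c * (1 + (norm y)\<^sup>2)"
  shows "bar a y \<le> c powr (a / 2) * bar a x"
proof -
  have p: "0 < 1 + (norm x)\<^sup>2" "0 < 1 + (norm y)\<^sup>2" by (simp_all add: add_pos_nonneg)
  have "(c * (1 + (norm y)\<^sup>2)) powr (- a / 2) \<le> (1 + (norm x)\<^sup>2) powr (- a / 2)"
    using assms p by (intro powr_mono2') auto
  then have "c powr (a / 2) * (c powr (- a / 2) * bar a y) \<le> c powr (a / 2) * bar a x"
    using assms by (intro mult_left_mono) (auto simp: bar_def powr_mult)
  moreover have "c powr (a / 2) * c powr (- a / 2) = 1"
    using assms by (simp add: powr_minus)
  then have "c powr (a / 2) * (c powr (- a / 2) * bar a y) = bar a y"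
    by (metis mult.assoc mult_1)
  ultimately show ?thesis by linarith
qed

lemma bar_antimono: "0 \<le> a \<Longrightarrow> norm x \<le> norm y \<Longrightarrow> bar a y \<le> bar a x"
  using bar_compare[of a 1 x y] by (simp add: power_mono)

lemma kern_eq_sq_powr: "z \<noteq> 0 \<Longrightarrow> kern a z = ((norm z)\<^sup>2) powr (- a / 2)"
proof -
  assume "z \<noteq> 0"
  then have "(norm z)\<^sup>2 = norm z powr 2" by simp
  then show ?thesis by (simp only: powr_powr) (simp add: kern_def powr_minus_divide)
qed

lemma kern_le_bar:
  assumes "0 \<le> a" "1 \<le> norm h" shows "kern a h \<le> 2 powr (a / 2) * bar a h"
proof -
  have 1: "1 \<le> (norm h)\<^sup>2" using assms by simp
  have "kern a h = ((norm h)\<^sup>2) powr (- a / 2)"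
    using assms(2) by (intro kern_eq_sq_powr) auto
  also have "\<dots> \<le> ((1 + (norm h)\<^sup>2) / 2) powr (- a / 2)"
    using assms 1 by (intro powr_mono2') auto
  also have "\<dots> = 2 powr (a / 2) * bar a h"
    by (simp add: bar_def powr_divide powr_minus_divide)
  finally show ?thesis .
qed

lemma bar_integrable:
  assumes a: "a > real DIM('a::euclidean_space)"
  shows "integrable lborel (bar a :: 'a \<Rightarrow> real)"
proof (rule Bochner_Integration.integrable_bound)
  show "integrable lborel (\<lambda>h::'a. indicator {h. 1 \<le> norm h} h * kern a h + indicator (ball 0 1) h)"
    by (intro Bochner_Integration.integrable_add integrable_kern_outside[OF a])
      (auto simp: integrable_indicator_iff emeasure_ball)
  show "AE h::'a in lborel. norm (bar a h) \<le> norm (indicator {h. 1 \<le> norm h} h * kern a h + indicator (ball 0 1) h)"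
  proof (rule AE_I2)
    fix h :: 'a
    have a0: "0 \<le> a" using a by auto
    have "bar a h \<le> kern a h" if "1 \<le> norm h"
    proof -
      have "bar a h \<le> ((norm h)\<^sup>2) powr (- a / 2)" unfolding bar_def using that a0 
        by (intro powr_mono2') (auto intro!: zero_less_power)
      also have "\<dots> = kern a h" using that by (subst kern_eq_sq_powr) auto
      finally show ?thesis .
    qed
    then show "norm (bar a h) \<le> norm (indicator {h. 1 \<le> norm h} h * kern a h + indicator (ball 0 1) h)"
      using bar_le_1[OF a0, of h] by (auto simp: indicator_def)
  qed
qed measurable

lemma bar_in_L2:
  assumes a: "a > real DIM('a::euclidean_space)"
  shows "in_L2 (bar a :: 'a \<Rightarrow> real)"
proof -
  have "integrable lborel (\<lambda>x::'a. (bar a x)\<^sup>2)"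
  proof (rule Bochner_Integration.integrable_bound[OF bar_integrable[OF a]])
    show "AE x::'a in lborel. norm ((bar a x)\<^sup>2) \<le> norm (bar a x)"
      using bar_le_1[of a] a by (auto intro!: AE_I2 mult_left_le simp: power2_eq_square)
  qed measurable
  then show ?thesis by (simp add: in_L2_def)
qed

text \<open>At least one of \<open>x + h\<close> and \<open>h\<close> has norm no less than half
  that of \<open>x\<close>, and the factor at that point is at most a multiple of
  \<open>bar a x\<close>. Keeping the sum of the other factors covers both cases, and integrating in
  \<open>h\<close> shows that \<open>bar\<close> convolved with itself is bounded by a multiple of
  \<open>bar\<close>.\<close>

lemma bar_convolution_pointwise:
  assumes "0 \<le> a"
  shows "bar a (x + h) * bar a h \<le> 4 powr (a / 2) * bar a x * (bar a (x + h) + bar a h)"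
proof -
  have n: "(norm x)\<^sup>2 \<le> 2 * (norm (x + h))\<^sup>2 + 2 * (norm h)\<^sup>2"
  proof -
    have "norm x \<le> norm (x + h) + norm h" using norm_triangle_ineq4[of "x + h" h] by simp
    then have "(norm x)\<^sup>2 \<le> (norm (x + h) + norm h)\<^sup>2" by (intro power_mono) auto
    also have "\<dots> \<le> 2 * (norm (x + h))\<^sup>2 + 2 * (norm h)\<^sup>2"
      using sum_squares_bound[of "norm (x + h)" "norm h"] by (simp add: power2_sum)
    finally show ?thesis .
  qed
  have arith: "1 + r \<le> 4 * (1 + u)" if "r \<le> 2 * u + 2 * v" "v \<le> u" for r u v :: real
  proof -
    have "2 * v \<le> 2 * u" using that by simp
    then show ?thesis using that by (simp add: algebra_simps)
  qed
  show ?thesis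
  proof (cases "norm h \<le> norm (x + h)")
    case True
    then have "(norm h)\<^sup>2 \<le> (norm (x + h))\<^sup>2" by (intro power_mono) auto
    then have "1 + (norm x)\<^sup>2 \<le> 4 * (1 + (norm (x + h))\<^sup>2)" using arith[OF n] by blast
    then have "bar a (x + h) \<le> 4 powr (a / 2) * bar a x" using assms by (intro bar_compare) auto
    then have "bar a (x + h) * bar a h \<le> 4 powr (a / 2) * bar a x * bar a h" by (intro mult_right_mono) auto
    also have "\<dots> \<le> 4 powr (a / 2) * bar a x * (bar a (x + h) + bar a h)" by (intro mult_left_mono) auto
    finally show ?thesis .
  next
    case False
    then have "(norm (x + h))\<^sup>2 \<le> (norm h)\<^sup>2" by (intro power_mono) auto
    then have "1 + (norm x)\<^sup>2 \<le> 4 * (1 + (norm h)\<^sup>2)" using arith n by (metis add.commute)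
    then have "bar a h \<le> 4 powr (a / 2) * bar a x" using assms by (intro bar_compare) auto
    then have "bar a h * bar a (x + h) \<le> 4 powr (a / 2) * bar a x * bar a (x + h)" by (intro mult_right_mono) auto
    also have "\<dots> \<le> 4 powr (a / 2) * bar a x * (bar a (x + h) + bar a h)" by (intro mult_left_mono) auto
    finally show ?thesis by (simp add: mult.commute)
  qed
qed

text \<open>Along a line \<open>Q\<close> is a quadratic polynomial with derivative
  \<open>2 * B\<close>, and \<open>B\<close> is affine with slope \<open>(norm h)\<^sup>2\<close>;
  the rest is the chain rule.\<close>

lemma bar_line_has_derivatives:
  fixes x h :: "'a::euclidean_space" and a t :: real
  defines "Q \<equiv> \<lambda>t. 1 + (norm (x + t *\<^sub>R h))\<^sup>2" and "B \<equiv> \<lambda>t. (x + t *\<^sub>R h) \<bullet> h"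
  shows "((\<lambda>t. bar a (x + t *\<^sub>R h)) has_real_derivative (- a * Q t powr (- a / 2 - 1) * B t)) (at t)"
    and "((\<lambda>t. - a * Q t powr (- a / 2 - 1) * B t) has_real_derivative
      (a * (a + 2) * Q t powr (- a / 2 - 2) * (B t)\<^sup>2 - a * Q t powr (- a / 2 - 1) * (norm h)\<^sup>2)) (at t)"
proof -
  have Qp: "Q t > 0" by (simp add: Q_def add_pos_nonneg)
  have Qe: "Q = (\<lambda>t. 1 + (norm x)\<^sup>2 + 2 * t * (x \<bullet> h) + t\<^sup>2 * (norm h)\<^sup>2)"
    unfolding Q_def power2_norm_eq_inner by (auto simp: algebra_simps inner_commute power2_eq_square)
  have Be: "B = (\<lambda>t. x \<bullet> h + t * (norm h)\<^sup>2)"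
    unfolding B_def by (auto simp: power2_norm_eq_inner algebra_simps)
  have dQ: "(Q has_real_derivative 2 * B t) (at t)"
    unfolding Qe Be by (auto intro!: derivative_eq_intros simp: algebra_simps)
  have dB: "(B has_real_derivative (norm h)\<^sup>2) (at t)"
    unfolding Be by (auto intro!: derivative_eq_intros)
  have dP: "((\<lambda>t. Q t powr r) has_real_derivative r * Q t powr (r - 1) * (2 * B t)) (at t)" for r
    using DERIV_chain2[OF has_real_derivative_powr[OF Qp, of r] dQ] by simp
  show "((\<lambda>t. bar a (x + t *\<^sub>R h)) has_real_derivative (- a * Q t powr (- a / 2 - 1) * B t)) (at t)"
    using dP[of "- a / 2"] by (simp add: bar_def Q_def mult.assoc)
  have "((\<lambda>t. (- a * Q t powr (- a / 2 - 1)) * B t) has_real_derivative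
     (- a * ((- a / 2 - 1) * Q t powr (- a / 2 - 1 - 1) * (2 * B t))) * B t + (norm h)\<^sup>2 * (- a * Q t powr (- a / 2 - 1))) (at t)"
    by (intro DERIV_mult DERIV_cmult dP dB)
  moreover have "(- a * ((- a / 2 - 1) * Q t powr (- a / 2 - 1 - 1) * (2 * B t))) * B t + (norm h)\<^sup>2 * (- a * Q t powr (- a / 2 - 1))
    = a * (a + 2) * Q t powr (- a / 2 - 2) * (B t)\<^sup>2 - a * Q t powr (- a / 2 - 1) * (norm h)\<^sup>2"
    by (simp add: power2_eq_square algebra_simps)
  ultimately show "((\<lambda>t. - a * Q t powr (- a / 2 - 1) * B t) has_real_derivative
      (a * (a + 2) * Q t powr (- a / 2 - 2) * (B t)\<^sup>2 - a * Q t powr (- a / 2 - 1) * (norm h)\<^sup>2)) (at t)"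
    by (simp only:)
qed

text \<open>Cauchy-Schwarz bounds the square of \<open>B\<close> by \<open>Q\<close> times
  \<open>(norm h)\<^sup>2\<close>, which absorbs the powers lost by differentiation, so both
  derivatives are controlled by \<open>bar\<close> at the moved point. Moving by at most 1 changes
  \<open>bar\<close> only by a constant factor.\<close>

lemma bar_line_derivative_bounds:
  fixes x h :: "'a::euclidean_space" and a t :: real
  defines "Q \<equiv> \<lambda>t. 1 + (norm (x + t *\<^sub>R h))\<^sup>2" and "B \<equiv> \<lambda>t. (x + t *\<^sub>R h) \<bullet> h"
  assumes a: "0 \<le> a" and t: "\<bar>t\<bar> \<le> 1" and h: "norm h \<le> 1"
  shows "\<bar>- a * Q t powr (- a / 2 - 1) * B t\<bar> \<le> a * 3 powr (a / 2) * norm h * bar a x"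
    and "\<bar>a * (a + 2) * Q t powr (- a / 2 - 2) * (B t)\<^sup>2 - a * Q t powr (- a / 2 - 1) * (norm h)\<^sup>2\<bar>
       \<le> a * (a + 3) * 3 powr (a / 2) * (norm h)\<^sup>2 * bar a x"
proof -
  let ?y = "x + t *\<^sub>R h"
  have Q1: "Q t \<ge> 1" by (simp add: Q_def)
  have Bs: "(B t)\<^sup>2 \<le> Q t * (norm h)\<^sup>2"
  proof -
    have "\<bar>B t\<bar> \<le> norm ?y * norm h" unfolding B_def by (rule Cauchy_Schwarz_ineq2)
    then have "\<bar>B t\<bar>\<^sup>2 \<le> (norm ?y * norm h)\<^sup>2" by (intro power_mono) auto
    also have "\<dots> \<le> Q t * (norm h)\<^sup>2" unfolding power_mult_distrib Q_def by (intro mult_right_mono) auto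
    finally show ?thesis by simp
  qed
  have Ba: "\<bar>B t\<bar> \<le> Q t * norm h"
  proof -
    have "\<bar>B t\<bar> \<le> norm ?y * norm h" unfolding B_def by (rule Cauchy_Schwarz_ineq2)
    also have "norm ?y \<le> Q t"
    proof -
      have "0 \<le> (norm ?y - 1 / 2)\<^sup>2" by simp
      then show ?thesis unfolding Q_def by (simp add: power2_eq_square algebra_simps)
    qed
    finally show ?thesis by (simp add: mult_right_mono)
  qed
  \<comment> \<open>The 3 comes from
    \<open>1 + (r + 1)\<^sup>2 \<le> 3 * (1 + r\<^sup>2)\<close>.\<close>
  have R: "bar a ?y \<le> 3 powr (a / 2) * bar a x"
  proof (rule bar_compare[OF a])
    have "norm x \<le> norm ?y + norm (t *\<^sub>R h)" using norm_triangle_ineq4[of ?y "t *\<^sub>R h"] by simp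
    also have "norm (t *\<^sub>R h) \<le> 1" using t h mult_mono[of "\<bar>t\<bar>" 1 "norm h" 1] by simp
    finally have "(norm x)\<^sup>2 \<le> (norm ?y + 1)\<^sup>2" by (intro power_mono) auto
    then show "1 + (norm x)\<^sup>2 \<le> 3 * (1 + (norm ?y)\<^sup>2)"
      using sum_squares_bound[of 1 "norm ?y"] zero_le_power2[of "norm ?y"] unfolding power2_sum distrib_left one_power2 mult_1_right by linarith
  qed simp
  have pw: "Q t powr (- a / 2 - 1) * Q t = bar a ?y"
    using Q1 powr_mult_base[of "Q t" "- a / 2 - 1"] by (simp add: Q_def bar_def mult.commute)
  have pw2: "Q t powr (- a / 2 - 2) * Q t = Q t powr (- a / 2 - 1)"
  proof -
    have "1 + (- a / 2 - 2) = - a / 2 - 1" by simp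
    then show ?thesis using Q1 powr_mult_base[of "Q t" "- a / 2 - 2"] by (simp only: mult.commute)
  qed
  have le: "Q t powr (- a / 2 - 1) \<le> bar a ?y"
    using pw Q1 mult_left_mono[OF Q1, of "Q t powr (- a / 2 - 1)"] by simp
  have "\<bar>- a * Q t powr (- a / 2 - 1) * B t\<bar> = a * Q t powr (- a / 2 - 1) * \<bar>B t\<bar>"
    using a by (simp add: abs_mult)
  also have "\<dots> \<le> a * Q t powr (- a / 2 - 1) * (Q t * norm h)" using a Ba by (intro mult_left_mono) auto
  also have "\<dots> = a * norm h * bar a ?y" unfolding pw[symmetric] by (simp only: mult_ac)
  also have "\<dots> \<le> a * norm h * (3 powr (a / 2) * bar a x)" using R a by (intro mult_left_mono) auto
  finally show "\<bar>- a * Q t powr (- a / 2 - 1) * B t\<bar> \<le> a * 3 powr (a / 2) * norm h * bar a x"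
    by (simp add: algebra_simps)
  have "a * (a + 2) * Q t powr (- a / 2 - 2) * (B t)\<^sup>2 \<le> a * (a + 2) * Q t powr (- a / 2 - 2) * (Q t * (norm h)\<^sup>2)"
    using a Bs by (intro mult_left_mono) auto
  also have "\<dots> = a * (a + 2) * (norm h)\<^sup>2 * Q t powr (- a / 2 - 1)" unfolding pw2[symmetric] by (simp only: mult_ac)
  also have "\<dots> \<le> a * (a + 2) * (norm h)\<^sup>2 * bar a ?y" using le a by (intro mult_left_mono) auto
  finally have 1: "a * (a + 2) * Q t powr (- a / 2 - 2) * (B t)\<^sup>2 \<le> a * (a + 2) * (norm h)\<^sup>2 * bar a ?y" .
  have 2: "a * Q t powr (- a / 2 - 1) * (norm h)\<^sup>2 \<le> a * (norm h)\<^sup>2 * bar a ?y"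
    using mult_left_mono[OF le, of "a * (norm h)\<^sup>2"] a by (simp add: algebra_simps)
  have 3: "0 \<le> a * (a + 2) * Q t powr (- a / 2 - 2) * (B t)\<^sup>2" "0 \<le> a * Q t powr (- a / 2 - 1) * (norm h)\<^sup>2"
    using a by auto
  have "\<bar>a * (a + 2) * Q t powr (- a / 2 - 2) * (B t)\<^sup>2 - a * Q t powr (- a / 2 - 1) * (norm h)\<^sup>2\<bar>
    \<le> a * (a + 2) * (norm h)\<^sup>2 * bar a ?y + a * (norm h)\<^sup>2 * bar a ?y"
    using 1 2 3 by linarith
  also have "\<dots> = a * (a + 3) * (norm h)\<^sup>2 * bar a ?y" by (simp add: algebra_simps)
  also have "\<dots> \<le> a * (a + 3) * (norm h)\<^sup>2 * (3 powr (a / 2) * bar a x)"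
    using R a by (intro mult_left_mono) auto
  finally show "\<bar>a * (a + 2) * Q t powr (- a / 2 - 2) * (B t)\<^sup>2 - a * Q t powr (- a / 2 - 1) * (norm h)\<^sup>2\<bar>
       \<le> a * (a + 3) * 3 powr (a / 2) * (norm h)\<^sup>2 * bar a x"
    by (simp add: algebra_simps)
qed

lemma bar_first_difference:
  fixes x h :: "'a::euclidean_space"
  assumes a: "0 \<le> a" and h: "norm h \<le> 1"
  shows "\<bar>bar a x - bar a (x + h)\<bar> \<le> a * 3 powr (a / 2) * norm h * bar a x"
proof -
  let ?g' = "\<lambda>t. - a * (1 + (norm (x + t *\<^sub>R h))\<^sup>2) powr (- a / 2 - 1) * ((x + t *\<^sub>R h) \<bullet> h)"
  have "\<exists>z>0. z < 1 \<and> bar a (x + 1 *\<^sub>R h) - bar a (x + 0 *\<^sub>R h) = (1 - 0) * ?g' z"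
    by (rule MVT2) (simp, rule bar_line_has_derivatives(1))
  then obtain z where z: "0 < z" "z < 1" "bar a (x + h) - bar a x = ?g' z" by auto
  show ?thesis using bar_line_derivative_bounds(1)[OF a _ h, of z x] z by (simp add: abs_minus_commute)
qed

text \<open>The mean value theorem is used twice: for the even function \<open>g t + g (- t)\<close>
  on \<open>[0, 1]\<close>, then for \<open>g'\<close> on \<open>[- z, z]\<close>. The interval
  length \<open>2 * z\<close> is the source of the leading 2.\<close>

lemma bar_second_difference:
  fixes x h :: "'a::euclidean_space"
  assumes a: "0 \<le> a" and h: "norm h \<le> 1"
  shows "\<bar>(bar a x - bar a (x + h)) + (bar a x - bar a (x - h))\<bar> \<le> 2 * (a * (a + 3) * 3 powr (a / 2)) * (norm h)\<^sup>2 * bar a x"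
proof -
  define g where "g t = bar a (x + t *\<^sub>R h)" for t
  define g' where "g' t = - a * (1 + (norm (x + t *\<^sub>R h))\<^sup>2) powr (- a / 2 - 1) * ((x + t *\<^sub>R h) \<bullet> h)" for t
  define g'' where "g'' t = a * (a + 2) * (1 + (norm (x + t *\<^sub>R h))\<^sup>2) powr (- a / 2 - 2) * ((x + t *\<^sub>R h) \<bullet> h)\<^sup>2
     - a * (1 + (norm (x + t *\<^sub>R h))\<^sup>2) powr (- a / 2 - 1) * (norm h)\<^sup>2" for t
  have d1: "(g has_real_derivative g' t) (at t)" for t
    unfolding g_def g'_def by (rule bar_line_has_derivatives(1))
  have d2: "(g' has_real_derivative g'' t) (at t)" for t
    unfolding g'_def g''_def by (rule bar_line_has_derivatives(2))
  have d1m: "((\<lambda>t. g (- t)) has_real_derivative - g' (- t)) (at t)" for t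
    using DERIV_chain2[OF d1 DERIV_minus[OF DERIV_ident], of t] by simp
  have "\<exists>z>0. z < 1 \<and> (g 1 + g (- 1)) - (g 0 + g (- 0)) = (1 - 0) * (g' z - g' (- z))"
    by (rule MVT2[where f="\<lambda>t. g t + g (- t)"])
      (simp, rule DERIV_add[OF d1 d1m, simplified])
  then obtain z where z: "0 < z" "z < 1" "g 1 + g (- 1) - 2 * g 0 = g' z - g' (- z)" by auto
  have "\<exists>y>-z. y < z \<and> g' z - g' (- z) = (z - (- z)) * g'' y"
    by (rule MVT2) (use z d2 in auto)
  then obtain y where y: "-z < y" "y < z" "g' z - g' (- z) = 2 * z * g'' y" by auto
  have b: "\<bar>g'' y\<bar> \<le> a * (a + 3) * 3 powr (a / 2) * (norm h)\<^sup>2 * bar a x"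
    unfolding g''_def by (rule bar_line_derivative_bounds(2)[OF a _ h]) (use y z in auto)
  have "\<bar>g 1 + g (- 1) - 2 * g 0\<bar> = (2 * z) * \<bar>g'' y\<bar>" using z y by (simp add: abs_mult)
  also have "\<dots> \<le> 2 * \<bar>g'' y\<bar>" using z by (intro mult_right_mono) auto
  also have "\<dots> \<le> 2 * (a * (a + 3) * 3 powr (a / 2) * (norm h)\<^sup>2 * bar a x)" using b by simp
  finally have *: "\<bar>g 1 + g (- 1) - 2 * g 0\<bar> \<le> 2 * (a * (a + 3) * 3 powr (a / 2) * (norm h)\<^sup>2 * bar a x)" .
  have "(bar a x - bar a (x + h)) + (bar a x - bar a (x - h)) = - (g 1 + g (- 1) - 2 * g 0)"
    by (simp add: g_def)
  with * show ?thesis by (simp only: abs_minus_cancel mult.assoc)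
qed

section \<open>The nonlocal operator on the barrier\<close>

text \<open>Tonelli and translation invariance: the iterated integral is the product of the two
  \<open>L1\<close> norms.\<close>

lemma integrable_mult_kernel:
  fixes f g :: "'a::euclidean_space \<Rightarrow> real"
  assumes f: "integrable lborel f" and g: "integrable lborel g"
  shows "integrable lborel2 (\<lambda>z. f (fst z) * g (fst z - snd z))"
proof (rule integrableI_bounded)
  have [measurable]: "f \<in> borel_measurable borel" "g \<in> borel_measurable borel"
    using f g by (auto dest: borel_measurable_integrable)
  show "(\<lambda>z. f (fst z) * g (fst z - snd z)) \<in> borel_measurable lborel2" by measurable
  have "(\<integral>\<^sup>+z. ennreal (norm (f (fst z) * g (fst z - snd z))) \<partial>lborel2)
     = (\<integral>\<^sup>+x. \<integral>\<^sup>+y. ennreal \<bar>f x\<bar> * ennreal \<bar>g (x - y)\<bar> \<partial>lborel \<partial>lborel)"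
    by (subst lborel.nn_integral_fst[symmetric]) (auto simp: abs_mult ennreal_mult)
  also have "\<dots> = (\<integral>\<^sup>+x. ennreal \<bar>f x\<bar> * (\<integral>\<^sup>+h. ennreal \<bar>g h\<bar> \<partial>lborel) \<partial>lborel)"
  proof (intro nn_integral_cong)
    fix x :: 'a
    have "(\<integral>\<^sup>+y. ennreal \<bar>f x\<bar> * ennreal \<bar>g (x - y)\<bar> \<partial>lborel) = ennreal \<bar>f x\<bar> * (\<integral>\<^sup>+y. ennreal \<bar>g (x - y)\<bar> \<partial>lborel)"
      by (rule nn_integral_cmult) measurable
    also have "(\<integral>\<^sup>+y. ennreal \<bar>g (x - y)\<bar> \<partial>lborel) = (\<integral>\<^sup>+h. ennreal \<bar>g (- h)\<bar> \<partial>lborel)"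
      by (subst nn_integral_lborel_translate[of _ x]) auto
    also have "\<dots> = (\<integral>\<^sup>+h. ennreal \<bar>g h\<bar> \<partial>(distr lborel borel uminus))"
      by (subst nn_integral_distr) auto
    finally show "(\<integral>\<^sup>+y. ennreal \<bar>f x\<bar> * ennreal \<bar>g (x - y)\<bar> \<partial>lborel) = ennreal \<bar>f x\<bar> * (\<integral>\<^sup>+h. ennreal \<bar>g h\<bar> \<partial>lborel)"
      by (simp add: lborel_distr_uminus_euclidean)
  qed
  also have "\<dots> = (\<integral>\<^sup>+x. ennreal \<bar>f x\<bar> \<partial>lborel) * (\<integral>\<^sup>+h. ennreal \<bar>g h\<bar> \<partial>lborel)"
    by (rule nn_integral_multc) measurable
  also have "\<dots> < \<infinity>"
    using f g by (simp add: integrable_iff_bounded ennreal_mult_less_top)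
  finally show "(\<integral>\<^sup>+z. ennreal (norm (f (fst z) * g (fst z - snd z))) \<partial>lborel2) < \<infinity>" .
qed

text \<open>For |h| at least 1 the kernel is itself bounded by a multiple of \<open>bar a h\<close>,
  so the term with \<open>bar a (x + h)\<close> falls under
  \<open>bar_convolution_pointwise\<close>; the term with \<open>bar a x\<close> only needs the
  kernel to be integrable at infinity.\<close>

lemma bar_far_bound:
  assumes a: "a > real DIM('a::euclidean_space)"
  shows "\<exists>C\<ge>0. \<forall>x::'a. integrable lborel (\<lambda>h. indicator {h. 1 \<le> norm h} h * (bar a x + bar a (x + h)) * kern a h) \<and>
     (\<integral>h. indicator {h. 1 \<le> norm h} h * (bar a x + bar a (x + h)) * kern a h \<partial>lborel) \<le> C * bar a x"
proof -
  have a0: "0 \<le> a" using a by auto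
  define K where "K = (\<integral>(h::'a). indicator {h. 1 \<le> norm h} h * kern a h \<partial>lborel)"
  define V where "V = (\<integral>(h::'a). bar a h \<partial>lborel)"
  define c where "c = 2 powr (a / 2) * 4 powr (a / 2)"
  have K0: "K \<ge> 0" "V \<ge> 0" "c \<ge> 0" by (auto simp: K_def V_def c_def)
  show ?thesis
  proof (intro exI[of _ "K + c * (V + V)"] conjI allI)
    show "0 \<le> K + c * (V + V)" using K0 by simp
    fix x :: 'a
    let ?g = "\<lambda>h. bar a x * (indicator {h. 1 \<le> norm h} h * kern a h) + c * bar a x * (bar a (x + h) + bar a h)"
    have ig: "integrable lborel ?g"
      using integrable_kern_outside[OF a] integrable_lborel_translate[OF bar_integrable[OF a], of x] bar_integrable[OF a] by auto
    have le: "indicator {h. 1 \<le> norm h} h * (bar a x + bar a (x + h)) * kern a h \<le> ?g h" for h :: 'a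
    proof (cases "1 \<le> norm h")
      case True
      have "bar a (x + h) * kern a h \<le> bar a (x + h) * (2 powr (a / 2) * bar a h)"
        by (intro mult_left_mono kern_le_bar a0 True) auto
      also have "\<dots> = 2 powr (a / 2) * (bar a (x + h) * bar a h)" by (simp add: algebra_simps)
      also have "\<dots> \<le> 2 powr (a / 2) * (4 powr (a / 2) * bar a x * (bar a (x + h) + bar a h))"
        by (intro mult_left_mono bar_convolution_pointwise a0) auto
      finally have "bar a (x + h) * kern a h \<le> c * bar a x * (bar a (x + h) + bar a h)"
        by (simp add: c_def mult.assoc)
      then show ?thesis using True by (simp add: distrib_right)
    qed (use K0 in \<open>auto intro!: mult_nonneg_nonneg add_nonneg_nonneg\<close>)
    have ge: "0 \<le> indicator {h. 1 \<le> norm h} h * (bar a x + bar a (x + h)) * kern a h" for h :: 'a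
      by (intro mult_nonneg_nonneg add_nonneg_nonneg) auto
    show i: "integrable lborel (\<lambda>h. indicator {h. 1 \<le> norm h} h * (bar a x + bar a (x + h)) * kern a h)"
      by (rule Bochner_Integration.integrable_bound[OF ig])
        (use le ge in \<open>auto intro!: AE_I2 order_trans[OF _ abs_ge_self] simp del: abs_mult\<close>)
    have "(\<integral>h. indicator {h. 1 \<le> norm h} h * (bar a x + bar a (x + h)) * kern a h \<partial>lborel) \<le> (\<integral>h. ?g h \<partial>lborel)"
      by (rule integral_mono[OF i ig le])
    also have "\<dots> = bar a x * K + c * bar a x * ((\<integral>h. bar a (x + h) \<partial>lborel) + V)"
      using integrable_kern_outside[OF a] integrable_lborel_translate[OF bar_integrable[OF a], of x] bar_integrable[OF a]
      by (simp add: K_def V_def)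
    also have "(\<integral>h. bar a (x + h) \<partial>lborel) = V"
      unfolding V_def by (rule integral_lborel_translate[symmetric]) measurable
    finally show "(\<integral>h. indicator {h. 1 \<le> norm h} h * (bar a x + bar a (x + h)) * kern a h \<partial>lborel) \<le> (K + c * (V + V)) * bar a x"
      by (simp add: algebra_simps)
  qed
qed

lemma integrable_norm_powr_kern_inside:
  assumes "a - p < real DIM('a::euclidean_space)"
  shows "integrable lborel (\<lambda>h::'a. indicator (ball 0 1) h * (norm h powr p * kern a h))"
proof -
  have "(\<lambda>h::'a. indicator (ball 0 1) h * (norm h powr p * kern a h)) = (\<lambda>h::'a. indicator (ball 0 1) h * kern (a - p) h)"
    by (auto simp: kern_def powr_diff)
  then show ?thesis using integrable_kern_inside[OF assms] by simp
qed

text \<open>For fixed \<open>x\<close> the inner integral is at most a multiple of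
  \<open>bar a x\<close>, which is integrable. Near \<open>x\<close> the first difference gives
  \<open>norm h powr p\<close> and \<open>bar\<close> to the power p is at most \<open>bar\<close>;
  far from \<open>x\<close> the difference is at most 1, so its power p is at most the difference
  itself.\<close>

lemma bar_finite_energy:
  assumes a: "a > real DIM('a::euclidean_space)" and ap: "a - p < real DIM('a)" and p: "p > 2"
  shows "finite_energy a p (bar a :: 'a \<Rightarrow> real)"
proof -
  have a0: "0 \<le> a" using a by auto
  obtain C where C: "C \<ge> 0" "\<And>x::'a. integrable lborel (\<lambda>h. indicator {h. 1 \<le> norm h} h * (bar a x + bar a (x + h)) * kern a h)"
    "\<And>x::'a. (\<integral>h. indicator {h. 1 \<le> norm h} h * (bar a x + bar a (x + h)) * kern a h \<partial>lborel) \<le> C * bar a x"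
    using bar_far_bound[OF a] by blast
  define c where "c = (a * 3 powr (a / 2)) powr p"
  define K where "K = (\<integral>(h::'a). indicator (ball 0 1) h * (norm h powr p * kern a h) \<partial>lborel)"
  have K0: "K \<ge> 0" by (auto simp: K_def)
  have iK: "integrable lborel (\<lambda>h::'a. indicator (ball 0 1) h * (norm h powr p * kern a h))"
    by (rule integrable_norm_powr_kern_inside[OF ap])
  have inner: "(\<integral>\<^sup>+y. ennreal (\<bar>bar a x - bar a y\<bar> powr p * kern a (x - y)) \<partial>lborel) \<le> ennreal ((c * K + C) * bar a x)" for x :: 'a
  proof -
    let ?g = "\<lambda>h. c * bar a x * (indicator (ball 0 1) h * (norm h powr p * kern a h)) +
       indicator {h. 1 \<le> norm h} h * (bar a x + bar a (x + h)) * kern a h"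
    have ig: "integrable lborel ?g" using iK C(2) by auto
    have le: "\<bar>bar a x - bar a (x + h)\<bar> powr p * kern a h \<le> ?g h" for h
    proof (cases "norm h < 1")
      case True
      have "\<bar>bar a x - bar a (x + h)\<bar> powr p \<le> (a * 3 powr (a / 2) * norm h * bar a x) powr p"
        using True p by (intro powr_mono2 bar_first_difference a0) auto
      also have "\<dots> = c * norm h powr p * bar a x powr p"
        using a0 by (simp add: powr_mult c_def)
      also have "\<dots> \<le> c * norm h powr p * bar a x"
        using p bar_le_1[OF a0] by (intro mult_left_mono powr_le_one_le) (auto simp: c_def)
      finally have "\<bar>bar a x - bar a (x + h)\<bar> powr p * kern a h \<le> (c * norm h powr p * bar a x) * kern a h"
        by (rule mult_right_mono) simp
      then show ?thesis using True by (simp add: algebra_simps)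
    next
      case False
      have d: "\<bar>bar a x - bar a (x + h)\<bar> \<le> bar a x + bar a (x + h)"
        using bar_nonneg[of a x] bar_nonneg[of a "x + h"] by (auto simp: abs_le_iff simp del: bar_nonneg)
      have "\<bar>bar a x - bar a (x + h)\<bar> \<le> 1"
        using bar_le_1[OF a0, of x] bar_le_1[OF a0, of "x + h"] bar_nonneg[of a x] bar_nonneg[of a "x + h"]
        by (auto simp: abs_le_iff simp del: bar_nonneg)
      then have "\<bar>bar a x - bar a (x + h)\<bar> powr p \<le> \<bar>bar a x - bar a (x + h)\<bar>"
        using p by (cases "bar a x = bar a (x + h)") (auto intro!: powr_le_one_le)
      with d have "\<bar>bar a x - bar a (x + h)\<bar> powr p * kern a h \<le> (bar a x + bar a (x + h)) * kern a h"
        by (intro mult_right_mono) auto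
      then show ?thesis using False by (simp add: indicator_def)
    qed
    have "(\<integral>\<^sup>+y. ennreal (\<bar>bar a x - bar a y\<bar> powr p * kern a (x - y)) \<partial>lborel)
      = (\<integral>\<^sup>+h. ennreal (\<bar>bar a x - bar a (x + h)\<bar> powr p * kern a h) \<partial>lborel)"
      by (subst nn_integral_lborel_translate[of _ x]) auto
    also have "\<dots> \<le> (\<integral>\<^sup>+h. ennreal (?g h) \<partial>lborel)"
      by (intro nn_integral_mono ennreal_leI le)
    also have "\<dots> = ennreal (\<integral>h. ?g h \<partial>lborel)"
      by (rule nn_integral_eq_integral[OF ig]) (use C in \<open>auto intro!: AE_I2 mult_nonneg_nonneg add_nonneg_nonneg simp: c_def\<close>)
    also have "(\<integral>h. ?g h \<partial>lborel) = c * bar a x * K + (\<integral>h. indicator {h. 1 \<le> norm h} h * (bar a x + bar a (x + h)) * kern a h \<partial>lborel)"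
      using iK C(2) by (simp add: K_def)
    also have "ennreal \<dots> \<le> ennreal ((c * K + C) * bar a x)"
      using C(3)[of x] by (intro ennreal_leI) (simp add: algebra_simps)
    finally show ?thesis .
  qed
  have "integrable lborel2 (\<lambda>z::'a \<times> 'a. \<bar>bar a (fst z) - bar a (snd z)\<bar> powr p * kern a (fst z - snd z))"
  proof (rule integrableI_bounded)
    have "(\<integral>\<^sup>+z. ennreal (norm (\<bar>bar a (fst z) - bar a (snd z)\<bar> powr p * kern a (fst z - snd z))) \<partial>(lborel2 :: ('a \<times> 'a) measure))
      = (\<integral>\<^sup>+(x::'a). \<integral>\<^sup>+y. ennreal (\<bar>bar a x - bar a y\<bar> powr p * kern a (x - y)) \<partial>lborel \<partial>lborel)"
      by (subst lborel.nn_integral_fst[symmetric]) (auto simp: abs_mult)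
    also have "\<dots> \<le> (\<integral>\<^sup>+(x::'a). ennreal ((c * K + C) * bar a x) \<partial>lborel)"
      by (intro nn_integral_mono inner)
    also have "\<dots> < \<infinity>"
    proof -
      have "integrable lborel (\<lambda>x::'a. (c * K + C) * bar a x)" using bar_integrable[OF a] by auto
      then have "(\<integral>\<^sup>+(x::'a). ennreal (norm ((c * K + C) * bar a x)) \<partial>lborel) < \<infinity>" unfolding integrable_iff_bounded by blast
      moreover have "c * K + C \<ge> 0" using K0 C by (simp add: c_def)
      ultimately show ?thesis by (simp add: abs_mult)
    qed
    finally show "(\<integral>\<^sup>+z. ennreal (norm (\<bar>bar a (fst z) - bar a (snd z)\<bar> powr p * kern a (fst z - snd z))) \<partial>(lborel2 :: ('a \<times> 'a) measure)) < \<infinity>" .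
  qed measurable
  then show ?thesis by (simp add: finite_energy_def)
qed

text \<open>Since \<open>Phi\<close> is odd, the sum is a difference of values of \<open>Phi\<close>
  whose arguments differ by a second difference of \<open>bar\<close>. The Lipschitz constant of
  \<open>Phi\<close> at scale |h| contributes the power p - 2 and the second difference the power 2,
  one power more than each term has alone.\<close>

lemma bar_near_symmetrised:
  fixes x h :: "'a::euclidean_space"
  assumes a: "0 \<le> a" and p: "p > 2" and h: "norm h \<le> 1"
  shows "\<bar>Phi p (bar a x - bar a (x + h)) + Phi p (bar a x - bar a (x - h))\<bar>
    \<le> (p - 1) * (a * 3 powr (a / 2)) powr (p - 2) * (2 * (a * (a + 3) * 3 powr (a / 2))) * bar a x * norm h powr p"
proof (cases "h = 0")
  case False
  let ?u = "bar a x - bar a (x + h)" and ?v = "bar a x - bar a (x - h)"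
  let ?c = "a * 3 powr (a / 2)"
  have b1: "?c * norm h * bar a x \<le> ?c * norm h"
    using a bar_le_1[OF a, of x] mult_left_mono[of "bar a x" 1 "?c * norm h"] by simp
  have u: "\<bar>?u\<bar> \<le> ?c * norm h" using bar_first_difference[OF a h, of x] b1 by simp
  have v: "\<bar>- ?v\<bar> \<le> ?c * norm h" using bar_first_difference[OF a, of "- h" x] h b1 by simp
  have "\<bar>Phi p ?u + Phi p ?v\<bar> = \<bar>Phi p ?u - Phi p (- ?v)\<bar>" by (simp only: Phi_uminus diff_minus_eq_add)
  also have "\<dots> \<le> (p - 1) * (?c * norm h) powr (p - 2) * \<bar>?u - (- ?v)\<bar>"
    by (rule Phi_Lipschitz[OF p u v])
  also have "\<dots> \<le> (p - 1) * (?c * norm h) powr (p - 2) * (2 * (a * (a + 3) * 3 powr (a / 2)) * (norm h)\<^sup>2 * bar a x)"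
    using bar_second_difference[OF a h, of x] p by (intro mult_left_mono) auto
  also have "\<dots> = (p - 1) * ?c powr (p - 2) * (2 * (a * (a + 3) * 3 powr (a / 2))) * bar a x * (norm h powr (p - 2) * (norm h)\<^sup>2)"
    using a by (simp add: powr_mult algebra_simps)
  also have "norm h powr (p - 2) * (norm h)\<^sup>2 = norm h powr p"
    using False by (simp add: powr_diff)
  finally show ?thesis .
qed simp

text \<open>The integral is the principal value of the operator on \<open>bar\<close>, cut off at
  distance \<open>e\<close>. The point is that \<open>C\<close> does not depend on \<open>e\<close>:
  the part beyond distance 1 is absolutely convergent, and the near part is averaged over
  \<open>h\<close> and \<open>- h\<close>.\<close>

lemma bar_truncated_operator_bound:
  assumes a: "a > real DIM('a::euclidean_space)" and ap: "a - p < real DIM('a)" and p: "p > 2"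
  shows "\<exists>C\<ge>0. \<forall>(x::'a) e. 0 < e \<and> e < 1 \<longrightarrow>
     \<bar>\<integral>h. indicator {h. e < norm h} h * Phi p (bar a x - bar a (x + h)) * kern a h \<partial>lborel\<bar> \<le> C * bar a x"
proof -
  have a0: "0 \<le> a" using a by auto
  obtain C where C: "C \<ge> 0" "\<And>x::'a. integrable lborel (\<lambda>h. indicator {h. 1 \<le> norm h} h * (bar a x + bar a (x + h)) * kern a h)"
    "\<And>x::'a. (\<integral>h. indicator {h. 1 \<le> norm h} h * (bar a x + bar a (x + h)) * kern a h \<partial>lborel) \<le> C * bar a x"
    using bar_far_bound[OF a] by blast
  define K where "K = (\<integral>(h::'a). indicator (ball 0 1) h * (norm h powr p * kern a h) \<partial>lborel)"
  have K0: "K \<ge> 0" by (auto simp: K_def)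
  have iK: "integrable lborel (\<lambda>h::'a. indicator (ball 0 1) h * (norm h powr p * kern a h))"
    by (rule integrable_norm_powr_kern_inside[OF ap])
  define c where "c = (p - 1) * (a * 3 powr (a / 2)) powr (p - 2) * (2 * (a * (a + 3) * 3 powr (a / 2)))"
  have c0: "c \<ge> 0" using p a0 by (simp add: c_def)
  show ?thesis
  proof (intro exI[of _ "c * K + C"] conjI allI impI)
    show "0 \<le> c * K + C" using K0 c0 C by simp
    fix x :: 'a and e :: real assume e: "0 < e \<and> e < 1"
    let ?d = "\<lambda>h. bar a x - bar a (x + h)"
    let ?n = "\<lambda>h. indicator {h. e < norm h \<and> norm h < 1} h * Phi p (?d h) * kern a h"
    let ?f = "\<lambda>h. indicator {h. 1 \<le> norm h} h * Phi p (?d h) * kern a h"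
    have d1: "\<bar>?d h\<bar> \<le> 1" "\<bar>?d h\<bar> \<le> bar a x + bar a (x + h)" for h
      using bar_le_1[OF a0, of x] bar_le_1[OF a0, of "x + h"] bar_nonneg[of a x] bar_nonneg[of a "x + h"]
      by (auto simp: abs_le_iff simp del: bar_nonneg)
    have P1: "\<bar>Phi p (?d h)\<bar> \<le> 1" "\<bar>Phi p (?d h)\<bar> \<le> bar a x + bar a (x + h)" for h
      using Phi_le_abs[OF p d1(1)[of h]] d1[of h] by linarith+
    have it: "integrable lborel (\<lambda>h::'a. indicator {h. e < norm h} h * kern a h)"
      using integrable_kern_truncated[OF a] e by blast
    have in1: "integrable lborel ?n"
      by (rule Bochner_Integration.integrable_bound[OF it])
        (use P1(1) in \<open>auto intro!: AE_I2 simp: indicator_def abs_mult mult_left_le_one_le\<close>)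
    have if1: "integrable lborel ?f"
      by (rule Bochner_Integration.integrable_bound[OF it])
        (use P1(1) e in \<open>auto intro!: AE_I2 simp: indicator_def abs_mult mult_left_le_one_le\<close>)
    have split: "(\<integral>h. indicator {h. e < norm h} h * Phi p (?d h) * kern a h \<partial>lborel) = (\<integral>h. ?n h \<partial>lborel) + (\<integral>h. ?f h \<partial>lborel)"
      using e by (subst Bochner_Integration.integral_add[OF in1 if1, symmetric])
        (auto intro!: Bochner_Integration.integral_cong simp: indicator_def)
    have far: "\<bar>\<integral>h. ?f h \<partial>lborel\<bar> \<le> C * bar a x"
    proof -
      have "\<bar>\<integral>h. ?f h \<partial>lborel\<bar> \<le> (\<integral>h. indicator {h. 1 \<le> norm h} h * (bar a x + bar a (x + h)) * kern a h \<partial>lborel)"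
        by (rule Bochner_Integration.integral_abs_bound_integral[OF if1 C(2)])
          (use P1(2) in \<open>auto simp: indicator_def abs_mult intro!: mult_right_mono\<close>)
      then show ?thesis using C(3)[of x] by linarith
    qed
    \<comment> \<open>Twice the near integral equals the integral of \<open>?n h + ?n (- h)\<close>,
      to which the symmetrised bound applies.\<close>
    have near: "\<bar>\<integral>h. ?n h \<partial>lborel\<bar> \<le> c * K * bar a x"
    proof -
      have inr: "integrable lborel (\<lambda>h. ?n (- h))" by (rule integrable_lborel_reflect[OF in1])
      have m: "?n \<in> borel_measurable borel" by measurable
      have "(\<integral>h. ?n h + ?n (- h) \<partial>lborel) = (\<integral>h. ?n h \<partial>lborel) + (\<integral>h. ?n (- h) \<partial>lborel)"
        by (rule Bochner_Integration.integral_add[OF in1 inr])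
      also have "(\<integral>h. ?n (- h) \<partial>lborel) = (\<integral>h. ?n h \<partial>lborel)" by (rule integral_lborel_reflect[OF m])
      finally have eq: "2 * (\<integral>h. ?n h \<partial>lborel) = (\<integral>h. ?n h + ?n (- h) \<partial>lborel)" by simp
      have "\<bar>\<integral>h. ?n h + ?n (- h) \<partial>lborel\<bar> \<le> (\<integral>(h::'a). c * bar a x * (indicator (ball 0 1) h * (norm h powr p * kern a h)) \<partial>lborel)"
      proof (rule Bochner_Integration.integral_abs_bound_integral)
        show "integrable lborel (\<lambda>h. ?n h + ?n (- h))" using in1 inr by (rule Bochner_Integration.integrable_add)
        show "integrable lborel (\<lambda>h::'a. c * bar a x * (indicator (ball 0 1) h * (norm h powr p * kern a h)))"
          using iK by auto
        fix h :: 'a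
        show "\<bar>?n h + ?n (- h)\<bar> \<le> c * bar a x * (indicator (ball 0 1) h * (norm h powr p * kern a h))"
        proof (cases "e < norm h \<and> norm h < 1")
          case True
          have "?n h + ?n (- h) = (Phi p (bar a x - bar a (x + h)) + Phi p (bar a x - bar a (x - h))) * kern a h"
            using True by (simp add: distrib_right)
          also have "\<bar>\<dots>\<bar> \<le> (c * bar a x * norm h powr p) * kern a h"
            unfolding abs_mult c_def using bar_near_symmetrised[OF a0 p, of h x] True
            by (auto intro!: mult_right_mono)
          finally show ?thesis using True by (simp add: mult.assoc)
        next
          case False
          then show ?thesis using c0 by (auto simp: indicator_def intro!: mult_nonneg_nonneg)
        qed
      qed
      also have "\<dots> = c * bar a x * K" using iK by (simp add: K_def)
      finally have "2 * \<bar>\<integral>h. ?n h \<partial>lborel\<bar> \<le> c * bar a x * K" using eq by simp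
      then show ?thesis by (simp add: mult.commute mult.left_commute)
    qed
    show "\<bar>\<integral>h. indicator {h. e < norm h} h * Phi p (?d h) * kern a h \<partial>lborel\<bar> \<le> (c * K + C) * bar a x"
      unfolding split distrib_right using near far by linarith
  qed
qed

text \<open>For \<open>|x - y| > e\<close> the kernel is integrable and the form becomes an integral against \<open>\<psi>\<close>; the
  cancellation between \<open>h\<close> and \<open>- h\<close> makes the resulting bound independent of \<open>e\<close>.\<close>
lemma bar_eform_bound:
  assumes a: "a > real DIM('a::euclidean_space)" and ap: "a - p < real DIM('a)" and p: "p > 2"
  shows "\<exists>C\<ge>0. \<forall>\<psi>::'a \<Rightarrow> real. in_L2 \<psi> \<and> finite_energy a p \<psi> \<and> (\<forall>x. 0 \<le> \<psi> x) \<longrightarrow>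
     \<bar>eform a p (bar a) \<psi>\<bar> \<le> C * (\<integral>x. bar a x * \<psi> x \<partial>lborel)"
proof -
  have a0: "0 \<le> a" using a by auto
  obtain C where C: "C \<ge> 0" "\<And>(x::'a) e. 0 < e \<and> e < 1 \<Longrightarrow>
     \<bar>\<integral>h. indicator {h. e < norm h} h * Phi p (bar a x - bar a (x + h)) * kern a h \<partial>lborel\<bar> \<le> C * bar a x"
    using bar_truncated_operator_bound[OF assms] by blast
  show ?thesis
  proof (intro exI[of _ "2 * C"] conjI allI impI)
    show "0 \<le> 2 * C" using C by simp
    fix \<psi> :: "'a \<Rightarrow> real" assume \<psi>: "in_L2 \<psi> \<and> finite_energy a p \<psi> \<and> (\<forall>x. 0 \<le> \<psi> x)"
    then have L: "in_L2 \<psi>" and fe: "finite_energy a p \<psi>" and pos: "\<And>x. 0 \<le> \<psi> x" by auto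
    have [measurable]: "\<psi> \<in> borel_measurable borel" using L by (simp add: in_L2_def)
    let ?I = "\<integral>x. bar a x * \<psi> x \<partial>lborel"
    have iI: "integrable lborel (\<lambda>x. bar a x * \<psi> x)" by (rule in_L2_mult_integrable[OF bar_in_L2[OF a] L])
    let ?Z = "\<lambda>z. Phi p (bar a (fst z) - bar a (snd z)) * (\<psi> (fst z) - \<psi> (snd z)) * kern a (fst z - snd z)"
    have iZ: "integrable lborel2 ?Z" by (rule eform_integrable[OF bar_finite_energy[OF a ap p] fe p])
    define e where "e n = 1 / real (n + 2)" for n
    have e: "0 < e n" "e n < 1" for n by (auto simp: e_def)
    have e0: "e \<longlonglongrightarrow> 0" unfolding e_def
      using LIMSEQ_ignore_initial_segment[OF lim_const_over_n[of "1::real"], of 2] by simp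
    \<comment> \<open>Only the part of the integrand carrying \<open>\<psi> (fst z)\<close>. It can
      be separated from the part with \<open>\<psi> (snd z)\<close> only because the truncated
      kernel is integrable.\<close>
    define T where "T n z = indicator {h. e n < norm h} (fst z - snd z) * Phi p (bar a (fst z) - bar a (snd z)) * \<psi> (fst z) * kern a (fst z - snd z)"
      for n and z :: "'a \<times> 'a"
    have Tm[measurable]: "T n \<in> borel_measurable lborel2" for n
      unfolding T_def by measurable
    \<comment> \<open>The values of \<open>Phi\<close> are at most \<open>bar a x + bar a y\<close>,
      and products with \<open>\<psi>\<close> are split into squares; each square is integrable
      against the truncated kernel.\<close>
    have iT: "integrable lborel2 (T n)" for n
    proof (rule Bochner_Integration.integrable_bound)
      let ?k = "\<lambda>h::'a. indicator {h. e n < norm h} h * kern a h"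
      have ik: "integrable lborel ?k" by (rule integrable_kern_truncated[OF a e(1)])
      have ib: "integrable lborel (\<lambda>x::'a. (bar a x)\<^sup>2)" using bar_in_L2[OF a] by (simp add: in_L2_def)
      have isq: "integrable lborel (\<lambda>x. (bar a x)\<^sup>2 + (\<psi> x)\<^sup>2)" using L ib by (simp add: in_L2_def)
      have s1: "integrable lborel2 (\<lambda>z. ((bar a (fst z))\<^sup>2 + (\<psi> (fst z))\<^sup>2) * ?k (fst z - snd z))"
        by (rule integrable_mult_kernel[OF isq ik])
      have sw: "integrable lborel2 (\<lambda>(x,y). (\<lambda>z. (bar a (fst z))\<^sup>2 * ?k (fst z - snd z)) (y, x))"
        by (rule lborel_pair.integrable_product_swap) (rule integrable_mult_kernel[OF ib ik])
      have s2: "integrable lborel2 (\<lambda>z. (bar a (snd z))\<^sup>2 * ?k (fst z - snd z))"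
      proof -
        have "(\<lambda>(x,y). (\<lambda>z. (bar a (fst z))\<^sup>2 * ?k (fst z - snd z)) (y, x)) = (\<lambda>z. (bar a (snd z))\<^sup>2 * ?k (fst z - snd z))"
          by (auto simp: fun_eq_iff indicator_def kern_def norm_minus_commute)
        then show ?thesis using sw by simp
      qed
      show "integrable lborel2 (\<lambda>z. ((bar a (fst z))\<^sup>2 + (\<psi> (fst z))\<^sup>2) * ?k (fst z - snd z) + (bar a (snd z))\<^sup>2 * ?k (fst z - snd z))"
        using s1 s2 by (rule Bochner_Integration.integrable_add)
      show "AE z in lborel2. norm (T n z) \<le> norm (((bar a (fst z))\<^sup>2 + (\<psi> (fst z))\<^sup>2) * ?k (fst z - snd z) + (bar a (snd z))\<^sup>2 * ?k (fst z - snd z))"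
      proof (rule AE_I2)
        fix z :: "'a \<times> 'a"
        let ?x = "fst z" and ?y = "snd z"
        have b: "0 \<le> bar a ?x" "0 \<le> bar a ?y" "bar a ?x \<le> 1" "bar a ?y \<le> 1" using bar_le_1[OF a0] by auto
        have d: "\<bar>bar a ?x - bar a ?y\<bar> \<le> 1" "\<bar>bar a ?x - bar a ?y\<bar> \<le> bar a ?x + bar a ?y"
          using b by (simp_all only: abs_le_iff) linarith+
        have "\<bar>Phi p (bar a ?x - bar a ?y)\<bar> \<le> bar a ?x + bar a ?y"
          using Phi_le_abs[OF p d(1)] d(2) by linarith
        then have "\<bar>Phi p (bar a ?x - bar a ?y)\<bar> * \<psi> ?x \<le> (bar a ?x + bar a ?y) * \<psi> ?x"
          by (intro mult_right_mono pos)
        also have "\<dots> \<le> (bar a ?x)\<^sup>2 + (\<psi> ?x)\<^sup>2 + (bar a ?y)\<^sup>2"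
        proof -
          have "2 * bar a ?x * \<psi> ?x \<le> (bar a ?x)\<^sup>2 + (\<psi> ?x)\<^sup>2" "2 * bar a ?y * \<psi> ?x \<le> (bar a ?y)\<^sup>2 + (\<psi> ?x)\<^sup>2"
            by (rule sum_squares_bound)+
          moreover have "0 \<le> (bar a ?x)\<^sup>2" "0 \<le> (bar a ?y)\<^sup>2" by auto
          ultimately show ?thesis unfolding distrib_right by linarith
        qed
        finally have *: "\<bar>Phi p (bar a ?x - bar a ?y)\<bar> * \<psi> ?x \<le> (bar a ?x)\<^sup>2 + (\<psi> ?x)\<^sup>2 + (bar a ?y)\<^sup>2" .
        have "norm (T n z) = (\<bar>Phi p (bar a ?x - bar a ?y)\<bar> * \<psi> ?x) * ?k (?x - ?y)"
          using pos[of ?x] by (simp add: T_def abs_mult)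
        also have "\<dots> \<le> ((bar a ?x)\<^sup>2 + (\<psi> ?x)\<^sup>2 + (bar a ?y)\<^sup>2) * ?k (?x - ?y)"
          by (rule mult_right_mono[OF *]) simp
        finally show "norm (T n z) \<le> norm (((bar a ?x)\<^sup>2 + (\<psi> ?x)\<^sup>2) * ?k (?x - ?y) + (bar a ?y)\<^sup>2 * ?k (?x - ?y))"
          unfolding real_norm_def distrib_right by (rule order_trans[OF _ abs_ge_self])
      qed
    qed measurable
    have bT: "\<bar>\<integral>z. T n z \<partial>lborel2\<bar> \<le> C * ?I" for n
    proof -
      have "(\<integral>z. T n z \<partial>lborel2) = (\<integral>x. \<integral>y. T n (x, y) \<partial>lborel \<partial>lborel)"
        by (rule lborel_pair.integral_fst'[OF iT, symmetric])
      also have "\<bar>\<dots>\<bar> \<le> (\<integral>x. C * (bar a x * \<psi> x) \<partial>lborel)"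
      proof (rule Bochner_Integration.integral_abs_bound_integral)
        show "integrable lborel (\<lambda>x. \<integral>y. T n (x, y) \<partial>lborel)" by (rule lborel_pair.integrable_fst'[OF iT])
        show "integrable lborel (\<lambda>x. C * (bar a x * \<psi> x))" using iI by auto
        fix x :: 'a
        have "(\<integral>y. T n (x, y) \<partial>lborel) = (\<integral>h. T n (x, x + h) \<partial>lborel)"
          by (rule integral_lborel_translate) measurable
        also have "\<dots> = (\<integral>h. \<psi> x * (indicator {h. e n < norm h} h * Phi p (bar a x - bar a (x + h)) * kern a h) \<partial>lborel)"
          by (intro Bochner_Integration.integral_cong) (auto simp: T_def indicator_def)
        also have "\<dots> = \<psi> x * (\<integral>h. indicator {h. e n < norm h} h * Phi p (bar a x - bar a (x + h)) * kern a h \<partial>lborel)"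
          by simp
        finally have eq: "(\<integral>y. T n (x, y) \<partial>lborel) = \<psi> x * (\<integral>h. indicator {h. e n < norm h} h * Phi p (bar a x - bar a (x + h)) * kern a h \<partial>lborel)" .
        show "\<bar>\<integral>y. T n (x, y) \<partial>lborel\<bar> \<le> C * (bar a x * \<psi> x)"
          unfolding eq abs_mult using mult_left_mono[OF C(2)[of "e n" x] pos[of x]] e[of n] pos[of x] by (simp add: algebra_simps)
      qed
      finally show ?thesis using iI by simp
    qed
    \<comment> \<open>Exchanging the two points changes the sign of \<open>Phi\<close> and turns the
      part with \<open>\<psi> (snd z)\<close> into the part with \<open>\<psi> (fst z)\<close>; this
      produces the factor 2 in the final constant.\<close>
    have sw: "(\<integral>z. indicator {h. e n < norm h} (fst z - snd z) * ?Z z \<partial>lborel2) = 2 * (\<integral>z. T n z \<partial>lborel2)" for n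
    proof -
      have "indicator {h. e n < norm h} (fst z - snd z) * ?Z z = T n z + (\<lambda>(x, y). T n (y, x)) z" for z :: "'a \<times> 'a"
      proof -
        have P: "Phi p (bar a (fst z) - bar a (snd z)) = - Phi p (bar a (snd z) - bar a (fst z))"
          using Phi_uminus[of p "bar a (snd z) - bar a (fst z)"] by simp
        have "norm (snd z - fst z) = norm (fst z - snd z)" by (rule norm_minus_commute)
        then show ?thesis
          by (auto simp: T_def case_prod_beta kern_commute[of a "snd z"] indicator_def P algebra_simps)
      qed
      then have "(\<integral>z. indicator {h. e n < norm h} (fst z - snd z) * ?Z z \<partial>lborel2) = (\<integral>z. T n z + (\<lambda>(x, y). T n (y, x)) z \<partial>lborel2)"
        by simp
      also have "\<dots> = (\<integral>z. T n z \<partial>lborel2) + (\<integral>z. (\<lambda>(x, y). T n (y, x)) z \<partial>lborel2)"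
        by (rule Bochner_Integration.integral_add[OF iT lborel_pair.integrable_product_swap[OF iT]])
      also have "(\<integral>z. (\<lambda>(x, y). T n (y, x)) z \<partial>lborel2) = (\<integral>z. T n z \<partial>lborel2)"
        by (rule lborel_pair.integral_product_swap[OF Tm])
      finally show ?thesis by simp
    qed
    \<comment> \<open>Without truncation the integrand is absolutely integrable by finite energy, so
      it dominates. On the diagonal, which no truncation ever includes, it vanishes because
      \<open>kern a 0 = 0\<close>.\<close>
    have lim: "(\<lambda>n. \<integral>z. indicator {h. e n < norm h} (fst z - snd z) * ?Z z \<partial>lborel2) \<longlonglongrightarrow> (\<integral>z. ?Z z \<partial>lborel2)"
    proof (rule integral_dominated_convergence)
      show "integrable lborel2 (\<lambda>z. norm (?Z z))" using iZ by (rule integrable_norm)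
      show "AE z in lborel2. (\<lambda>n. indicator {h. e n < norm h} (fst z - snd z) * ?Z z) \<longlonglongrightarrow> ?Z z"
      proof (rule AE_I2)
        fix z :: "'a \<times> 'a"
        show "(\<lambda>n. indicator {h. e n < norm h} (fst z - snd z) * ?Z z) \<longlonglongrightarrow> ?Z z"
        proof (cases "fst z = snd z")
          case False
          then have "\<forall>\<^sub>F n in sequentially. e n < norm (fst z - snd z)"
            using order_tendstoD(2)[OF e0] by simp
          then have "\<forall>\<^sub>F n in sequentially. indicator {h. e n < norm h} (fst z - snd z) * ?Z z = ?Z z"
            by eventually_elim simp
          then show ?thesis by (rule tendsto_eventually)
        qed simp
      qed
      fix n
      show "AE z in lborel2. norm (indicator {h. e n < norm h} (fst z - snd z) * ?Z z) \<le> norm (?Z z)"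
        by (rule AE_I2) (simp add: indicator_def)
    qed (use iZ in measurable)
    have "\<bar>\<integral>z. ?Z z \<partial>lborel2\<bar> \<le> 2 * C * ?I"
    proof (rule LIMSEQ_le_const2[OF tendsto_rabs[OF lim]], intro exI[of _ 0] allI impI)
      fix n
      show "\<bar>\<integral>z. indicator {h. e n < norm h} (fst z - snd z) * ?Z z \<partial>lborel2\<bar> \<le> 2 * C * ?I"
        unfolding sw using bT[of n] by (simp add: abs_mult)
    qed
    then show "\<bar>eform a p (bar a) \<psi>\<bar> \<le> 2 * C * ?I" by (simp add: eform_def)
  qed
qed

section \<open>Curves in \<open>L\<^sup>2\<close> and comparison\<close>

lemma AE_lborel_affine:
  fixes P :: "real \<Rightarrow> bool"
  assumes c: "c \<noteq> 0" and P: "AE x in lborel. P x"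
  shows "AE x in lborel. P (t + c * x)"
proof -
  obtain N where N: "{x \<in> space lborel. \<not> P x} \<subseteq> N" "emeasure lborel N = 0" "N \<in> sets lborel"
    using P by (auto elim: AE_E)
  have "AE x in lborel. x \<notin> N" using N by (intro AE_not_in) auto
  then have "AE x in lborel. t + c * x \<notin> N"
    using N(3) by (intro AE_borel_affine[OF c]) (auto simp: pred_def)
  then show ?thesis by eventually_elim (use N(1) in auto)
qed

text \<open>The regularity of a solution at positive times only. The initial value is kept separate,
  so that barriers and the self-similar solution, whose \<open>L2\<close> norm blows up at time 0,
  are covered too.\<close>

definition L2_curve :: "(real \<Rightarrow> 'a::euclidean_space \<Rightarrow> real) \<Rightarrow> bool" where
  "L2_curve f \<longleftrightarrow> (\<forall>t>0. in_L2 (f t)) \<and>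
     (\<forall>\<delta> T. 0 < \<delta> \<longrightarrow> (\<exists>L. \<forall>t1\<in>{\<delta>..T}. \<forall>t2\<in>{\<delta>..T}. L2norm (\<lambda>x. f t1 x - f t2 x) \<le> L * \<bar>t1 - t2\<bar>))"

definition L2_deriv :: "(real \<Rightarrow> 'a::euclidean_space \<Rightarrow> real) \<Rightarrow> real \<Rightarrow> ('a \<Rightarrow> real) \<Rightarrow> bool" where
  "L2_deriv f t d \<longleftrightarrow> in_L2 d \<and> ((\<lambda>h. L2norm (\<lambda>x. (f (t + h) x - f t x) / h - d x)) \<longlongrightarrow> 0) (at 0)"

lemma L2_curve_in_L2: "L2_curve f \<Longrightarrow> 0 < t \<Longrightarrow> in_L2 (f t)"
  by (auto simp: L2_curve_def)

lemma L2_curve_eventually: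
  assumes "L2_curve f" "0 < t" shows "\<forall>\<^sub>F h in at 0. in_L2 (f (t + h))"
  unfolding eventually_at using assms by (intro exI[of _ t]) (auto simp: dist_real_def intro!: L2_curve_in_L2)

lemma L2_curve_diff:
  assumes f: "L2_curve f" and g: "L2_curve g"
  shows "L2_curve (\<lambda>t x. f t x - g t x)"
  unfolding L2_curve_def
proof (intro conjI allI impI)
  fix t :: real assume "0 < t"
  then show "in_L2 (\<lambda>x. f t x - g t x)" using f g by (intro in_L2_diff) (auto simp: L2_curve_def)
next
  fix \<delta> T :: real assume d: "0 < \<delta>"
  obtain L1 L2 where L1: "\<forall>t1\<in>{\<delta>..T}. \<forall>t2\<in>{\<delta>..T}. L2norm (\<lambda>x. f t1 x - f t2 x) \<le> L1 * \<bar>t1 - t2\<bar>"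
    and L2: "\<forall>t1\<in>{\<delta>..T}. \<forall>t2\<in>{\<delta>..T}. L2norm (\<lambda>x. g t1 x - g t2 x) \<le> L2 * \<bar>t1 - t2\<bar>"
    using f g d unfolding L2_curve_def by meson
  show "\<exists>L. \<forall>t1\<in>{\<delta>..T}. \<forall>t2\<in>{\<delta>..T}. L2norm (\<lambda>x. f t1 x - g t1 x - (f t2 x - g t2 x)) \<le> L * \<bar>t1 - t2\<bar>"
  proof (intro exI[of _ "L1 + L2"] ballI)
    fix t1 t2 assume t: "t1 \<in> {\<delta>..T}" "t2 \<in> {\<delta>..T}"
    have "L2norm (\<lambda>x. (f t1 x - f t2 x) - (g t1 x - g t2 x)) \<le> L2norm (\<lambda>x. f t1 x - f t2 x) + L2norm (\<lambda>x. g t1 x - g t2 x)"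
      using f g t d by (intro L2norm_triangle_diff in_L2_diff) (auto simp: L2_curve_def)
    also have "\<dots> \<le> L1 * \<bar>t1 - t2\<bar> + L2 * \<bar>t1 - t2\<bar>" using L1 L2 t by (intro add_mono) blast+
    finally show "L2norm (\<lambda>x. f t1 x - g t1 x - (f t2 x - g t2 x)) \<le> (L1 + L2) * \<bar>t1 - t2\<bar>"
      by (simp add: distrib_right algebra_simps)
  qed
qed

lemma L2_deriv_diff:
  assumes f: "L2_curve f" and g: "L2_curve g" and t: "0 < t" and d: "L2_deriv f t d" and e: "L2_deriv g t e"
  shows "L2_deriv (\<lambda>t x. f t x - g t x) t (\<lambda>x. d x - e x)"
  unfolding L2_deriv_def
proof
  show "in_L2 (\<lambda>x. d x - e x)" using d e by (intro in_L2_diff) (auto simp: L2_deriv_def)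
  let ?F = "\<lambda>h x. (f (t + h) x - f t x) / h - d x" and ?G = "\<lambda>h x. (g (t + h) x - g t x) / h - e x"
  have q: "in_L2 (\<lambda>x. (k (t + h) x - k t x) / h - m x)" if "in_L2 (k (t + h))" "in_L2 (k t)" "in_L2 m" for k m and h
    using in_L2_diff[OF in_L2_cmult[OF in_L2_diff[OF that(1,2)], of "1 / h"] that(3)] by simp
  have ev: "\<forall>\<^sub>F h in at 0. norm (L2norm (\<lambda>x. ((f (t + h) x - g (t + h) x) - (f t x - g t x)) / h - (d x - e x))) \<le> L2norm (?F h) + L2norm (?G h)"
    using L2_curve_eventually[OF f t] L2_curve_eventually[OF g t]
  proof eventually_elim
    case (elim h)
    have "L2norm (\<lambda>x. ?F h x - ?G h x) \<le> L2norm (?F h) + L2norm (?G h)"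
      using elim d e f g t by (intro L2norm_triangle_diff q) (auto simp: L2_deriv_def L2_curve_def)
    moreover have "(\<lambda>x. ?F h x - ?G h x) = (\<lambda>x. ((f (t + h) x - g (t + h) x) - (f t x - g t x)) / h - (d x - e x))"
      by (auto simp: fun_eq_iff diff_divide_distrib)
    ultimately show ?case by simp
  qed
  have "((\<lambda>h. L2norm (?F h) + L2norm (?G h)) \<longlongrightarrow> 0 + 0) (at 0)"
    using d e by (intro tendsto_add) (auto simp: L2_deriv_def)
  then have "((\<lambda>h. L2norm (?F h) + L2norm (?G h)) \<longlongrightarrow> 0) (at 0)" by simp
  from Lim_null_comparison[OF ev this]
  show "((\<lambda>h. L2norm (\<lambda>x. ((f (t + h) x - g (t + h) x) - (f t x - g t x)) / h - (d x - e x))) \<longlongrightarrow> 0) (at 0)" .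
qed

text \<open>The integral in the hypothesis is half the time derivative of the squared norm of the
  positive part of \<open>f - g\<close> on \<open>S\<close>. Each comparison below amounts to
  checking its sign, whether \<open>g\<close> is a flow or an explicit barrier.\<close>

lemma curve_comparison:
  fixes f g :: "real \<Rightarrow> 'a::euclidean_space \<Rightarrow> real"
  assumes f: "L2_curve f" and g: "L2_curve g" and S: "S \<in> sets borel" and b: "0 < b"
    and lim: "((\<lambda>t. pos_part_sq S (\<lambda>x. f t x - g t x)) \<longlongrightarrow> 0) (at_right 0)"
    and ae: "AE t in lborel. t \<in> {0<..<b} \<longrightarrow> (\<exists>d e. L2_deriv f t d \<and> L2_deriv g t e \<and>
        (\<integral>x. indicator S x * max 0 (f t x - g t x) * (d x - e x) \<partial>lborel) \<le> 0)"
  shows "AE x in lborel. x \<in> S \<longrightarrow> f b x \<le> g b x"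
proof -
  have c: "L2_curve (\<lambda>t x. f t x - g t x)" by (rule L2_curve_diff[OF f g])
  have "AE x in lborel. x \<in> S \<longrightarrow> f b x - g b x \<le> 0"
  proof (rule pos_part_sq_decay[where f = "\<lambda>t x. f t x - g t x", OF S _ _ _ lim b])
    show "0 < t \<Longrightarrow> in_L2 (\<lambda>x. f t x - g t x)" for t using c by (simp add: L2_curve_def)
    show "0 < a \<Longrightarrow> a \<le> b \<Longrightarrow> \<exists>L. \<forall>t1\<in>{a..b}. \<forall>t2\<in>{a..b}. L2norm (\<lambda>x. f t1 x - g t1 x - (f t2 x - g t2 x)) \<le> L * \<bar>t1 - t2\<bar>" for a
      using c by (simp add: L2_curve_def)
    show "AE t in lborel. t \<in> {0<..<b} \<longrightarrow> (\<exists>d. in_L2 d \<and>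
        ((\<lambda>h. L2norm (\<lambda>x. (f (t + h) x - g (t + h) x - (f t x - g t x)) / h - d x)) \<longlongrightarrow> 0) (at 0) \<and>
        (\<integral>x. indicator S x * max 0 (f t x - g t x) * d x \<partial>lborel) \<le> 0)"
      using ae
    proof eventually_elim
      case (elim t)
      show ?case
      proof
        assume t: "t \<in> {0<..<b}"
        then obtain d e where de: "L2_deriv f t d" "L2_deriv g t e"
          "(\<integral>x. indicator S x * max 0 (f t x - g t x) * (d x - e x) \<partial>lborel) \<le> 0" using elim by blast
        have "L2_deriv (\<lambda>t x. f t x - g t x) t (\<lambda>x. d x - e x)"
          using t by (intro L2_deriv_diff[OF f g _ de(1,2)]) auto
        then show "\<exists>d. in_L2 d \<and>
        ((\<lambda>h. L2norm (\<lambda>x. (f (t + h) x - g (t + h) x - (f t x - g t x)) / h - d x)) \<longlongrightarrow> 0) (at 0) \<and>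
        (\<integral>x. indicator S x * max 0 (f t x - g t x) * d x \<partial>lborel) \<le> 0"
          using de(3) unfolding L2_deriv_def by blast
      qed
    qed
  qed
  then show ?thesis by eventually_elim simp
qed

text \<open>The derivative of \<open>g\<close> needs a bound only away from 0; this admits
  \<open>t powr \<gamma>\<close> with \<gamma> < 1, whose slope is infinite at 0.\<close>

lemma L2_curve_barrier:
  assumes b: "in_L2 b" and g: "\<And>t. 0 < t \<Longrightarrow> (g has_real_derivative g' t) (at t)"
    and K: "\<And>\<delta>. 0 < \<delta> \<Longrightarrow> \<exists>K. \<forall>t\<ge>\<delta>. \<bar>g' t\<bar> \<le> K"
  shows "L2_curve (\<lambda>t x. g t * b x)"
  unfolding L2_curve_def
proof (intro conjI allI impI in_L2_cmult b)
  fix \<delta> T :: real assume d: "0 < \<delta>"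
  obtain K where K: "\<forall>t\<ge>\<delta>. \<bar>g' t\<bar> \<le> K" using K[OF d] by blast
  have lip: "\<bar>g x - g y\<bar> \<le> K * \<bar>x - y\<bar>" if xy: "\<delta> \<le> x" "x < y" for x y
  proof -
    have "\<exists>z>x. z < y \<and> g y - g x = (y - x) * g' z"
      using xy d by (intro MVT2 g) auto
    then obtain z where z: "x < z" "z < y" "g y - g x = (y - x) * g' z" by blast
    have "\<bar>g x - g y\<bar> = (y - x) * \<bar>g' z\<bar>" using z by (metis abs_minus_commute abs_mult abs_of_pos diff_gt_0_iff_gt xy(2))
    also have "\<dots> \<le> (y - x) * K" using K z xy by (intro mult_left_mono) auto
    finally show ?thesis using xy by (simp add: mult.commute)
  qed
  show "\<exists>L. \<forall>t1\<in>{\<delta>..T}. \<forall>t2\<in>{\<delta>..T}. L2norm (\<lambda>x. g t1 * b x - g t2 * b x) \<le> L * \<bar>t1 - t2\<bar>"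
  proof (intro exI[of _ "K * L2norm b"] ballI)
    fix t1 t2 assume t: "t1 \<in> {\<delta>..T}" "t2 \<in> {\<delta>..T}"
    have "\<bar>g t1 - g t2\<bar> \<le> K * \<bar>t1 - t2\<bar>"
      using lip[of t1 t2] lip[of t2 t1] t by (cases t1 t2 rule: linorder_cases) (auto simp: abs_minus_commute)
    then have "\<bar>g t1 - g t2\<bar> * L2norm b \<le> K * \<bar>t1 - t2\<bar> * L2norm b" by (rule mult_right_mono) simp
    moreover have "L2norm (\<lambda>x. g t1 * b x - g t2 * b x) = \<bar>g t1 - g t2\<bar> * L2norm b"
      using L2norm_cmult[of "g t1 - g t2" b] by (simp add: left_diff_distrib)
    ultimately show "L2norm (\<lambda>x. g t1 * b x - g t2 * b x) \<le> K * L2norm b * \<bar>t1 - t2\<bar>"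
      by (simp add: mult_ac)
  qed
qed

lemma L2_deriv_barrier:
  assumes b: "in_L2 b" and g: "(g has_real_derivative D) (at t)"
  shows "L2_deriv (\<lambda>t x. g t * b x) t (\<lambda>x. D * b x)"
  unfolding L2_deriv_def
proof
  show "in_L2 (\<lambda>x. D * b x)" by (rule in_L2_cmult[OF b])
  have "L2norm (\<lambda>x. (g (t + h) * b x - g t * b x) / h - D * b x) = \<bar>(g (t + h) - g t) / h - D\<bar> * L2norm b" for h
  proof -
    have "(\<lambda>x. (g (t + h) * b x - g t * b x) / h - D * b x) = (\<lambda>x. ((g (t + h) - g t) / h - D) * b x)"
      by (auto simp: fun_eq_iff left_diff_distrib diff_divide_distrib)
    then show ?thesis by (simp add: L2norm_cmult)
  qed
  moreover have "((\<lambda>h. \<bar>(g (t + h) - g t) / h - D\<bar> * L2norm b) \<longlongrightarrow> \<bar>D - D\<bar> * L2norm b) (at 0)"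
    using g unfolding DERIV_def by (intro tendsto_intros)
  ultimately show "((\<lambda>h. L2norm (\<lambda>x. (g (t + h) * b x - g t * b x) / h - D * b x)) \<longlongrightarrow> 0) (at 0)" by simp
qed

section \<open>Gradient flows without initial datum, their time shifts and amplitude scaling\<close>

definition flow :: "real \<Rightarrow> real \<Rightarrow> (real \<Rightarrow> 'a::euclidean_space \<Rightarrow> real) \<Rightarrow> bool" where
  "flow s p v \<longleftrightarrow> L2_curve v \<and>
     (AE t in lborel. 0 < t \<longrightarrow> (\<exists>w. L2_deriv v t (\<lambda>x. - w x) \<and> subdiffJ s p (v t) w))"

lemma is_solution_imp_flow:
  assumes "is_solution s p u0 u" shows "flow s p u"
proof -
  have "AE t in lborel. 0 < t \<longrightarrow> (\<exists>w. ((\<lambda>h. L2norm (\<lambda>x. (u (t + h) x - u t x) / h + w x)) \<longlongrightarrow> 0) (at 0) \<and> subdiffJ s p (u t) w)"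
    using assms by (simp add: is_solution_def)
  then have "AE t in lborel. 0 < t \<longrightarrow> (\<exists>w. L2_deriv u t (\<lambda>x. - w x) \<and> subdiffJ s p (u t) w)"
  proof eventually_elim
    case (elim t)
    show ?case
    proof
      assume "0 < t"
      then obtain w where w: "((\<lambda>h. L2norm (\<lambda>x. (u (t + h) x - u t x) / h + w x)) \<longlongrightarrow> 0) (at 0)" "subdiffJ s p (u t) w"
        using elim by blast
      have "in_L2 w" using w(2) by (simp add: subdiffJ_def)
      then have "L2_deriv u t (\<lambda>x. - w x)" using w(1) by (simp add: L2_deriv_def in_L2_uminus)
      with w(2) show "\<exists>w. L2_deriv u t (\<lambda>x. - w x) \<and> subdiffJ s p (u t) w" by (intro exI[of _ w] conjI)
    qed
  qed
  then show ?thesis using assms by (auto simp: flow_def L2_curve_def is_solution_def)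
qed

lemma L2_deriv_shift: "L2_deriv (\<lambda>t. v (c + t)) t d \<longleftrightarrow> L2_deriv v (c + t) d"
  by (simp add: L2_deriv_def add.assoc)

lemma flow_shift:
  assumes v: "flow s p v" and c: "0 \<le> c"
  shows "flow s p (\<lambda>t. v (c + t))"
proof -
  have "AE t in lborel. 0 < c + 1 * t \<longrightarrow> (\<exists>w. L2_deriv v (c + 1 * t) (\<lambda>x. - w x) \<and> subdiffJ s p (v (c + 1 * t)) w)"
    using v by (intro AE_lborel_affine) (auto simp: flow_def)
  then have "AE t in lborel. 0 < t \<longrightarrow> (\<exists>w. L2_deriv (\<lambda>t. v (c + t)) t (\<lambda>x. - w x) \<and> subdiffJ s p (v (c + t)) w)"
    by eventually_elim (use c in \<open>auto simp: L2_deriv_shift\<close>)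
  moreover have "L2_curve (\<lambda>t. v (c + t))"
    unfolding L2_curve_def
  proof (intro conjI allI impI)
    show "0 < t \<Longrightarrow> in_L2 (v (c + t))" for t using v c by (auto simp: flow_def L2_curve_def)
    fix \<delta> T :: real assume "0 < \<delta>"
    then have "0 < c + \<delta>" using c by simp
    then obtain L where L: "\<forall>t1\<in>{c+\<delta>..c+T}. \<forall>t2\<in>{c+\<delta>..c+T}. L2norm (\<lambda>x. v t1 x - v t2 x) \<le> L * \<bar>t1 - t2\<bar>"
      using v unfolding flow_def L2_curve_def by blast
    show "\<exists>L. \<forall>t1\<in>{\<delta>..T}. \<forall>t2\<in>{\<delta>..T}. L2norm (\<lambda>x. v (c + t1) x - v (c + t2) x) \<le> L * \<bar>t1 - t2\<bar>"
    proof (intro exI[of _ L] ballI)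
      fix t1 t2 assume "t1 \<in> {\<delta>..T}" "t2 \<in> {\<delta>..T}"
      then show "L2norm (\<lambda>x. v (c + t1) x - v (c + t2) x) \<le> L * \<bar>t1 - t2\<bar>"
        using bspec[OF bspec[OF L, of "c + t1"], of "c + t2"] by simp
    qed
  qed
  ultimately show ?thesis by (simp add: flow_def)
qed

text \<open>The hypothesis speaks only of restarts at times \<open>t0 > 0\<close>. Restarting at the
  times 1 / (n + 1) reaches every positive time, and countably many exceptional null sets remain
  null.\<close>

lemma is_solution_pos_imp_flow:
  assumes U: "is_solution_pos s p U" shows "flow s p U"
proof -
  have fl: "flow s p (\<lambda>t. U (t0 + t))" if "0 < t0" for t0
    using U that is_solution_imp_flow[of s p "U t0" "\<lambda>t. U (t0 + t)"] unfolding is_solution_pos_def by blast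
  have c: "L2_curve U" unfolding L2_curve_def
  proof (intro conjI allI impI)
    show "0 < t \<Longrightarrow> in_L2 (U t)" for t using U by (auto simp: is_solution_pos_def)
    \<comment> \<open>Restarting at \<delta> / 2 keeps the whole interval at distance \<delta> / 2
      from the new origin, where the Lipschitz bound is available.\<close>
    fix \<delta> T :: real assume d: "0 < \<delta>"
    then obtain L where L: "\<forall>t1\<in>{\<delta>/2..T}. \<forall>t2\<in>{\<delta>/2..T}. L2norm (\<lambda>x. U (\<delta>/2 + t1) x - U (\<delta>/2 + t2) x) \<le> L * \<bar>t1 - t2\<bar>"
      using fl[of "\<delta>/2"] unfolding flow_def L2_curve_def by (meson half_gt_zero)
    show "\<exists>L. \<forall>t1\<in>{\<delta>..T}. \<forall>t2\<in>{\<delta>..T}. L2norm (\<lambda>x. U t1 x - U t2 x) \<le> L * \<bar>t1 - t2\<bar>"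
    proof (intro exI[of _ L] ballI)
      fix t1 t2 assume t: "t1 \<in> {\<delta>..T}" "t2 \<in> {\<delta>..T}"
      have "t1 - \<delta>/2 \<in> {\<delta>/2..T}" "t2 - \<delta>/2 \<in> {\<delta>/2..T}" using t d by auto
      from bspec[OF bspec[OF L this(1)] this(2)]
      show "L2norm (\<lambda>x. U t1 x - U t2 x) \<le> L * \<bar>t1 - t2\<bar>" by simp
    qed
  qed
  have "AE t in lborel. \<forall>n::nat. 0 < - (1 / real (n + 1)) + 1 * t \<longrightarrow> (\<exists>w. L2_deriv U t (\<lambda>x. - w x) \<and> subdiffJ s p (U t) w)"
    unfolding AE_all_countable
  proof
    fix n :: nat
    let ?e = "1 / real (n + 1)"
    have "AE t in lborel. 0 < t \<longrightarrow> (\<exists>w. L2_deriv U (?e + t) (\<lambda>x. - w x) \<and> subdiffJ s p (U (?e + t)) w)"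
      using fl[of ?e] by (simp add: flow_def L2_deriv_shift)
    from AE_lborel_affine[OF _ this, of 1 "- ?e"]
    show "AE t in lborel. 0 < - ?e + 1 * t \<longrightarrow> (\<exists>w. L2_deriv U t (\<lambda>x. - w x) \<and> subdiffJ s p (U t) w)" by simp
  qed
  then have "AE t in lborel. 0 < t \<longrightarrow> (\<exists>w. L2_deriv U t (\<lambda>x. - w x) \<and> subdiffJ s p (U t) w)"
  proof eventually_elim
    case (elim t)
    show ?case
    proof
      assume "0 < t"
      then obtain n where "inverse (real (Suc n)) < t" using reals_Archimedean by blast
      then have "0 < - (1 / real (n + 1)) + 1 * t" by (simp add: inverse_eq_divide)
      then show "\<exists>w. L2_deriv U t (\<lambda>x. - w x) \<and> subdiffJ s p (U t) w" using elim by blast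
    qed
  qed
  then show ?thesis using c by (simp add: flow_def)
qed

lemma Jfun_cmult:
  fixes v :: "'a::euclidean_space \<Rightarrow> real"
  assumes [measurable]: "v \<in> borel_measurable lborel" and c: "c > 0" and p: "p > 0"
    and fe: "finite_energy (real DIM('a) + s * p) p v"
  shows "enn2real (Jfun s p (\<lambda>x. c * v x)) = c powr p * enn2real (Jfun s p v)"
proof -
  let ?k = "\<lambda>z. kern (real DIM('a) + s * p) (fst z - snd z)"
  have "(\<lambda>z. \<bar>c * v (fst z) - c * v (snd z)\<bar> powr p * ?k z) = (\<lambda>z. c powr p * (\<bar>v (fst z) - v (snd z)\<bar> powr p * ?k z))"
    using c by (auto simp: fun_eq_iff right_diff_distrib[symmetric] abs_mult powr_mult)
  then show ?thesis
    using Jfun_eq_energy(2)[OF _ p finite_energy_cmult[OF fe, of c]] Jfun_eq_energy(2)[OF _ p fe] by simp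
qed

text \<open>The energy is homogeneous of degree p, hence its subgradient of degree p - 1;
  competitors correspond through division by \<open>c\<close>.\<close>

lemma subdiffJ_scale:
  fixes v w :: "'a::euclidean_space \<Rightarrow> real"
  assumes sub: "subdiffJ s p v w" and c: "c > 0" and p: "p > 2"
  shows "subdiffJ s p (\<lambda>x. c * v x) (\<lambda>x. c powr (p - 1) * w x)"
proof -
  let ?a = "real DIM('a) + s * p"
  have p0: "0 < p" using p by simp
  have L: "in_L2 v" "in_L2 w" using sub by (auto simp: subdiffJ_def)
  have fe: "finite_energy ?a p v" by (rule subdiffJ_finite_energy[OF sub p])
  have m[measurable]: "v \<in> borel_measurable lborel" using L by (simp add: in_L2_def)
  have "enn2real (Jfun s p \<phi>) \<ge> enn2real (Jfun s p (\<lambda>x. c * v x)) + (\<integral>x. (c powr (p - 1) * w x) * (\<phi> x - c * v x) \<partial>lborel)"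
    if \<phi>: "in_L2 \<phi>" "Jfun s p \<phi> < \<infinity>" for \<phi>
  proof -
    define \<eta> where "\<eta> x = 1 / c * \<phi> x" for x
    have e: "\<phi> = (\<lambda>x. c * \<eta> x)" using c by (auto simp: \<eta>_def fun_eq_iff)
    have \<eta>L: "in_L2 \<eta>" unfolding \<eta>_def by (rule in_L2_cmult[OF \<phi>(1)])
    have fphi: "finite_energy ?a p \<phi>" using \<phi> Jfun_eq_energy(1)[of \<phi> p s] p0 by (auto simp: in_L2_def)
    have fchi: "finite_energy ?a p \<eta>" unfolding \<eta>_def by (rule finite_energy_cmult[OF fphi])
    have "enn2real (Jfun s p \<eta>) \<ge> enn2real (Jfun s p v) + (\<integral>x. w x * (\<eta> x - v x) \<partial>lborel)"
      using sub \<eta>L fchi Jfun_eq_energy(1)[of \<eta> p s] p0 by (auto simp: subdiffJ_def in_L2_def)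
    then have "c powr p * enn2real (Jfun s p \<eta>) \<ge> c powr p * (enn2real (Jfun s p v) + (\<integral>x. w x * (\<eta> x - v x) \<partial>lborel))"
      using c by (intro mult_left_mono) auto
    moreover have "enn2real (Jfun s p \<phi>) = c powr p * enn2real (Jfun s p \<eta>)"
      unfolding e using \<eta>L by (intro Jfun_cmult c p0 fchi) (simp add: in_L2_def)
    moreover have "enn2real (Jfun s p (\<lambda>x. c * v x)) = c powr p * enn2real (Jfun s p v)"
      by (intro Jfun_cmult c p0 fe m)
    moreover have "(\<integral>x. (c powr (p - 1) * w x) * (\<phi> x - c * v x) \<partial>lborel) = c powr p * (\<integral>x. w x * (\<eta> x - v x) \<partial>lborel)"
    proof -
      have "c powr (p - 1) * c = c powr p" using c powr_mult_base[of c "p - 1"] by (simp add: mult.commute)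
      moreover have "(\<lambda>x. (c powr (p - 1) * w x) * (\<phi> x - c * v x)) = (\<lambda>x. (c powr (p - 1) * c) * (w x * (\<eta> x - v x)))"
        unfolding e by (simp only: right_diff_distrib mult_ac)
      ultimately have "(\<lambda>x. (c powr (p - 1) * w x) * (\<phi> x - c * v x)) = (\<lambda>x. c powr p * (w x * (\<eta> x - v x)))"
        by simp
      then show ?thesis by simp
    qed
    ultimately show ?thesis by (simp add: distrib_left)
  qed
  moreover have "Jfun s p (\<lambda>x. c * v x) < \<infinity>"
    using Jfun_eq_energy(1)[of "\<lambda>x. c * v x" p s] finite_energy_cmult[OF fe, of c] p0 by simp
  ultimately show ?thesis unfolding subdiffJ_def using in_L2_cmult[OF L(1)] in_L2_cmult[OF L(2)] by blast
qed

text \<open>Multiplying the amplitude by \<open>M\<close> multiplies the operator by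
  \<open>M powr (p - 1)\<close>. The time derivative gains \<open>M\<close> from the amplitude and
  \<open>M powr (p - 2)\<close> from the faster clock, so the equation is preserved without any
  scaling in space.\<close>

lemma flow_scale:
  assumes v: "flow s p v" and M: "M > 0" and p: "p > 2"
  shows "flow s p (\<lambda>t x. M * v (M powr (p - 2) * t) x)"
proof -
  let ?m = "M powr (p - 2)"
  have m: "?m > 0" using M by simp
  have alg: "(M * A - M * B) / h - - (M * m * w) = M * m * ((A - B) / (m * h) - - w)" if "m \<noteq> 0" for A B h m w :: real
    using that by (cases "h = 0") (simp_all add: field_simps)
  have "AE t in lborel. 0 < 0 + ?m * t \<longrightarrow> (\<exists>w. L2_deriv v (0 + ?m * t) (\<lambda>x. - w x) \<and> subdiffJ s p (v (0 + ?m * t)) w)"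
    using v m by (intro AE_lborel_affine) (auto simp: flow_def)
  then have "AE t in lborel. 0 < t \<longrightarrow> (\<exists>w. L2_deriv (\<lambda>t x. M * v (?m * t) x) t (\<lambda>x. - w x) \<and> subdiffJ s p (\<lambda>x. M * v (?m * t) x) w)"
  proof eventually_elim
    case (elim t)
    show ?case
    proof
      assume "0 < t"
      then obtain w where w: "L2_deriv v (?m * t) (\<lambda>x. - w x)" "subdiffJ s p (v (?m * t)) w"
        using elim m by auto
      have lim: "((\<lambda>h. L2norm (\<lambda>x. (v (?m * t + h) x - v (?m * t) x) / h - - w x)) \<longlongrightarrow> 0) (at 0)"
        using w by (simp add: L2_deriv_def)
      have "((\<lambda>h. ?m * h) \<longlongrightarrow> ?m * 0) (at 0)" by (intro tendsto_intros)
      then have "filterlim (\<lambda>h. ?m * h) (at 0) (at 0)"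
        using m by (auto simp: filterlim_at eventually_at_filter)
      from filterlim_compose[OF lim this]
      have l2: "((\<lambda>h. L2norm (\<lambda>x. (v (?m * t + ?m * h) x - v (?m * t) x) / (?m * h) - - w x)) \<longlongrightarrow> 0) (at 0)" .
      have "L2norm (\<lambda>x. (M * v (?m * (t + h)) x - M * v (?m * t) x) / h - - (M powr (p - 1) * w x))
         = M powr (p - 1) * L2norm (\<lambda>x. (v (?m * t + ?m * h) x - v (?m * t) x) / (?m * h) - - w x)" for h
      proof -
        have M1: "M powr (p - 1) = M * ?m" using M powr_mult_base[of M "p - 2"] by simp
        have "(\<lambda>x. (M * v (?m * (t + h)) x - M * v (?m * t) x) / h - - (M powr (p - 1) * w x))
          = (\<lambda>x. M powr (p - 1) * ((v (?m * t + ?m * h) x - v (?m * t) x) / (?m * h) - - w x))"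
          unfolding M1 distrib_left using m by (intro ext alg) simp
        then show ?thesis using M by (simp add: L2norm_cmult)
      qed
      then have "((\<lambda>h. L2norm (\<lambda>x. (M * v (?m * (t + h)) x - M * v (?m * t) x) / h - - (M powr (p - 1) * w x))) \<longlongrightarrow> M powr (p - 1) * 0) (at 0)"
        using tendsto_mult_left[OF l2, of "M powr (p - 1)"] by simp
      moreover have "in_L2 (\<lambda>x. M powr (p - 1) * w x)" using w by (intro in_L2_cmult) (auto simp: subdiffJ_def)
      ultimately have "L2_deriv (\<lambda>t x. M * v (?m * t) x) t (\<lambda>x. - (M powr (p - 1) * w x))"
        by (simp add: L2_deriv_def in_L2_uminus)
      then show "\<exists>w. L2_deriv (\<lambda>t x. M * v (?m * t) x) t (\<lambda>x. - w x) \<and> subdiffJ s p (\<lambda>x. M * v (?m * t) x) w"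
        using subdiffJ_scale[OF w(2) M p] by (intro exI[of _ "\<lambda>x. M powr (p - 1) * w x"] conjI)
    qed
  qed
  moreover have "L2_curve (\<lambda>t x. M * v (?m * t) x)"
    unfolding L2_curve_def
  proof (intro conjI allI impI)
    show "0 < t \<Longrightarrow> in_L2 (\<lambda>x. M * v (?m * t) x)" for t
      using v m by (intro in_L2_cmult) (auto simp: flow_def L2_curve_def)
    fix \<delta> T :: real assume "0 < \<delta>"
    then have "0 < ?m * \<delta>" using m by simp
    then obtain L where L: "\<forall>t1\<in>{?m*\<delta>..?m*T}. \<forall>t2\<in>{?m*\<delta>..?m*T}. L2norm (\<lambda>x. v t1 x - v t2 x) \<le> L * \<bar>t1 - t2\<bar>"
      using v unfolding flow_def L2_curve_def by blast
    show "\<exists>L. \<forall>t1\<in>{\<delta>..T}. \<forall>t2\<in>{\<delta>..T}. L2norm (\<lambda>x. M * v (?m * t1) x - M * v (?m * t2) x) \<le> L * \<bar>t1 - t2\<bar>"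
    proof (intro exI[of _ "M * (L * ?m)"] ballI)
      fix t1 t2 assume t: "t1 \<in> {\<delta>..T}" "t2 \<in> {\<delta>..T}"
      have "L2norm (\<lambda>x. v (?m * t1) x - v (?m * t2) x) \<le> L * \<bar>?m * t1 - ?m * t2\<bar>"
        using bspec[OF bspec[OF L, of "?m * t1"], of "?m * t2"] t m by simp
      also have "\<bar>?m * t1 - ?m * t2\<bar> = ?m * \<bar>t1 - t2\<bar>"
        using m by (simp add: right_diff_distrib[symmetric] abs_mult)
      finally have "M * L2norm (\<lambda>x. v (?m * t1) x - v (?m * t2) x) \<le> M * (L * (?m * \<bar>t1 - t2\<bar>))"
        using M by simp
      moreover have "L2norm (\<lambda>x. M * v (?m * t1) x - M * v (?m * t2) x) = M * L2norm (\<lambda>x. v (?m * t1) x - v (?m * t2) x)"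
        using L2norm_cmult[of M "\<lambda>x. v (?m * t1) x - v (?m * t2) x"] M by (simp add: right_diff_distrib)
      ultimately show "L2norm (\<lambda>x. M * v (?m * t1) x - M * v (?m * t2) x) \<le> M * (L * ?m) * \<bar>t1 - t2\<bar>"
        by (simp add: mult.assoc)
    qed
  qed
  ultimately show ?thesis by (simp add: flow_def)
qed

text \<open>Both factors have the sign of \<open>(u1 - v1) - (u2 - v2)\<close>, since this number is
  also \<open>(u1 - u2) - (v1 - v2)\<close>. This is the pointwise form of T-monotonicity, the
  source of the comparison principle.\<close>

lemma Phi_T_monotone:
  assumes p: "p > 2"
  shows "0 \<le> (Phi p (u1 - u2) - Phi p (v1 - v2)) * (max 0 (u1 - v1) - max 0 (u2 - v2))"
proof (cases "u1 - v1 \<le> u2 - v2")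
  case True
  then have "Phi p (u1 - u2) \<le> Phi p (v1 - v2)" by (intro Phi_mono[OF p]) simp
  moreover have "max 0 (u1 - v1) \<le> max 0 (u2 - v2)" using True by auto
  ultimately show ?thesis by (intro mult_nonpos_nonpos) auto
next
  case False
  then have "Phi p (u1 - u2) \<ge> Phi p (v1 - v2)" by (intro Phi_mono[OF p]) simp
  moreover have "max 0 (u1 - v1) \<ge> max 0 (u2 - v2)" using False by auto
  ultimately show ?thesis by (intro mult_nonneg_nonneg) auto
qed

lemma eform_diff:
  assumes "finite_energy a p u" "finite_energy a p v" "finite_energy a p \<psi>" "p > 2"
  shows "eform a p u \<psi> - eform a p v \<psi> = (\<integral>z. (Phi p (u (fst z) - u (snd z)) - Phi p (v (fst z) - v (snd z))) *
     (\<psi> (fst z) - \<psi> (snd z)) * kern a (fst z - snd z) \<partial>lborel2)"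
  unfolding eform_def Bochner_Integration.integral_diff[OF eform_integrable[OF assms(1,3,4)]
    eform_integrable[OF assms(2,3,4)], symmetric]
  by (simp only: left_diff_distrib)

lemma finite_energy_pos_part_diff:
  assumes "finite_energy a p u" "finite_energy a p v" "p > 2"
  shows "finite_energy a p (\<lambda>x. max 0 (u x - v x))"
  by (rule finite_energy_dominated[OF assms(1,2)]) (use assms in \<open>auto simp: finite_energy_def\<close>)

lemma flow_comparison:
  fixes u v :: "real \<Rightarrow> 'a::euclidean_space \<Rightarrow> real"
  assumes u: "flow s p u" and v: "flow s p v" and p: "p > 2" and b: "0 < b"
    and lim: "((\<lambda>t. pos_part_sq UNIV (\<lambda>x. u t x - v t x)) \<longlongrightarrow> 0) (at_right 0)"
  shows "AE x in lborel. u b x \<le> v b x"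
proof -
  let ?a = "real DIM('a) + s * p"
  have cu: "L2_curve u" and cv: "L2_curve v" using u v by (auto simp: flow_def)
  have "AE x in lborel. x \<in> UNIV \<longrightarrow> u b x \<le> v b x"
  proof (rule curve_comparison[OF cu cv _ b lim])
    have "AE t in lborel. 0 < t \<longrightarrow> (\<exists>w. L2_deriv u t (\<lambda>x. - w x) \<and> subdiffJ s p (u t) w)"
      "AE t in lborel. 0 < t \<longrightarrow> (\<exists>w. L2_deriv v t (\<lambda>x. - w x) \<and> subdiffJ s p (v t) w)"
      using u v by (auto simp: flow_def)
    then show "AE t in lborel. t \<in> {0<..<b} \<longrightarrow> (\<exists>d e. L2_deriv u t d \<and> L2_deriv v t e \<and>
        (\<integral>x. indicator UNIV x * max 0 (u t x - v t x) * (d x - e x) \<partial>lborel) \<le> 0)"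
    proof eventually_elim
      case (elim t)
      show ?case
      proof
        assume t: "t \<in> {0<..<b}"
        obtain w where w: "L2_deriv u t (\<lambda>x. - w x)" "subdiffJ s p (u t) w" using elim t by auto
        obtain z where z: "L2_deriv v t (\<lambda>x. - z x)" "subdiffJ s p (v t) z" using elim t by auto
        let ?\<psi> = "\<lambda>x. max 0 (u t x - v t x)"
        have fu: "finite_energy ?a p (u t)" "finite_energy ?a p (v t)"
          using subdiffJ_finite_energy[OF w(2) p] subdiffJ_finite_energy[OF z(2) p] by auto
        have f\<psi>: "finite_energy ?a p ?\<psi>" by (rule finite_energy_pos_part_diff[OF fu p])
        have L\<psi>: "in_L2 ?\<psi>" using w z by (intro in_L2_pos_part in_L2_diff) (auto simp: subdiffJ_def)
        have ew: "(\<integral>x. w x * ?\<psi> x \<partial>lborel) = eform ?a p (u t) ?\<psi>" "(\<integral>x. z x * ?\<psi> x \<partial>lborel) = eform ?a p (v t) ?\<psi>"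
          using subdiffJ_eq_eform[OF w(2) p L\<psi> f\<psi>] subdiffJ_eq_eform[OF z(2) p L\<psi> f\<psi>] by auto
        have "0 \<le> eform ?a p (u t) ?\<psi> - eform ?a p (v t) ?\<psi>"
          unfolding eform_diff[OF fu f\<psi> p]
          by (intro Bochner_Integration.integral_nonneg mult_nonneg_nonneg Phi_T_monotone[OF p]) auto
        moreover have "(\<integral>x. indicator UNIV x * ?\<psi> x * (- w x - - z x) \<partial>lborel) = (\<integral>x. z x * ?\<psi> x \<partial>lborel) - (\<integral>x. w x * ?\<psi> x \<partial>lborel)"
          using in_L2_mult_integrable[of w ?\<psi>] in_L2_mult_integrable[of z ?\<psi>] w z L\<psi>
          by (subst Bochner_Integration.integral_diff[symmetric])
            (auto simp: subdiffJ_def algebra_simps intro!: Bochner_Integration.integral_cong)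
        ultimately have "(\<integral>x. indicator UNIV x * ?\<psi> x * (- w x - - z x) \<partial>lborel) \<le> 0" using ew by linarith
        then show "\<exists>d e. L2_deriv u t d \<and> L2_deriv v t e \<and>
          (\<integral>x. indicator UNIV x * ?\<psi> x * (d x - e x) \<partial>lborel) \<le> 0" using w(1) z(1) by blast
      qed
    qed
  qed simp
  then show ?thesis by simp
qed

section \<open>Lower barrier\<close>

text \<open>A source anywhere in a fixed ball is felt at \<open>x\<close> with at least the strength
  \<open>bar a x\<close>, because \<open>norm (x - y)\<close> is at most
  \<open>norm x + D\<close>.\<close>

lemma kern_ge_bar:
  fixes x y :: "'a::euclidean_space"
  assumes a: "0 \<le> a" and xy: "x \<noteq> y" and y: "norm y \<le> D"
  shows "(2 * (1 + D\<^sup>2)) powr (- a / 2) * bar a x \<le> kern a (x - y)"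
proof -
  have "norm (x - y) \<le> norm x + D" using norm_triangle_ineq4[of x y] y by linarith
  then have "(norm (x - y))\<^sup>2 \<le> (norm x + D)\<^sup>2" by (intro power_mono) auto
  also have "\<dots> \<le> 2 * (1 + D\<^sup>2) * (1 + (norm x)\<^sup>2)"
  proof -
    have "2 * norm x * D \<le> (norm x)\<^sup>2 + D\<^sup>2" by (rule sum_squares_bound)
    moreover have "0 \<le> D\<^sup>2 * (norm x)\<^sup>2" "0 \<le> D\<^sup>2" "0 \<le> (norm x)\<^sup>2" by simp_all
    moreover have "2 * (1 + D\<^sup>2) * (1 + (norm x)\<^sup>2) = 2 + 2 * (norm x)\<^sup>2 + 2 * D\<^sup>2 + 2 * (D\<^sup>2 * (norm x)\<^sup>2)"
      by (simp add: algebra_simps)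
    ultimately show ?thesis unfolding power2_sum by linarith
  qed
  finally have "(2 * (1 + D\<^sup>2) * (1 + (norm x)\<^sup>2)) powr (- a / 2) \<le> ((norm (x - y))\<^sup>2) powr (- a / 2)"
    using a xy by (intro powr_mono2') auto
  then show ?thesis using xy by (simp add: kern_eq_sq_powr bar_def powr_mult)
qed

text \<open>Here \<open>norm (x - y)\<close> is at least half of \<open>norm x\<close>, and the 5
  comes from \<open>(1 + r\<^sup>2) / 5 \<le> r\<^sup>2 / 4\<close> for r at least 2. The gap
  between the two regions keeps the kernel away from its singularity.\<close>

lemma kern_le_bar_exterior:
  fixes x y :: "'a::euclidean_space"
  assumes a: "0 \<le> a" and x: "2 \<le> norm x" and y: "norm y \<le> 1"
  shows "kern a (x - y) \<le> 5 powr (a / 2) * bar a x"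
proof -
  have n: "norm x / 2 \<le> norm (x - y)" using norm_triangle_ineq2[of x y] x y by linarith
  then have "(norm x / 2)\<^sup>2 \<le> (norm (x - y))\<^sup>2" by (intro power_mono) auto
  moreover have "2\<^sup>2 \<le> (norm x)\<^sup>2" using x by (intro power_mono) auto
  ultimately have m: "(1 + (norm x)\<^sup>2) / 5 \<le> (norm (x - y))\<^sup>2" by (simp add: power_divide)
  have nz: "x - y \<noteq> 0" using n x by auto
  have "((norm (x - y))\<^sup>2) powr (- a / 2) \<le> ((1 + (norm x)\<^sup>2) / 5) powr (- a / 2)"
    using a m by (intro powr_mono2') auto
  also have "\<dots> = 5 powr (a / 2) * bar a x" by (simp add: bar_def powr_divide powr_minus_divide)
  finally show ?thesis using kern_eq_sq_powr[OF nz] by simp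
qed

lemma integrable_prod_mult:
  fixes f g :: "'a::euclidean_space \<Rightarrow> real"
  assumes f: "integrable lborel f" and g: "integrable lborel g"
  shows "integrable lborel2 (\<lambda>z. f (fst z) * g (snd z))"
    and "(\<integral>z. f (fst z) * g (snd z) \<partial>lborel2) = (\<integral>x. f x \<partial>lborel) * (\<integral>y. g y \<partial>lborel)"
proof -
  have [measurable]: "f \<in> borel_measurable borel" "g \<in> borel_measurable borel"
    using f g by (auto dest: borel_measurable_integrable)
  show i: "integrable lborel2 (\<lambda>z. f (fst z) * g (snd z))"
  proof (rule integrableI_bounded)
    have "(\<integral>\<^sup>+z. ennreal (norm (f (fst z) * g (snd z))) \<partial>lborel2)
       = (\<integral>\<^sup>+x. \<integral>\<^sup>+y. ennreal \<bar>f x\<bar> * ennreal \<bar>g y\<bar> \<partial>lborel \<partial>lborel)"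
      by (subst lborel.nn_integral_fst[symmetric]) (auto simp: abs_mult ennreal_mult)
    also have "\<dots> = (\<integral>\<^sup>+x. ennreal \<bar>f x\<bar> \<partial>lborel) * (\<integral>\<^sup>+h. ennreal \<bar>g h\<bar> \<partial>lborel)"
      by (simp add: nn_integral_cmult nn_integral_multc)
    also have "\<dots> < \<infinity>"
      using f g by (simp add: integrable_iff_bounded ennreal_mult_less_top)
    finally show "(\<integral>\<^sup>+z. ennreal (norm (f (fst z) * g (snd z))) \<partial>lborel2) < \<infinity>" .
  qed measurable
  show "(\<integral>z. f (fst z) * g (snd z) \<partial>lborel2) = (\<integral>x. f x \<partial>lborel) * (\<integral>y. g y \<partial>lborel)"
    using lborel_pair.integral_fst'[OF i] by simp
qed

lemma integral_swap:
  fixes f :: "'a::euclidean_space \<times> 'a \<Rightarrow> real"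
  assumes "integrable lborel2 f"
  shows "integrable lborel2 (\<lambda>z. f (snd z, fst z))"
    and "(\<integral>z. f (snd z, fst z) \<partial>lborel2) = (\<integral>z. f z \<partial>lborel2)"
proof -
  have "(\<lambda>z. f (snd z, fst z)) = (\<lambda>(x, y). f (y, x))" by auto
  then show "integrable lborel2 (\<lambda>z. f (snd z, fst z))"
    "(\<integral>z. f (snd z, fst z) \<partial>lborel2) = (\<integral>z. f z \<partial>lborel2)"
    using lborel_pair.integrable_product_swap[OF assms]
      lborel_pair.integral_product_swap[OF borel_measurable_integrable[OF assms]] by simp_all
qed

lemma eform_scale:
  "0 < c \<Longrightarrow> eform a p (\<lambda>x. c * v x) \<psi> = c powr (p - 1) * eform a p v \<psi>"
  unfolding eform_def by (simp add: right_diff_distrib[symmetric] Phi_scale mult.assoc del: right_diff_distrib)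

lemma integrable_lborel_scale:
  fixes f :: "'a::euclidean_space \<Rightarrow> real"
  assumes f: "integrable lborel f" and c: "c > 0"
  shows "integrable lborel (\<lambda>x. f (c *\<^sub>R x))"
    and "(\<integral>x. f (c *\<^sub>R x) \<partial>lborel) = (\<integral>x. f x \<partial>lborel) / c ^ DIM('a)"
proof -
  have [measurable]: "f \<in> borel_measurable borel" using f by (auto dest: borel_measurable_integrable)
  have eq: "lborel = density (distr lborel borel (\<lambda>x::'a. 0 + c *\<^sub>R x)) (\<lambda>_. ennreal (c ^ DIM('a)))"
    using lborel_affine[of c "0::'a"] c by simp
  have d: "integrable (density (distr lborel borel (\<lambda>x::'a. 0 + c *\<^sub>R x)) (\<lambda>_. ennreal (c ^ DIM('a)))) f"
    using f by (subst eq[symmetric])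
  have "integrable (distr lborel borel (\<lambda>x::'a. 0 + c *\<^sub>R x)) (\<lambda>x. c ^ DIM('a) *\<^sub>R f x)"
    using d c by (subst (asm) integrable_density) auto
  then have "integrable lborel (\<lambda>x. c ^ DIM('a) * f (c *\<^sub>R x))"
    by (subst (asm) integrable_distr_eq) auto
  then show i: "integrable lborel (\<lambda>x. f (c *\<^sub>R x))" using c by simp
  have "(\<integral>x. f x \<partial>lborel) = (\<integral>x. f x \<partial>(density (distr lborel borel (\<lambda>x::'a. 0 + c *\<^sub>R x)) (\<lambda>_. ennreal (c ^ DIM('a)))))"
    by (subst eq) simp
  also have "\<dots> = (\<integral>x. c ^ DIM('a) *\<^sub>R f x \<partial>(distr lborel borel (\<lambda>x::'a. 0 + c *\<^sub>R x)))"
    using c by (subst integral_density) auto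
  also have "\<dots> = (\<integral>x. c ^ DIM('a) * f (c *\<^sub>R x) \<partial>lborel)"
    by (subst integral_distr) auto
  also have "\<dots> = c ^ DIM('a) * (\<integral>x. f (c *\<^sub>R x) \<partial>lborel)" by simp
  finally show "(\<integral>x. f (c *\<^sub>R x) \<partial>lborel) = (\<integral>x. f x \<partial>lborel) / c ^ DIM('a)" using c by simp
qed

lemma pos_part_sq_le_AE:
  assumes f: "in_L2 f" and g: "in_L2 g" and S: "S \<in> sets borel" and le: "AE x in lborel. x \<in> S \<longrightarrow> f x \<le> \<bar>g x\<bar>"
  shows "pos_part_sq S f \<le> (L2norm g)\<^sup>2"
  unfolding pos_part_sq_eq_L2norm
proof (intro power_mono L2norm_mono[OF g in_L2_indicator_pos_part[OF f S]])
  show "AE x in lborel. \<bar>indicator S x * max 0 (f x)\<bar> \<le> \<bar>g x\<bar>"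
    using le by eventually_elim (auto simp: indicator_def)
qed auto

lemma pos_part_sq_nonneg: "0 \<le> pos_part_sq S f"
  by (simp add: pos_part_sq_eq_L2norm)

text \<open>The set where \<open>f\<close> is positive is a countable union of such pieces, with
  level 1 / (n + 1) and radius n + 1; if all of them were null, \<open>f\<close> would vanish almost
  everywhere.\<close>

lemma positive_set_bounded_part:
  fixes f :: "'a::euclidean_space \<Rightarrow> real"
  assumes [measurable]: "f \<in> borel_measurable borel" and nn: "AE x in lborel. 0 \<le> f x" and nz: "\<not> (AE x in lborel. f x = 0)"
  shows "\<exists>\<delta>>0. \<exists>D>0. 0 < measure lborel ({x. \<delta> < f x} \<inter> ball 0 D)"
proof (rule ccontr)
  assume *: "\<not> ?thesis"
  have null: "{x. 1 / real (n + 1) < f x} \<inter> ball 0 (real (n + 1)) \<in> null_sets lborel" for n :: nat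
  proof -
    let ?A = "{x. 1 / real (n + 1) < f x} \<inter> ball 0 (real (n + 1))"
    have "0 < 1 / real (n + 1)" "0 < real (n + 1)" by auto
    then have "\<not> 0 < measure lborel ?A" using * by blast
    then have "measure lborel ?A = 0" using measure_nonneg[of lborel ?A] by linarith
    moreover have "emeasure lborel ?A \<noteq> \<infinity>"
    proof -
      have "emeasure lborel ?A \<le> emeasure lborel (ball (0::'a) (real (n + 1)))" by (rule emeasure_mono) auto
      then show ?thesis using emeasure_lborel_ball_finite[of "0::'a" "real (n + 1)"] by (auto simp: top_unique)
    qed
    ultimately have "emeasure lborel ?A = 0" using emeasure_eq_ennreal_measure[of lborel ?A] by simp
    moreover have "?A \<in> sets lborel" by measurable
    ultimately show ?thesis by auto
  qed
  have "(\<Union>n. {x. 1 / real (n + 1) < f x} \<inter> ball 0 (real (n + 1))) \<in> null_sets lborel"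
    by (rule null_sets_UN) (rule null)
  then have "AE x in lborel. x \<notin> (\<Union>n. {x. 1 / real (n + 1) < f x} \<inter> ball 0 (real (n + 1)))" by (rule AE_not_in)
  with nn have "AE x in lborel. f x = 0"
  proof eventually_elim
    case (elim x)
    show ?case
    proof (rule ccontr)
      assume "f x \<noteq> 0"
      then have pos: "0 < f x" using elim by auto
      obtain n1 where n1: "inverse (real (Suc n1)) < f x" using reals_Archimedean[OF pos] by blast
      obtain n2 :: nat where n2: "norm x < real n2" using reals_Archimedean2 by blast
      define n where "n = max n1 n2"
      have "1 / real (n + 1) \<le> inverse (real (Suc n1))" by (simp add: n_def inverse_eq_divide field_simps)
      then have "1 / real (n + 1) < f x" "norm x < real (n + 1)" using n1 n2 by (auto simp: n_def)
      then show False using elim(2) by auto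
    qed
  qed
  with nz show False by simp
qed

text \<open>The barrier \<open>\<eta> * t * bar\<close> starts at 0, so it lies below the
  nonnegative datum, and it stays below the level of \<open>u\<close> on a set of fixed measure.
  Where it exceeds \<open>u\<close>, that set pulls \<open>u\<close> up at a rate proportional to
  \<open>bar\<close>, which beats the slope \<eta> of the barrier together with the operator acting
  on it.\<close>

lemma flow_lower_barrier:
  fixes u :: "real \<Rightarrow> 'a::euclidean_space \<Rightarrow> real"
  assumes s: "0 < s" "s < 1" and p: "p > 2" and u: "flow s p u" and u0: "in_L2 u0"
    and lim: "((\<lambda>t. L2norm (\<lambda>x. u t x - u0 x)) \<longlongrightarrow> 0) (at_right 0)"
    and nn: "AE x in lborel. 0 \<le> u0 x" and nz: "\<not> (AE x in lborel. u0 x = 0)" and \<tau>: "0 < \<tau>"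
  shows "\<exists>t1 c. 0 < t1 \<and> t1 \<le> \<tau> \<and> 0 < c \<and> (AE x in lborel. c * bar (real DIM('a) + s * p) x \<le> u t1 x)"
proof -
  define a where "a = real DIM('a) + s * p"
  have sp: "0 < s * p" "s * p < p" using s p by auto
  have a: "a > real DIM('a)" "a - p < real DIM('a)" "0 \<le> a" using sp by (auto simp: a_def)
  have [measurable]: "u0 \<in> borel_measurable borel" using u0 by (simp add: in_L2_def)
  obtain C where C: "C \<ge> 0" "\<And>\<psi>::'a \<Rightarrow> real. in_L2 \<psi> \<Longrightarrow> finite_energy a p \<psi> \<Longrightarrow> (\<forall>x. 0 \<le> \<psi> x) \<Longrightarrow>
     \<bar>eform a p (bar a) \<psi>\<bar> \<le> C * (\<integral>x. bar a x * \<psi> x \<partial>lborel)"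
    using bar_eform_bound[OF a(1,2) p] by blast
  obtain \<delta> D where \<delta>: "0 < \<delta>" "0 < D" "0 < measure lborel ({x. \<delta> < u0 x} \<inter> ball 0 D)"
    using positive_set_bounded_part[OF _ nn nz] by auto
  define A where "A = {x. \<delta> < u0 x} \<inter> ball 0 D"
  define m where "m = measure lborel A / 2"
  have m0: "m > 0" using \<delta> by (simp add: m_def A_def)
  have [measurable]: "A \<in> sets borel" unfolding A_def by measurable
  have curve: "L2_curve u" using u by (simp add: flow_def)
  \<comment> \<open>By Chebyshev this closeness confines the points where \<open>u t\<close> differs
    from \<open>u0\<close> by at least \<delta> / 2 to measure at most \<open>m\<close>, half of the
    measure of \<open>A\<close>; the other half keeps \<open>u t\<close> above \<delta> / 2.\<close>
  have ev: "\<forall>\<^sub>F t in at_right 0. L2norm (\<lambda>x. u t x - u0 x) < sqrt m * (\<delta> / 2)"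
    using order_tendstoD(2)[OF lim, of "sqrt m * (\<delta> / 2)"] m0 \<delta> by auto
  then obtain b where b: "b > 0" "\<And>t. 0 < t \<Longrightarrow> t < b \<Longrightarrow> L2norm (\<lambda>x. u t x - u0 x) < sqrt m * (\<delta> / 2)"
    by (auto simp: eventually_at_right_field)
  define t1 where "t1 = min (min (b / 2) 1) \<tau>"
  have t1: "0 < t1" "t1 \<le> 1" "t1 \<le> \<tau>" "t1 < b" using b \<tau> by (auto simp: t1_def)
  \<comment> \<open>If \<open>y\<close> has \<open>u t y > \<delta> / 2\<close>, if
    \<open>u t x\<close> lies below \<open>W t x\<close>, and if \<open>W\<close> takes values in
    [0, \<delta> / 8], then \<open>u t x - u t y\<close> is at most -3 \<delta> / 8 while
    \<open>W t x - W t y\<close> is at least -\<delta> / 8. The gap between the values of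
    \<open>Phi\<close> is \<open>c0\<close>.\<close>
  define c0 where "c0 = Phi p (3 * \<delta> / 8) - Phi p (\<delta> / 8)"
  have c0: "c0 > 0" unfolding c0_def using \<delta> p by (auto simp: Phi_nonneg intro!: powr_less_mono2)
  define \<kappa> where "\<kappa> = (2 * (1 + D\<^sup>2)) powr (- a / 2)"
  have \<kappa>: "\<kappa> > 0" using add_pos_nonneg[of 1 "D\<^sup>2"] by (simp add: \<kappa>_def)
  \<comment> \<open>The bound \<delta> / 8 keeps the barrier below half the gap level, the bound 1
    allows \<open>(\<eta> * t) powr (p - 1) \<le> \<eta>\<close>, and the last bound makes the gain
    \<open>c0 * \<kappa> * m\<close> exceed \<eta> for the time derivative plus
    \<open>\<eta> * C\<close> for the operator.\<close>
  define \<eta> where "\<eta> = min (min (\<delta> / 8) 1) (c0 * \<kappa> * m / (1 + C))"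
  have \<eta>: "\<eta> > 0" "\<eta> \<le> \<delta> / 8" "\<eta> \<le> 1" "\<eta> * (1 + C) \<le> c0 * \<kappa> * m"
  proof -
    show "\<eta> > 0" using \<delta> c0 \<kappa> m0 C by (simp add: \<eta>_def)
    have "\<eta> \<le> c0 * \<kappa> * m / (1 + C)" by (simp add: \<eta>_def)
    then show "\<eta> * (1 + C) \<le> c0 * \<kappa> * m" using C by (simp add: pos_le_divide_eq)
    show "\<eta> \<le> \<delta> / 8" unfolding \<eta>_def by (intro min.coboundedI1 min.cobounded1)
    show "\<eta> \<le> 1" unfolding \<eta>_def by (rule min.coboundedI1[OF min.cobounded2])
  qed
  define W where "W = (\<lambda>t x. (\<eta> * t) * bar a (x::'a))"
  have Wc: "L2_curve W" unfolding W_def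
    by (rule L2_curve_barrier[OF bar_in_L2[OF a(1)], where g' = "\<lambda>_. \<eta>"])
      (auto intro!: derivative_eq_intros exI[of _ "\<eta>"] simp: \<eta> less_imp_le)
  have meas: "m \<le> measure lborel ({x. \<delta> / 2 < u t x} \<inter> ball 0 D)" if t: "0 < t" "t < b" for t
  proof -
    have ut: "in_L2 (u t)" using L2_curve_in_L2[OF curve] t by auto
    then have [measurable]: "u t \<in> borel_measurable borel" by (simp add: in_L2_def)
    define B where "B = A \<inter> {x. \<delta> / 2 \<le> \<bar>u t x - u0 x\<bar>}"
    let ?At = "{x. \<delta> / 2 < u t x} \<inter> ball 0 D"
    have [measurable]: "B \<in> sets borel" "?At \<in> sets borel" unfolding B_def by measurable
    have fin: "X \<in> fmeasurable lborel" if "X \<subseteq> ball 0 D" "X \<in> sets borel" for X :: "'a set"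
      by (rule fmeasurableI2[of "ball 0 D"]) (use that in \<open>auto simp: fmeasurable_def emeasure_lborel_ball_finite[simplified]\<close>)
    have fB: "B \<in> fmeasurable lborel" by (rule fin) (auto simp: B_def A_def)
    have fAt: "?At \<in> fmeasurable lborel" by (rule fin) auto
    have "measure lborel A \<le> measure lborel (B \<union> ?At)"
    proof (rule measure_mono_fmeasurable)
      have "\<delta> / 2 \<le> \<bar>u t x - u0 x\<bar>" if "\<not> \<delta> / 2 < u t x" "\<delta> < u0 x" for x using that by linarith
      then show "A \<subseteq> B \<union> ?At" unfolding A_def B_def by blast
    qed (use fB fAt in auto)
    also have "\<dots> \<le> measure lborel B + measure lborel ?At"
      by (rule measure_Un_le) auto
    finally have 1: "2 * m \<le> measure lborel B + measure lborel ?At" by (simp add: m_def)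
    have L: "in_L2 (\<lambda>x. u t x - u0 x)" by (rule in_L2_diff[OF ut u0])
    have "(\<delta> / 2)\<^sup>2 * measure lborel B = (\<integral>x. (\<delta> / 2)\<^sup>2 * indicator B x \<partial>lborel)" by simp
    also have "\<dots> \<le> (\<integral>x. (u t x - u0 x)\<^sup>2 \<partial>lborel)"
    proof (rule integral_mono)
      show "integrable lborel (\<lambda>x. (\<delta> / 2)\<^sup>2 * indicator B x)" using fB by (auto simp: fmeasurable_def)
      show "integrable lborel (\<lambda>x. (u t x - u0 x)\<^sup>2)" using L by (simp add: in_L2_def)
      fix x
      show "(\<delta> / 2)\<^sup>2 * indicator B x \<le> (u t x - u0 x)\<^sup>2"
      proof (cases "x \<in> B")
        case True
        then have "\<bar>\<delta> / 2\<bar> \<le> \<bar>u t x - u0 x\<bar>" using \<delta> by (simp add: B_def)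
        then show ?thesis using True by (simp add: abs_le_square_iff del: abs_divide)
      qed simp
    qed
    also have "\<dots> = (L2norm (\<lambda>x. u t x - u0 x))\<^sup>2" by (simp add: L2norm_power2)
    also have "\<dots> \<le> (sqrt m * (\<delta> / 2))\<^sup>2" using b(2)[OF t] by (intro power_mono) auto
    also have "\<dots> = (\<delta> / 2)\<^sup>2 * m" unfolding power_mult_distrib using m0 by simp
    finally have "measure lborel B \<le> m" using \<delta> by simp
    with 1 show ?thesis by linarith
  qed
  have "AE x in lborel. x \<in> UNIV \<longrightarrow> W t1 x \<le> u t1 x"
  proof (rule curve_comparison[OF Wc curve _ t1(1)])
    show "((\<lambda>t. pos_part_sq UNIV (\<lambda>x. W t x - u t x)) \<longlongrightarrow> 0) (at_right 0)"
    proof (rule Lim_null_comparison)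
      show "\<forall>\<^sub>F t in at_right 0. norm (pos_part_sq UNIV (\<lambda>x. W t x - u t x)) \<le> (\<eta> * t * L2norm (bar a :: 'a \<Rightarrow> real) + L2norm (\<lambda>x. u t x - u0 x))\<^sup>2"
        using eventually_at_right_less[of 0]
      proof eventually_elim
        case (elim t)
        have ut: "in_L2 (u t)" using L2_curve_in_L2[OF curve] elim by auto
        have Wt: "in_L2 (W t)" using L2_curve_in_L2[OF Wc] elim by auto
        have L: "in_L2 (\<lambda>x. u t x - u0 x)" by (rule in_L2_diff[OF ut u0])
        \<comment> \<open>Nonnegativity of \<open>u0\<close> enters here: adding it only increases
          the right-hand side, which tends to 0 in \<open>L2\<close>.\<close>
        have le: "AE x in lborel. x \<in> UNIV \<longrightarrow> W t x - u t x \<le> \<bar>W t x - (u t x - u0 x)\<bar>"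
          using nn by eventually_elim auto
        have "pos_part_sq UNIV (\<lambda>x. W t x - u t x) \<le> (L2norm (\<lambda>x. W t x - (u t x - u0 x)))\<^sup>2"
          by (rule pos_part_sq_le_AE[OF in_L2_diff[OF Wt ut] in_L2_diff[OF Wt L] _ le]) simp
        also have "\<dots> \<le> (L2norm (W t) + L2norm (\<lambda>x. u t x - u0 x))\<^sup>2"
          by (intro power_mono L2norm_triangle_diff Wt L) simp
        also have "L2norm (W t) = \<eta> * t * L2norm (bar a :: 'a \<Rightarrow> real)"
          unfolding W_def using elim \<eta> by (subst L2norm_cmult) simp
        finally show ?case by (simp add: pos_part_sq_nonneg)
      qed
      have "((\<lambda>t. (\<eta> * t * L2norm (bar a :: 'a \<Rightarrow> real) + L2norm (\<lambda>x. u t x - u0 x))\<^sup>2) \<longlongrightarrow> (\<eta> * 0 * L2norm (bar a :: 'a \<Rightarrow> real) + 0)\<^sup>2) (at_right 0)"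
        by (intro tendsto_intros lim)
      then show "((\<lambda>t. (\<eta> * t * L2norm (bar a :: 'a \<Rightarrow> real) + L2norm (\<lambda>x. u t x - u0 x))\<^sup>2) \<longlongrightarrow> 0) (at_right 0)" by simp
    qed
    have "AE t in lborel. 0 < t \<longrightarrow> (\<exists>w. L2_deriv u t (\<lambda>x. - w x) \<and> subdiffJ s p (u t) w)"
      using u by (simp add: flow_def)
    then show "AE t in lborel. t \<in> {0<..<t1} \<longrightarrow> (\<exists>d e. L2_deriv W t d \<and> L2_deriv u t e \<and>
        (\<integral>x. indicator UNIV x * max 0 (W t x - u t x) * (d x - e x) \<partial>lborel) \<le> 0)"
    proof eventually_elim
      case (elim t)
      show ?case
      proof
        assume t: "t \<in> {0<..<t1}"
        obtain w where w: "L2_deriv u t (\<lambda>x. - w x)" "subdiffJ s p (u t) w" using elim t by auto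
        have dW: "L2_deriv W t (\<lambda>x. \<eta> * bar a x)" unfolding W_def
          by (rule L2_deriv_barrier[OF bar_in_L2[OF a(1)]]) (auto intro!: derivative_eq_intros)
        have ut: "in_L2 (u t)" and wL: "in_L2 w" using w(2) by (auto simp: subdiffJ_def)
        have [measurable]: "u t \<in> borel_measurable borel" using ut by (simp add: in_L2_def)
        have Wt: "in_L2 (W t)" using L2_curve_in_L2[OF Wc] t by auto
        define \<psi> where "\<psi> x = max 0 (W t x - u t x)" for x
        have fu: "finite_energy a p (u t)" unfolding a_def by (rule subdiffJ_finite_energy[OF w(2) p])
        have fW: "finite_energy a p (W t)" unfolding W_def by (rule finite_energy_cmult[OF bar_finite_energy[OF a(1,2) p]])
        have f\<psi>: "finite_energy a p \<psi>" unfolding \<psi>_def by (rule finite_energy_pos_part_diff[OF fW fu p])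
        have L\<psi>: "in_L2 \<psi>" unfolding \<psi>_def by (intro in_L2_pos_part in_L2_diff Wt ut)
        have \<psi>0: "0 \<le> \<psi> x" for x by (simp add: \<psi>_def)
        define I where "I = (\<integral>x. bar a x * \<psi> x \<partial>lborel)"
        have iI: "integrable lborel (\<lambda>x. bar a x * \<psi> x)" by (rule in_L2_mult_integrable[OF bar_in_L2[OF a(1)] L\<psi>])
        have I0: "0 \<le> I" unfolding I_def using \<psi>0 by (intro Bochner_Integration.integral_nonneg) auto
        let ?At = "{x. \<delta> / 2 < u t x} \<inter> ball 0 D"
        have iAt: "integrable lborel (indicator ?At :: 'a \<Rightarrow> real)"
        proof -
          have "emeasure lborel ?At \<le> emeasure lborel (ball (0::'a) D)" by (rule emeasure_mono) auto
          also have "\<dots> < \<infinity>" by (rule emeasure_lborel_ball_finite)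
          finally show ?thesis by (simp add: integrable_indicator_iff)
        qed
        have \<eta>t: "0 < \<eta> * t" "\<eta> * t \<le> \<eta>" using \<eta> t t1 by auto
        have Wb: "0 \<le> W t x" "W t x \<le> \<delta> / 8" for x
        proof -
          show "0 \<le> W t x" using \<eta>t by (simp add: W_def)
          have "W t x \<le> \<eta> * t * 1" unfolding W_def using \<eta>t bar_le_1[OF a(3)] by (intro mult_left_mono) auto
          then show "W t x \<le> \<delta> / 8" using \<eta>t \<eta> by linarith
        qed
        let ?Z = "\<lambda>z. (Phi p (u t (fst z) - u t (snd z)) - Phi p (W t (fst z) - W t (snd z))) * (\<psi> (fst z) - \<psi> (snd z)) * kern a (fst z - snd z)"
        have iZ: "integrable lborel2 ?Z"
          using Bochner_Integration.integrable_diff[OF eform_integrable[OF fu f\<psi> p] eform_integrable[OF fW f\<psi> p]]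
          by (simp only: left_diff_distrib)
        \<comment> \<open>Pairs whose second point is not in the good set are discarded by
          T-monotonicity. On the remaining ones \<psi> vanishes at the second point, so the first
          point alone carries the gain.\<close>
        have pw: "?Z z \<le> - (c0 * \<kappa>) * ((bar a (fst z) * \<psi> (fst z)) * indicator ?At (snd z))" for z
        proof -
          let ?x = "fst z" and ?y = "snd z"
          have T: "?Z z \<le> 0"
          proof -
            have "0 \<le> (Phi p (W t ?x - W t ?y) - Phi p (u t ?x - u t ?y)) * (max 0 (W t ?x - u t ?x) - max 0 (W t ?y - u t ?y))"
              by (rule Phi_T_monotone[OF p])
            then have "(Phi p (u t ?x - u t ?y) - Phi p (W t ?x - W t ?y)) * (\<psi> ?x - \<psi> ?y) \<le> 0"
              by (simp add: \<psi>_def left_diff_distrib)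
            then show ?thesis by (rule mult_nonpos_nonneg) simp
          qed
          show ?thesis
          proof (cases "?y \<in> ?At \<and> 0 < \<psi> ?x")
            case True
            then have y: "\<delta> / 2 < u t ?y" "norm ?y \<le> D" by auto
            have \<psi>y: "\<psi> ?y = 0" using y Wb(2)[of ?y] \<delta> by (simp add: \<psi>_def)
            have x: "u t ?x < W t ?x" using True by (auto simp: \<psi>_def)
            have ne: "?x \<noteq> ?y" using True \<psi>y by auto
            have "Phi p (u t ?x - u t ?y) \<le> Phi p (- (3 * \<delta> / 8))"
              using x y Wb(2)[of ?x] by (intro Phi_mono[OF p]) linarith
            moreover have "Phi p (- (\<delta> / 8)) \<le> Phi p (W t ?x - W t ?y)"
              using Wb(1)[of ?x] Wb(2)[of ?y] by (intro Phi_mono[OF p]) linarith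
            ultimately have P: "Phi p (u t ?x - u t ?y) - Phi p (W t ?x - W t ?y) \<le> - c0"
              unfolding Phi_uminus c0_def by linarith
            have K: "\<kappa> * bar a ?x \<le> kern a (?x - ?y)" unfolding \<kappa>_def by (rule kern_ge_bar[OF a(3) ne y(2)])
            have "?Z z = (Phi p (u t ?x - u t ?y) - Phi p (W t ?x - W t ?y)) * (\<psi> ?x * kern a (?x - ?y))"
              by (simp add: \<psi>y)
            also have "\<dots> \<le> (- c0) * (\<psi> ?x * kern a (?x - ?y))" using P \<psi>0 by (intro mult_right_mono) auto
            also have "\<dots> \<le> (- c0) * (\<psi> ?x * (\<kappa> * bar a ?x))"
              using K \<psi>0 c0 by (intro mult_left_mono_neg mult_left_mono) auto
            finally show ?thesis using True by (simp add: mult_ac)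
          next
            case False
            then have "bar a ?x * \<psi> ?x * indicator ?At ?y = 0" using \<psi>0[of ?x] by (auto simp: indicator_def)
            then show ?thesis using T by (simp only: mult_zero_right)
          qed
        qed
        have iR: "integrable lborel2 (\<lambda>z. (bar a (fst z) * \<psi> (fst z)) * indicator ?At (snd z))"
          and R: "(\<integral>z. (bar a (fst z) * \<psi> (fst z)) * indicator ?At (snd z) \<partial>lborel2) = I * measure lborel ?At"
          using integrable_prod_mult[OF iI iAt] by (simp_all add: I_def)
        have "eform a p (u t) \<psi> - eform a p (W t) \<psi> = (\<integral>z. ?Z z \<partial>lborel2)"
          by (rule eform_diff[OF fu fW f\<psi> p])
        also have "\<dots> \<le> (\<integral>z. - (c0 * \<kappa>) * ((bar a (fst z) * \<psi> (fst z)) * indicator ?At (snd z)) \<partial>lborel2)"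
          by (rule integral_mono[OF iZ _ pw]) (use iR in auto)
        also have "\<dots> = - (c0 * \<kappa>) * (I * measure lborel ?At)" using R by simp
        also have "\<dots> \<le> - (c0 * \<kappa>) * (I * m)"
          using meas[of t] t t1 I0 c0 \<kappa> by (intro mult_left_mono_neg mult_left_mono) auto
        finally have E1: "eform a p (u t) \<psi> \<le> eform a p (W t) \<psi> - c0 * \<kappa> * m * I" by (simp add: mult_ac)
        have "eform a p (W t) \<psi> = (\<eta> * t) powr (p - 1) * eform a p (bar a) \<psi>"
          unfolding W_def using \<eta>t by (intro eform_scale)
        also have "\<dots> \<le> (\<eta> * t) powr (p - 1) * (C * I)"
          using C(2)[OF L\<psi> f\<psi>] \<psi>0 by (intro mult_left_mono) (auto simp: I_def abs_le_iff)
        also have "\<dots> \<le> \<eta> * (C * I)"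
        proof (intro mult_right_mono)
          have "(\<eta> * t) powr (p - 1) \<le> \<eta> * t" using \<eta>t p order_trans[OF \<eta>t(2) \<eta>(3)] by (intro powr_le_one_le) linarith+
          then show "(\<eta> * t) powr (p - 1) \<le> \<eta>" using \<eta>t by linarith
        qed (use C I0 in auto)
        finally have E2: "eform a p (W t) \<psi> \<le> \<eta> * C * I" by (simp add: mult_ac)
        have ew: "(\<integral>x. w x * \<psi> x \<partial>lborel) = eform a p (u t) \<psi>"
          using subdiffJ_eq_eform[OF w(2) p L\<psi>] f\<psi> by (simp add: a_def)
        have "(\<integral>x. indicator UNIV x * max 0 (W t x - u t x) * (\<eta> * bar a x - - w x) \<partial>lborel) = (\<integral>x. \<eta> * (bar a x * \<psi> x) + w x * \<psi> x \<partial>lborel)"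
          by (intro Bochner_Integration.integral_cong) (auto simp: \<psi>_def algebra_simps)
        also have "\<dots> = \<eta> * I + (\<integral>x. w x * \<psi> x \<partial>lborel)"
          using iI in_L2_mult_integrable[OF wL L\<psi>] by (simp add: I_def)
        also have "\<dots> \<le> \<eta> * I + (\<eta> * C * I - c0 * \<kappa> * m * I)" using E1 E2 ew by linarith
        also have "\<dots> = (\<eta> * (1 + C) - c0 * \<kappa> * m) * I" by (simp add: algebra_simps)
        also have "\<dots> \<le> 0" using \<eta>(4) I0 by (intro mult_nonpos_nonneg) auto
        finally show "\<exists>d e. L2_deriv W t d \<and> L2_deriv u t e \<and>
          (\<integral>x. indicator UNIV x * max 0 (W t x - u t x) * (d x - e x) \<partial>lborel) \<le> 0"
          using dW w(1) by blast
      qed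
    qed
  qed simp
  then have "AE x in lborel. (\<eta> * t1) * bar a x \<le> u t1 x" by (simp add: W_def)
  then show ?thesis using t1 \<eta> by (intro exI[of _ t1] exI[of _ "\<eta> * t1"]) (auto simp: a_def)
qed

section \<open>Tail of the self-similar profile\<close>

lemma filterlim_neg_powr_at_right_0:
  fixes b :: real assumes b: "0 < b"
  shows "filterlim (\<lambda>t. t powr (- b)) at_top (at_right 0)"
  unfolding filterlim_at_top
proof
  fix Z :: real
  define Y where "Y = max Z 1"
  have Y: "1 \<le> Y" "Z \<le> Y" by (auto simp: Y_def)
  have "Z \<le> t powr (- b)" if t: "0 < t" "t < Y powr (- 1 / b)" for t
  proof -
    have "(Y powr (- 1 / b)) powr (- b) \<le> t powr (- b)" using t b by (intro powr_mono2') auto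
    moreover have "(Y powr (- 1 / b)) powr (- b) = Y" using b Y by (simp add: powr_powr)
    ultimately show ?thesis using Y by linarith
  qed
  then show "\<forall>\<^sub>F t in at_right 0. Z \<le> t powr (- b)"
    unfolding eventually_at_right_field using Y by (intro exI[of _ "Y powr (- 1 / b)"]) auto
qed

text \<open>On the ball of radius \<open>r\<close> the profile is at least \<open>F r\<close>, so
  \<open>F r\<close> times the volume of the ball is at most the total mass.\<close>

lemma profile_le_norm_powr:
  fixes F :: "real \<Rightarrow> real"
  assumes mono: "\<And>r1 r2. 0 \<le> r1 \<Longrightarrow> r1 \<le> r2 \<Longrightarrow> F r2 \<le> F r1" and pos: "\<And>r. 0 \<le> r \<Longrightarrow> 0 < F r"
    and int: "integrable lborel (\<lambda>x::'a::euclidean_space. F (norm x))" and one: "(\<integral>x. F (norm (x::'a)) \<partial>lborel) = 1"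
    and r: "0 \<le> r"
  shows "F r * (unit_ball_vol (real DIM('a)) * r ^ DIM('a)) \<le> 1"
proof -
  have m: "emeasure lborel (ball (0::'a) r) = ennreal (unit_ball_vol (real DIM('a)) * r ^ DIM('a))"
    by (rule emeasure_ball[OF r])
  have mm: "measure lborel (ball (0::'a) r) = unit_ball_vol (real DIM('a)) * r ^ DIM('a)"
    using m r by (simp add: measure_def)
  have "F r * (unit_ball_vol (real DIM('a)) * r ^ DIM('a)) = (\<integral>x. F r * indicator (ball (0::'a) r) x \<partial>lborel)"
    by (simp add: mm)
  also have "\<dots> \<le> (\<integral>x. F (norm (x::'a)) \<partial>lborel)"
  proof (rule integral_mono[OF _ int])
    show "integrable lborel (\<lambda>x. F r * indicator (ball (0::'a) r) x)"
      using m by (intro integrable_mult_right) (auto simp: integrable_indicator_iff)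
    fix x :: 'a
    show "F r * indicator (ball 0 r) x \<le> F (norm x)"
      using mono[of "norm x" r] pos[of "norm x"] by (auto simp: indicator_def)
  qed
  finally show ?thesis using one by simp
qed

text \<open>The mass of the self-similar solution outside the unit ball vanishes as time tends to 0, so
  there it can be compared with \<open>(A + B t\<^sup>\<gamma>) bar\<close>: the inflow from the unit ball is of order
  \<open>t powr (\<gamma> - 1)\<close> because \<open>F\<close> is bounded and integrable, which is exactly what the
  time derivative of the barrier absorbs for small times.\<close>
lemma selfsimilar_tail:
  fixes F :: "real \<Rightarrow> real" and U :: "real \<Rightarrow> 'a::euclidean_space \<Rightarrow> real"
  assumes s: "0 < s" "s < 1" and p: "p > 2"
    and mono: "\<And>r1 r2. 0 \<le> r1 \<Longrightarrow> r1 \<le> r2 \<Longrightarrow> F r2 \<le> F r1" and pos: "\<And>r. 0 \<le> r \<Longrightarrow> 0 < F r"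
    and int: "integrable lborel (\<lambda>x::'a. F (norm x))" and one: "(\<integral>x. F (norm (x::'a)) \<partial>lborel) = 1"
    and \<beta>: "\<beta> = 1 / (real DIM('a) * (p - 2) + s * p)"
    and U: "U = (\<lambda>t x. t powr (- (real DIM('a) * \<beta>)) * F (norm x * t powr (- \<beta>)))"
    and flow: "flow s p U"
  shows "\<exists>t1 K. 0 < t1 \<and> t1 \<le> 1 \<and> 0 < K \<and> (AE x in lborel. 1 \<le> norm x \<longrightarrow> U t1 x \<le> K * bar (real DIM('a) + s * p) x)"
proof -
  define a where "a = real DIM('a) + s * p"
  define N where "N = DIM('a)"
  define S where "S = {x::'a. 1 \<le> norm x}"
  have S[measurable]: "S \<in> sets borel" unfolding S_def by measurable
  have sp: "0 < s * p" "s * p < p" using s p by auto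
  have a: "a > real DIM('a)" "a - p < real DIM('a)" "0 \<le> a" using sp by (auto simp: a_def)
  have N0: "0 < real N" by (simp add: N_def)
  have den: "0 < real N * (p - 2) + s * p" using N0 p sp by (simp add: add_pos_pos)
  have \<beta>0: "0 < \<beta>" using den by (simp add: \<beta> N_def)
  \<comment> \<open>Since \<open>1 - \<gamma> = N * \<beta> * (p - 2)\<close>, the bound of
    \<open>U\<close> by its maximum \<open>t powr (- N * \<beta>) * F 0\<close>, raised to the power
    p - 2, contributes \<open>t powr (\<gamma> - 1)\<close>. This is the rate of the inflow, and it
    is integrable at 0.\<close>
  define \<gamma> where "\<gamma> = s * p * \<beta>"
  have \<gamma>: "0 < \<gamma>" "\<gamma> < 1" "1 - \<gamma> = real N * \<beta> * (p - 2)"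
  proof -
    show "0 < \<gamma>" using sp \<beta>0 by (simp add: \<gamma>_def)
    have "(real N * (p - 2) + s * p) * \<beta> = 1" using den by (simp add: \<beta> N_def)
    then show e: "1 - \<gamma> = real N * \<beta> * (p - 2)" by (simp add: \<gamma>_def algebra_simps)
    have "0 < real N * \<beta> * (p - 2)" using N0 \<beta>0 p by simp
    then show "\<gamma> < 1" using e by linarith
  qed
  have U0: "0 < U t x" if "0 < t" for t x using that pos by (simp add: U)
  have curve: "L2_curve U" using flow by (simp add: flow_def)
  define V where "V = unit_ball_vol (real N)"
  have V0: "V > 0" by (simp add: V_def)
  \<comment> \<open>A bound for \<open>U\<close> outside the unit ball that is uniform in time, from
    unit mass and monotonicity: the dilations in the height and in the radius cancel.\<close>
  define k where "k = 1 / V"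
  have k0: "k > 0" using V0 by (simp add: k_def)
  have Uk: "U t x \<le> k" if t: "0 < t" and x: "1 \<le> norm x" for t x
  proof -
    define r where "r = norm x * t powr (- \<beta>)"
    have r0: "0 < r" unfolding r_def using t less_le_trans[OF zero_less_one x] by (intro mult_pos_pos) auto
    have "F r * (V * r ^ N) \<le> 1"
      unfolding V_def N_def using profile_le_norm_powr[OF mono pos int one, of r] r0 by simp
    moreover have "r ^ N = (norm x) ^ N * t powr (- (real N * \<beta>))"
      using t by (simp add: r_def power_mult_distrib powr_power mult.commute)
    ultimately have "V * (norm x) ^ N * U t x \<le> 1" by (simp add: U r_def N_def mult_ac)
    moreover have "V * 1 * U t x \<le> V * (norm x) ^ N * U t x"
      using V0 U0[OF t, of x] x by (intro mult_right_mono mult_left_mono one_le_power) auto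
    ultimately have "V * U t x \<le> 1" by simp
    then show ?thesis using V0 by (simp add: k_def field_simps)
  qed
  have UF0: "U t x \<le> t powr (- (real N * \<beta>)) * F 0" if "0 < t" for t x
    unfolding U N_def using mono[of 0 "norm x * t powr (- \<beta>)"] by (intro mult_left_mono) auto
  have scale: "integrable lborel (U t)" "(\<integral>x. U t x \<partial>lborel) = 1" if t: "0 < t" for t
  proof -
    let ?c = "t powr (- \<beta>)"
    have c: "?c > 0" using t by simp
    have eq: "(\<lambda>x. F (norm (?c *\<^sub>R x))) = (\<lambda>x::'a. F (norm x * ?c))" using c by (auto simp: mult.commute)
    have i: "integrable lborel (\<lambda>x::'a. F (norm x * ?c))"
      using integrable_lborel_scale(1)[OF int c] unfolding eq .
    then show "integrable lborel (U t)" unfolding U by auto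
    have "(\<integral>x. F (norm (x::'a) * ?c) \<partial>lborel) = 1 / ?c ^ DIM('a)"
      using integrable_lborel_scale(2)[OF int c] unfolding eq one .
    moreover have "?c ^ DIM('a) = t powr (- (real DIM('a) * \<beta>))" using t by (simp add: powr_power mult.commute)
    ultimately show "(\<integral>x. U t x \<partial>lborel) = 1" using t unfolding U by simp
  qed
  obtain C where C: "C \<ge> 0" "\<And>\<psi>::'a \<Rightarrow> real. in_L2 \<psi> \<Longrightarrow> finite_energy a p \<psi> \<Longrightarrow> (\<forall>x. 0 \<le> \<psi> x) \<Longrightarrow>
     \<bar>eform a p (bar a) \<psi>\<bar> \<le> C * (\<integral>x. bar a x * \<psi> x \<partial>lborel)"
    using bar_eform_bound[OF a(1,2) p] by blast
  define c5 where "c5 = 5 powr (a / 2)"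
  have c5: "c5 > 0" by (simp add: c5_def)
  \<comment> \<open>Chosen so that the barrier already exceeds \<open>k\<close> on the ball of
    radius 2. The test function then vanishes for norm at most 2, which separates its support from
    the unit ball.\<close>
  define A where "A = k * c5"
  have A0: "A > 0" using k0 c5 by (simp add: A_def)
  have Ak: "k \<le> A * bar a x" if x: "norm x \<le> 2" for x :: 'a
  proof -
    have "(norm x)\<^sup>2 \<le> 2\<^sup>2" using x by (intro power_mono) auto
    then have "bar a (0::'a) \<le> 5 powr (a / 2) * bar a x" using a by (intro bar_compare) auto
    then have "1 \<le> c5 * bar a x" by (simp add: bar_def c5_def)
    then have "k * 1 \<le> k * (c5 * bar a x)" using k0 by (intro mult_left_mono) auto
    then show ?thesis by (simp add: A_def mult.assoc)
  qed
  define G where "G = 2 * c5 * F 0 powr (p - 2)"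
  have G0: "G \<ge> 0" using c5 by (simp add: G_def)
  \<comment> \<open>The slope of the barrier is \<open>B * \<gamma> * t powr (\<gamma> - 1)\<close>;
    of the factor G + 1, the part \<open>G\<close> absorbs the inflow and the 1 absorbs the operator
    acting on the barrier.\<close>
  define B where "B = (G + 1) / \<gamma>"
  have B0: "B > 0" "B * \<gamma> = G + 1" using \<gamma> G0 by (auto simp: B_def)
  \<comment> \<open>\<open>H\<close> bounds the operator on the barrier relative to
    \<open>bar\<close>; \<open>t1\<close> solves \<open>t1 powr (\<gamma> - 1) = H\<close>, so up to
    that time this bound is dominated by \<open>t powr (\<gamma> - 1)\<close>.\<close>
  define H where "H = (A + B) powr (p - 1) * C + 1"
  have H1: "H \<ge> 1" using C by (simp add: H_def)
  define t1 where "t1 = H powr (- 1 / (1 - \<gamma>))"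
  have t1: "0 < t1" "t1 \<le> 1"
  proof -
    show "0 < t1" using H1 by (simp add: t1_def)
    have "H powr (- 1 / (1 - \<gamma>)) \<le> H powr 0" using H1 \<gamma> by (intro powr_mono) (auto simp: divide_nonpos_nonneg)
    then show "t1 \<le> 1" using H1 by (simp add: t1_def)
  qed
  have tH: "H \<le> t powr (\<gamma> - 1)" if t: "0 < t" "t < t1" for t
  proof -
    have "t1 powr (\<gamma> - 1) \<le> t powr (\<gamma> - 1)" using t \<gamma> by (intro powr_mono2') auto
    moreover have "t1 powr (\<gamma> - 1) = H powr ((- 1 / (1 - \<gamma>)) * (\<gamma> - 1))" by (simp add: t1_def powr_powr)
    moreover have "(- 1 / (1 - \<gamma>)) * (\<gamma> - 1) = 1" using \<gamma> by (simp add: field_simps)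
    ultimately show ?thesis using H1 by simp
  qed
  define g where "g t = A + B * t powr \<gamma>" for t
  define g' where "g' t = B * (\<gamma> * t powr (\<gamma> - 1))" for t
  have dg: "(g has_real_derivative g' t) (at t)" if "0 < t" for t
    unfolding g_def g'_def
    using DERIV_add[OF DERIV_const DERIV_cmult[OF has_real_derivative_powr[OF that, of \<gamma>], of B], of A] by simp
  have g_pos: "0 < g t" for t using A0 B0 by (simp add: g_def add_pos_nonneg)
  have gA: "A \<le> g t" for t using B0 by (simp add: g_def)
  have gB: "g t \<le> A + B" if "0 < t" "t \<le> 1" for t
    using B0 that \<gamma> powr_mono2[of \<gamma> t 1] by (simp add: g_def)
  define W where "W = (\<lambda>t x. g t * bar a (x::'a))"
  have Wc: "L2_curve W" unfolding W_def
  proof (rule L2_curve_barrier[OF bar_in_L2[OF a(1)], where g' = g'])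
    show "\<exists>K. \<forall>t\<ge>\<delta>. \<bar>g' t\<bar> \<le> K" if d: "0 < \<delta>" for \<delta>
    proof (intro exI[of _ "g' \<delta>"] allI impI)
      fix t assume "\<delta> \<le> t"
      then have "t powr (\<gamma> - 1) \<le> \<delta> powr (\<gamma> - 1)" using d \<gamma> by (intro powr_mono2') auto
      then show "\<bar>g' t\<bar> \<le> g' \<delta>" using B0 \<gamma> by (simp add: g'_def abs_mult)
    qed
  qed (rule dg)
  have "AE x in lborel. x \<in> S \<longrightarrow> U t1 x \<le> W t1 x"
  proof (rule curve_comparison[OF curve Wc S t1(1)])
    show "((\<lambda>t. pos_part_sq S (\<lambda>x. U t x - W t x)) \<longlongrightarrow> 0) (at_right 0)"
    proof (rule Lim_null_comparison)
      \<comment> \<open>Since \<open>U\<close> is at most \<open>k\<close> on \<open>S\<close>, the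
        squared positive part is at most \<open>k * U\<close>, and the mass of \<open>U\<close> on
        \<open>S\<close> equals the mass of the profile beyond radius
        \<open>t powr (- \<beta>)\<close>, which tends to infinity as t tends to 0.\<close>
      let ?T = "\<lambda>R. \<integral>x. indicator {x. R \<le> norm x} x * F (norm (x::'a)) \<partial>lborel"
      show "\<forall>\<^sub>F t in at_right 0. norm (pos_part_sq S (\<lambda>x. U t x - W t x)) \<le> k * ?T (t powr (- \<beta>))"
        using eventually_at_right_less[of 0]
      proof eventually_elim
        case (elim t)
        let ?c = "t powr (- \<beta>)"
        have c: "?c > 0" using elim by simp
        have iR: "integrable lborel (\<lambda>x::'a. indicator {x. ?c \<le> norm x} x * F (norm x))"
          using integrable_mult_indicator[OF _ int, of "{x. ?c \<le> norm x}"] by simp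
        have eq: "(\<lambda>x::'a. indicator {x. ?c \<le> norm x} (?c *\<^sub>R x) * F (norm (?c *\<^sub>R x))) = (\<lambda>x. indicator S x * F (norm x * ?c))"
          using c by (auto simp: S_def indicator_def fun_eq_iff mult.commute)
        have sc: "integrable lborel (\<lambda>x::'a. indicator S x * F (norm x * ?c))"
          "(\<integral>x. indicator S x * F (norm (x::'a) * ?c) \<partial>lborel) = ?T ?c / ?c ^ DIM('a)"
          using integrable_lborel_scale[OF iR c] unfolding eq by auto
        have cN: "?c ^ DIM('a) = t powr (- (real DIM('a) * \<beta>))" using elim by (simp add: powr_power mult.commute)
        have cN0: "?c ^ DIM('a) > 0" using c by simp
        have "pos_part_sq S (\<lambda>x. U t x - W t x) \<le> (\<integral>x. k * (?c ^ DIM('a) * (indicator S x * F (norm (x::'a) * ?c))) \<partial>lborel)"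
          unfolding pos_part_sq_def
        proof (rule integral_mono)
          show "integrable lborel (\<lambda>x. indicator S x * (max 0 (U t x - W t x))\<^sup>2)"
            by (intro pos_part_sq_integrable in_L2_diff S) (use L2_curve_in_L2[OF curve] L2_curve_in_L2[OF Wc] elim in auto)
          show "integrable lborel (\<lambda>x::'a. k * (?c ^ DIM('a) * (indicator S x * F (norm x * ?c))))" using sc by auto
          fix x :: 'a
          show "indicator S x * (max 0 (U t x - W t x))\<^sup>2 \<le> k * (?c ^ DIM('a) * (indicator S x * F (norm x * ?c)))"
          proof (cases "x \<in> S")
            case True
            have "0 \<le> W t x" using g_pos[of t] by (simp add: W_def)
            then have m: "max 0 (U t x - W t x) \<le> U t x" using U0[OF elim, of x] by auto
            have "(max 0 (U t x - W t x))\<^sup>2 \<le> k * U t x"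
              unfolding power2_eq_square using m True Uk[OF elim, of x] U0[OF elim, of x] 
              by (intro mult_mono) (auto simp: S_def)
            then show ?thesis using True by (simp add: cN U)
          qed simp
        qed
        also have "\<dots> = k * ?T ?c" using sc cN0 elim by simp
        finally show ?case by (simp add: pos_part_sq_nonneg)
      qed
      have "((\<lambda>R. ?T R) \<longlongrightarrow> (\<integral>x. 0 \<partial>(lborel :: 'a measure))) at_top"
      proof (rule integral_dominated_convergence_at_top[OF _ _ int])
        show "AE x::'a in lborel. ((\<lambda>R. indicator {x. R \<le> norm x} x * F (norm x)) \<longlongrightarrow> 0) at_top"
        proof (rule AE_I2)
          fix x :: 'a
          have "\<forall>\<^sub>F R in at_top. norm x < R" by (rule eventually_gt_at_top)
          then have "\<forall>\<^sub>F R in at_top. indicator {x. R \<le> norm x} x * F (norm x) = 0" by eventually_elim simp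
          then show "((\<lambda>R. indicator {x. R \<le> norm x} x * F (norm x)) \<longlongrightarrow> 0) at_top" by (rule tendsto_eventually)
        qed
        show "\<forall>\<^sub>F R in at_top. AE x::'a in lborel. norm (indicator {x. R \<le> norm x} x * F (norm x)) \<le> F (norm x)"
          using pos by (intro always_eventually allI AE_I2) (auto simp: indicator_def less_imp_le)
        show "(\<lambda>x::'a. indicator {x. R \<le> norm x} x * F (norm x)) \<in> borel_measurable lborel" for R
          using borel_measurable_integrable[OF int] by measurable
      qed simp
      moreover have "filterlim (\<lambda>t. t powr (- \<beta>)) at_top (at_right 0)"
        by (rule filterlim_neg_powr_at_right_0[OF \<beta>0])
      ultimately have "((\<lambda>t. ?T (t powr (- \<beta>))) \<longlongrightarrow> (\<integral>x. 0 \<partial>(lborel :: 'a measure))) (at_right 0)"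
        by (rule filterlim_compose)
      from tendsto_mult_left[OF this, of k]
      show "((\<lambda>t. k * ?T (t powr (- \<beta>))) \<longlongrightarrow> 0) (at_right 0)" by simp
    qed
    have "AE t in lborel. 0 < t \<longrightarrow> (\<exists>w. L2_deriv U t (\<lambda>x. - w x) \<and> subdiffJ s p (U t) w)"
      using flow by (simp add: flow_def)
    then show "AE t in lborel. t \<in> {0<..<t1} \<longrightarrow> (\<exists>d e. L2_deriv U t d \<and> L2_deriv W t e \<and>
        (\<integral>x. indicator S x * max 0 (U t x - W t x) * (d x - e x) \<partial>lborel) \<le> 0)"
    proof eventually_elim
      case (elim t)
      show ?case
      proof
        assume t: "t \<in> {0<..<t1}"
        then have t0: "0 < t" by simp
        obtain w where w: "L2_deriv U t (\<lambda>x. - w x)" "subdiffJ s p (U t) w" using elim t by auto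
        have dW: "L2_deriv W t (\<lambda>x. g' t * bar a x)" unfolding W_def
          by (rule L2_deriv_barrier[OF bar_in_L2[OF a(1)] dg[OF t0]])
        have Ut: "in_L2 (U t)" and wL: "in_L2 w" using w(2) by (auto simp: subdiffJ_def)
        have [measurable]: "U t \<in> borel_measurable borel" using Ut by (simp add: in_L2_def)
        have Wt: "in_L2 (W t)" using L2_curve_in_L2[OF Wc] t by auto
        have [measurable]: "W t \<in> borel_measurable borel" using Wt by (simp add: in_L2_def)
        define \<psi> where "\<psi> x = indicator S x * max 0 (U t x - W t x)" for x
        have [measurable]: "\<psi> \<in> borel_measurable borel" unfolding \<psi>_def by measurable
        have WA: "A * bar a x \<le> W t x" for x unfolding W_def using gA by (intro mult_right_mono) auto
        have \<psi>2: "\<psi> x = 0" if "norm x \<le> 2" for x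
          using that Ak[OF that] WA[of x] Uk[OF t0, of x] by (auto simp: \<psi>_def S_def indicator_def)
        \<comment> \<open>Cutting off with the indicator of \<open>S\<close> might create a jump of
          infinite energy. Truncating \<open>U\<close> at height \<open>k\<close> gives the same
          function, since inside the unit ball the barrier exceeds \<open>k\<close>, and this form
          is visibly a contraction of \<open>U\<close> and \<open>W\<close>.\<close>
        have \<psi>min: "\<psi> x = max 0 (min (U t x) k - W t x)" for x
        proof (cases "1 \<le> norm x")
          case True
          then show ?thesis using Uk[OF t0 True] by (simp add: \<psi>_def S_def)
        next
          case False
          then show ?thesis using Ak[of x] WA[of x] by (auto simp: \<psi>_def S_def)
        qed
        have fU: "finite_energy a p (U t)" unfolding a_def by (rule subdiffJ_finite_energy[OF w(2) p])
        have fW: "finite_energy a p (W t)" unfolding W_def by (rule finite_energy_cmult[OF bar_finite_energy[OF a(1,2) p]])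
        have f\<psi>: "finite_energy a p \<psi>"
        proof (rule finite_energy_dominated[OF fU fW])
          show "\<bar>\<psi> x - \<psi> y\<bar> \<le> \<bar>U t x - U t y\<bar> + \<bar>W t x - W t y\<bar>" for x y unfolding \<psi>min by linarith
        qed (use p in auto)
        have L\<psi>: "in_L2 \<psi>" unfolding \<psi>_def by (intro in_L2_indicator_pos_part in_L2_diff Ut Wt S)
        have \<psi>0: "0 \<le> \<psi> x" for x by (simp add: \<psi>_def)
        define I where "I = (\<integral>x. bar a x * \<psi> x \<partial>lborel)"
        have iI: "integrable lborel (\<lambda>x. bar a x * \<psi> x)" by (rule in_L2_mult_integrable[OF bar_in_L2[OF a(1)] L\<psi>])
        have I0: "0 \<le> I" unfolding I_def using \<psi>0 by (intro Bochner_Integration.integral_nonneg) auto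
        \<comment> \<open>The inflow density: \<open>Phi p (- U t y)\<close> bounds from below the
          interaction of a positive outer value with a point \<open>y\<close> of the unit
          ball.\<close>
        define Up where "Up y = indicator (- S) y * U t y powr (p - 1)" for y
        have Uple: "U t y powr (p - 1) \<le> (F 0 powr (p - 2) * t powr (\<gamma> - 1)) * U t y" for y
        proof -
          have "U t y powr (p - 1) = U t y powr (p - 2) * U t y"
            using U0[OF t0, of y] powr_mult_base[of "U t y" "p - 2"] by (simp add: mult.commute)
          also have "\<dots> \<le> (t powr (- (real N * \<beta>)) * F 0) powr (p - 2) * U t y"
            using U0[OF t0, of y] UF0[OF t0, of y] p by (intro mult_right_mono powr_mono2) auto
          also have "(t powr (- (real N * \<beta>)) * F 0) powr (p - 2) = F 0 powr (p - 2) * t powr (\<gamma> - 1)"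
          proof -
            have "- (real N * \<beta>) * (p - 2) = \<gamma> - 1" using \<gamma>(3) by (simp add: algebra_simps)
            then show ?thesis using pos[of 0] by (simp add: powr_mult powr_powr mult.commute)
          qed
          finally show ?thesis .
        qed
        have iU: "integrable lborel (\<lambda>y. (F 0 powr (p - 2) * t powr (\<gamma> - 1)) * U t y)" using scale(1)[OF t0] by auto
        have Up0: "0 \<le> Up y" "Up y \<le> (F 0 powr (p - 2) * t powr (\<gamma> - 1)) * U t y" for y
          using Uple[of y] U0[OF t0, of y] by (auto simp: Up_def indicator_def)
        have iUp: "integrable lborel Up"
          by (rule Bochner_Integration.integrable_bound[OF iU]) 
            (use Up0 in \<open>auto simp: Up_def[abs_def] intro!: AE_I2 order_trans[OF _ abs_ge_self]\<close>)
        have Upint: "(\<integral>y. Up y \<partial>lborel) \<le> F 0 powr (p - 2) * t powr (\<gamma> - 1)"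
          using integral_mono[OF iUp iU Up0(2)] scale(2)[OF t0] by simp
        let ?Z = "\<lambda>z. (Phi p (U t (fst z) - U t (snd z)) - Phi p (W t (fst z) - W t (snd z))) * (\<psi> (fst z) - \<psi> (snd z)) * kern a (fst z - snd z)"
        have iZ: "integrable lborel2 ?Z"
          using Bochner_Integration.integrable_diff[OF eform_integrable[OF fU f\<psi> p] eform_integrable[OF fW f\<psi> p]]
          by (simp only: left_diff_distrib)
        define R where "R z = (bar a (fst z) * \<psi> (fst z)) * Up (snd z)" for z
        have R0: "0 \<le> R z" for z unfolding R_def using \<psi>0 Up0 by simp
        have iR: "integrable lborel2 R" and R: "(\<integral>z. R z \<partial>lborel2) = I * (\<integral>y. Up y \<partial>lborel)"
          unfolding R_def[abs_def] using integrable_prod_mult[OF iI iUp] by (simp_all add: I_def)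
        note sw = integral_swap[OF iR]
        \<comment> \<open>Pairs with \<open>y\<close> in the unit ball are not governed by
          T-monotonicity, as \<psi> is cut off there. The contribution of \<open>W\<close> has a
          good sign because \<open>bar\<close> is radially decreasing, and that of \<open>U\<close>
          loses at most \<open>Up y\<close>.\<close>
        have half: "- (c5 * R (x, y)) \<le> (Phi p (U t x - U t y) - Phi p (W t x - W t y)) * \<psi> x * kern a (x - y)"
          if y: "y \<notin> S" for x y
        proof (cases "\<psi> x = 0")
          case False
          then have x2: "2 < norm x" using \<psi>2[of x] by force
          have y1: "norm y < 1" using y by (simp add: S_def)
          have "W t x \<le> W t y" unfolding W_def using g_pos[of t] x2 y1 a
            by (intro mult_left_mono bar_antimono) auto
          then have P2: "Phi p (W t x - W t y) \<le> 0" using Phi_mono[OF p, of "W t x - W t y" 0] by simp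
          have "Phi p (- U t y) \<le> Phi p (U t x - U t y)" using U0[OF t0, of x] by (intro Phi_mono[OF p]) simp
          then have "- (U t y powr (p - 1)) \<le> Phi p (U t x - U t y)"
            using U0[OF t0, of y] by (simp add: Phi_nonneg)
          then have P: "- Up y \<le> Phi p (U t x - U t y) - Phi p (W t x - W t y)" using P2 y by (simp add: Up_def)
          have K: "kern a (x - y) \<le> c5 * bar a x" unfolding c5_def using x2 y1 a by (intro kern_le_bar_exterior) auto
          have "Up y * (\<psi> x * kern a (x - y)) \<le> Up y * (\<psi> x * (c5 * bar a x))"
            using K \<psi>0 Up0 by (intro mult_left_mono) auto
          then have "- (c5 * R (x, y)) \<le> - Up y * (\<psi> x * kern a (x - y))" by (simp add: R_def mult_ac)
          also have "\<dots> \<le> (Phi p (U t x - U t y) - Phi p (W t x - W t y)) * (\<psi> x * kern a (x - y))"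
            using P \<psi>0 by (intro mult_right_mono) auto
          finally show ?thesis by (simp add: mult.assoc)
        qed (simp add: R_def)
        \<comment> \<open>Two points in \<open>S\<close> contribute nonnegatively by T-monotonicity,
          two points outside contribute nothing, and mixed pairs lose one of the two
          \<open>R\<close> terms. Counting both orders of a mixed pair gives the factor 2 in
          \<open>G\<close>.\<close>
        have pw: "- c5 * (R z + R (snd z, fst z)) \<le> ?Z z" for z
        proof -
          define x y where "x = fst z" and "y = snd z"
          have z: "z = (x, y)" by (simp add: x_def y_def)
          have Rs: "0 \<le> c5 * R (x, y)" "0 \<le> c5 * R (y, x)" using R0 c5 by auto
          have goal: "- (c5 * R (x, y)) - c5 * R (y, x) \<le> (Phi p (U t x - U t y) - Phi p (W t x - W t y)) * (\<psi> x - \<psi> y) * kern a (x - y)"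
          proof (cases "x \<in> S"; cases "y \<in> S")
            assume "x \<in> S" "y \<in> S"
            then have "0 \<le> (Phi p (U t x - U t y) - Phi p (W t x - W t y)) * (\<psi> x - \<psi> y)"
              using Phi_T_monotone[OF p, of "U t x" "U t y" "W t x" "W t y"] by (simp add: \<psi>_def)
            then have "0 \<le> (Phi p (U t x - U t y) - Phi p (W t x - W t y)) * (\<psi> x - \<psi> y) * kern a (x - y)"
              by (rule mult_nonneg_nonneg) simp
            then show ?thesis using Rs by linarith
          next
            assume "x \<in> S" "y \<notin> S"
            then have "\<psi> y = 0" by (simp add: \<psi>_def)
            then show ?thesis using half[OF \<open>y \<notin> S\<close>, of x] Rs by simp
          next
            assume xS: "x \<notin> S" "y \<in> S"
            then have px: "\<psi> x = 0" by (simp add: \<psi>_def)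
            have "(Phi p (U t x - U t y) - Phi p (W t x - W t y)) * (\<psi> x - \<psi> y) * kern a (x - y)
              = (Phi p (U t y - U t x) - Phi p (W t y - W t x)) * \<psi> y * kern a (y - x)"
              using Phi_uminus[of p "U t y - U t x"] Phi_uminus[of p "W t y - W t x"]
              by (simp add: px kern_commute[of a y x] algebra_simps)
            then show ?thesis using half[OF xS(1), of y] Rs by linarith
          next
            assume "x \<notin> S" "y \<notin> S"
            then have "\<psi> x = 0" "\<psi> y = 0" by (simp_all add: \<psi>_def)
            then show ?thesis using Rs by simp
          qed
          then show ?thesis by (simp add: z algebra_simps)
        qed
        have "- c5 * (2 * (I * (\<integral>y. Up y \<partial>lborel))) = (\<integral>z. - c5 * (R z + R (snd z, fst z)) \<partial>lborel2)"
          using iR sw R by simp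
        also have "\<dots> \<le> (\<integral>z. ?Z z \<partial>lborel2)"
          by (rule integral_mono[OF _ iZ pw]) (use iR sw in auto)
        also have "\<dots> = eform a p (U t) \<psi> - eform a p (W t) \<psi>"
          by (rule eform_diff[OF fU fW f\<psi> p, symmetric])
        finally have E1: "eform a p (W t) \<psi> - 2 * c5 * (I * (\<integral>y. Up y \<partial>lborel)) \<le> eform a p (U t) \<psi>" by simp
        have "2 * c5 * (I * (\<integral>y. Up y \<partial>lborel)) \<le> 2 * c5 * (I * (F 0 powr (p - 2) * t powr (\<gamma> - 1)))"
          using Upint I0 c5 by (intro mult_left_mono) auto
        also have "\<dots> = G * t powr (\<gamma> - 1) * I" by (simp add: G_def mult_ac)
        finally have E2: "2 * c5 * (I * (\<integral>y. Up y \<partial>lborel)) \<le> G * t powr (\<gamma> - 1) * I" .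
        have "- (g t powr (p - 1) * (C * I)) \<le> g t powr (p - 1) * eform a p (bar a) \<psi>"
        proof -
          have "- (C * I) \<le> eform a p (bar a) \<psi>" using C(2)[OF L\<psi> f\<psi>] \<psi>0 by (auto simp: I_def abs_le_iff)
          then have "g t powr (p - 1) * (- (C * I)) \<le> g t powr (p - 1) * eform a p (bar a) \<psi>" by (intro mult_left_mono) auto
          then show ?thesis by simp
        qed
        also have "\<dots> = eform a p (W t) \<psi>" unfolding W_def using g_pos by (intro eform_scale[symmetric])
        finally have E3: "- (g t powr (p - 1) * (C * I)) \<le> eform a p (W t) \<psi>" .
        have "g t powr (p - 1) * C \<le> (A + B) powr (p - 1) * C"
          using gB[of t] g_pos[of t] t t1 p C by (intro mult_right_mono powr_mono2) auto
        also have "\<dots> \<le> t powr (\<gamma> - 1)" using tH[of t] t by (simp add: H_def)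
        finally have "g t powr (p - 1) * C * I \<le> t powr (\<gamma> - 1) * I" using I0 by (rule mult_right_mono)
        then have "g t powr (p - 1) * (C * I) \<le> t powr (\<gamma> - 1) * I" by (simp add: mult.assoc)
        then have "- (t powr (\<gamma> - 1) * I) - G * t powr (\<gamma> - 1) * I \<le> eform a p (U t) \<psi>"
          using E1 E2 E3 by linarith
        moreover have "g' t * I = t powr (\<gamma> - 1) * I + G * t powr (\<gamma> - 1) * I"
        proof -
          have "g' t = (B * \<gamma>) * t powr (\<gamma> - 1)" by (simp add: g'_def)
          then show ?thesis unfolding B0(2) by (simp add: algebra_simps)
        qed
        ultimately have E: "- eform a p (U t) \<psi> - g' t * I \<le> 0" by linarith
        have ew: "(\<integral>x. w x * \<psi> x \<partial>lborel) = eform a p (U t) \<psi>"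
          using subdiffJ_eq_eform[OF w(2) p L\<psi>] f\<psi> by (simp add: a_def)
        have "(\<integral>x. indicator S x * max 0 (U t x - W t x) * (- w x - g' t * bar a x) \<partial>lborel) = (\<integral>x. - (w x * \<psi> x) - g' t * (bar a x * \<psi> x) \<partial>lborel)"
          by (intro Bochner_Integration.integral_cong) (auto simp: \<psi>_def algebra_simps)
        also have "\<dots> = - eform a p (U t) \<psi> - g' t * I"
          using iI in_L2_mult_integrable[OF wL L\<psi>] ew by (simp add: I_def)
        finally show "\<exists>d e. L2_deriv U t d \<and> L2_deriv W t e \<and>
          (\<integral>x. indicator S x * max 0 (U t x - W t x) * (d x - e x) \<partial>lborel) \<le> 0"
          using dW w(1) E by (intro exI[of _ "\<lambda>x. - w x"] exI[of _ "\<lambda>x. g' t * bar a x"]) auto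
      qed
    qed
  qed
  then have "AE x in lborel. 1 \<le> norm x \<longrightarrow> U t1 x \<le> g t1 * bar a x" by (simp add: W_def S_def)
  then show ?thesis using t1 g_pos[of t1] by (intro exI[of _ t1] exI[of _ "g t1"]) (auto simp: a_def)
qed

text \<open>By self-similarity the bound for \<open>U\<close> at the single time \<open>t\<close> is
  a bound for \<open>F\<close> after dilation. The bound on \<open>U\<close> holds only almost
  everywhere, and monotonicity of \<open>F\<close> upgrades it to every radius.\<close>

lemma profile_tail:
  assumes s: "0 < s" "s < 1" and p: "p > 2" and prof: "is_profile s p TYPE('a::euclidean_space) F"
  shows "\<exists>K>0. \<forall>r\<ge>0. F r \<le> K * (1 + r\<^sup>2) powr (- (real DIM('a) + s * p) / 2)"
proof -
  define a where "a = real DIM('a) + s * p"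
  have a0: "0 \<le> a" using s p by (simp add: a_def)
  have pos: "\<And>r. 0 \<le> r \<Longrightarrow> 0 < F r" and mono: "\<And>r1 r2. 0 \<le> r1 \<Longrightarrow> r1 \<le> r2 \<Longrightarrow> F r2 \<le> F r1"
    using prof by (auto simp: is_profile_def)
  define \<beta> where "\<beta> = 1 / (real DIM('a) * (p - 2) + s * p)"
  have \<beta>0: "0 < \<beta>" using s p by (simp add: \<beta>_def add_nonneg_pos)
  define U where "U = (\<lambda>t (x::'a). t powr (- (real DIM('a) * \<beta>)) * F (norm x * t powr (- \<beta>)))"
  have "Ubar s p F 1 = U" by (simp add: fun_eq_iff Ubar_def U_def alphaE_def betaE_def \<beta>_def)
  moreover have "flow s p (Ubar s p F 1 :: real \<Rightarrow> 'a \<Rightarrow> real)"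
    using prof by (intro is_solution_pos_imp_flow) (simp add: is_profile_def)
  ultimately have fl: "flow s p U" by simp
  have int: "integrable lborel (\<lambda>x::'a. F (norm x))" "(\<integral>x. F (norm (x::'a)) \<partial>lborel) = 1"
    using prof by (auto simp: is_profile_def)
  obtain t K where t: "0 < t" "t \<le> 1" and K: "0 < K" and
    ae: "AE x::'a in lborel. 1 \<le> norm x \<longrightarrow> U t x \<le> K * bar a x"
    unfolding a_def using selfsimilar_tail[OF s p mono pos int \<beta>_def U_def fl] by blast
  define T where "T = t powr \<beta>"
  have T: "0 < T" "T \<le> 1" using t \<beta>0 powr_mono2[of \<beta> t 1] by (auto simp: T_def)
  have Ti: "t powr (- \<beta>) = 1 / T" using t by (simp add: T_def powr_minus_divide)
  define Z where "Z = t powr (real DIM('a) * \<beta>)"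
  have Z: "0 < Z" using t by (simp add: Z_def)
  have large: "F (r / T) \<le> Z * K * 4 powr (a / 2) * (1 + r\<^sup>2) powr (- a / 2)" if r: "2 \<le> r" for r
  proof -
    \<comment> \<open>A nonempty open shell is not null, so it contains a point where the bound
      holds. This point has norm below \<open>r\<close>, so \<open>F\<close> there dominates
      \<open>F (r / T)\<close>, and norm above \<open>r / 2\<close>, which costs only the factor
      \<open>4 powr (a / 2)\<close>.\<close>
    define Sh where "Sh = {x::'a. r / 2 < norm x \<and> norm x < r}"
    have op: "open Sh"
    proof -
      have "Sh = ball 0 r - cball 0 (r / 2)" by (auto simp: Sh_def)
      then show ?thesis by auto
    qed
    obtain b :: 'a where b: "b \<in> Basis" using nonempty_Basis by blast
    have "(3 / 4 * r) *\<^sub>R b \<in> Sh" using b r by (simp add: Sh_def)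
    then have ne: "Sh \<noteq> {}" by auto
    have "\<exists>x\<in>Sh. U t x \<le> K * bar a x"
    proof (rule ccontr)
      assume *: "\<not> ?thesis"
      have "AE x in lborel. x \<notin> Sh" using ae
      proof eventually_elim
        case (elim x)
        show ?case
        proof
          assume x: "x \<in> Sh"
          then have "1 \<le> norm x" using r by (simp add: Sh_def)
          then show False using elim * x by blast
        qed
      qed
      then have "emeasure lborel Sh = 0" using op by (subst (asm) AE_iff_measurable[of Sh]) auto
      then show False using open_not_negligible[OF op ne] op
        by (simp add: negligible_iff_null_sets null_sets_def)
    qed
    then obtain x where x: "x \<in> Sh" "U t x \<le> K * bar a x" by blast
    have nx: "r / 2 < norm x" "norm x < r" using x by (auto simp: Sh_def)
    have "F (r / T) \<le> F (norm x / T)" using nx T by (intro mono divide_right_mono) auto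
    also have "\<dots> = Z * U t x"
    proof -
      have "Z * t powr (- (real DIM('a) * \<beta>)) = 1" using t by (simp add: Z_def powr_minus)
      then show ?thesis by (simp add: U_def Ti mult.assoc[symmetric])
    qed
    also have "\<dots> \<le> Z * (K * bar a x)" using x Z by (intro mult_left_mono) auto
    also have "\<dots> \<le> Z * (K * (4 powr (a / 2) * (1 + r\<^sup>2) powr (- a / 2)))"
    proof -
      have "(r / 2)\<^sup>2 \<le> (norm x)\<^sup>2" using nx r by (intro power_mono) auto
      then have "(1 + r\<^sup>2) / 4 \<le> 1 + (norm x)\<^sup>2" by (simp add: power_divide)
      then have "bar a x \<le> ((1 + r\<^sup>2) / 4) powr (- a / 2)"
        unfolding bar_def using a0 add_pos_nonneg[of 1 "r\<^sup>2"] by (intro powr_mono2') auto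
      also have "\<dots> = 4 powr (a / 2) * (1 + r\<^sup>2) powr (- a / 2)" by (simp add: powr_divide powr_minus_divide)
      finally show ?thesis using Z K by (intro mult_left_mono) auto
    qed
    finally show ?thesis by (simp add: mult.assoc)
  qed
  \<comment> \<open>\<open>K1\<close> serves radii with \<open>r * T \<ge> 2\<close>, where the
    power of \<open>T\<close> undoes the dilation; \<open>K2\<close> serves the remaining bounded
    range, where \<open>F\<close> is estimated by \<open>F 0\<close>.\<close>
  define K1 where "K1 = Z * K * 4 powr (a / 2) * T powr (- a)"
  define K2 where "K2 = F 0 * (1 + (2 / T)\<^sup>2) powr (a / 2)"
  have K12: "0 < K1" "0 \<le> K2" using Z K T pos[of 0] by (auto simp: K1_def K2_def)
  show ?thesis
  proof (intro exI[of _ "K1 + K2"] conjI allI impI)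
    show "0 < K1 + K2" using K12 by simp
    fix r :: real assume r: "0 \<le> r"
    have q: "0 < 1 + r\<^sup>2" by (simp add: add_pos_nonneg)
    have "F r \<le> (K1 + K2) * (1 + r\<^sup>2) powr (- a / 2)"
    proof (cases "2 \<le> r * T")
      case True
      have "F r = F (r * T / T)" using T by simp
      also have "\<dots> \<le> Z * K * 4 powr (a / 2) * (1 + (r * T)\<^sup>2) powr (- a / 2)" by (rule large[OF True])
      also have "\<dots> \<le> Z * K * 4 powr (a / 2) * (T powr (- a) * (1 + r\<^sup>2) powr (- a / 2))"
      proof (intro mult_left_mono)
        have "T\<^sup>2 * (1 + r\<^sup>2) \<le> 1 + (r * T)\<^sup>2" using T power_le_one[of T 2] by (simp add: algebra_simps power_mult_distrib)
        then have "(1 + (r * T)\<^sup>2) powr (- a / 2) \<le> (T\<^sup>2 * (1 + r\<^sup>2)) powr (- a / 2)"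
          using a0 T q by (intro powr_mono2') auto
        also have "\<dots> = (T\<^sup>2) powr (- a / 2) * (1 + r\<^sup>2) powr (- a / 2)" by (simp add: powr_mult)
        also have "(T\<^sup>2) powr (- a / 2) = T powr (- a)"
        proof -
          have "T\<^sup>2 = T powr 2" using T by simp
          then show ?thesis by (simp only: powr_powr) simp
        qed
        finally show "(1 + (r * T)\<^sup>2) powr (- a / 2) \<le> T powr (- a) * (1 + r\<^sup>2) powr (- a / 2)" .
      qed (use Z K in auto)
      also have "\<dots> = K1 * (1 + r\<^sup>2) powr (- a / 2)" by (simp add: K1_def mult.assoc)
      also have "\<dots> \<le> (K1 + K2) * (1 + r\<^sup>2) powr (- a / 2)" using K12 by (intro mult_right_mono) auto
      finally show ?thesis .
    next
      case False
      then have "r \<le> 2 / T" using T by (simp add: field_simps)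
      then have "r\<^sup>2 \<le> (2 / T)\<^sup>2" using r by (intro power_mono) auto
      then have "(1 + (2 / T)\<^sup>2) powr (- a / 2) \<le> (1 + r\<^sup>2) powr (- a / 2)"
        using a0 q by (intro powr_mono2') auto
      then have "F 0 * (1 + (2 / T)\<^sup>2) powr (a / 2) * (1 + (2 / T)\<^sup>2) powr (- a / 2) \<le> K2 * (1 + r\<^sup>2) powr (- a / 2)"
        unfolding K2_def using pos[of 0] by (intro mult_left_mono) auto
      moreover have "(1 + (2 / T)\<^sup>2) powr (a / 2) * (1 + (2 / T)\<^sup>2) powr (- a / 2) = 1"
        using add_pos_nonneg[of 1 "(2 / T)\<^sup>2"] by (simp add: powr_minus)
      ultimately have "F 0 \<le> K2 * (1 + r\<^sup>2) powr (- a / 2)" by (simp only: mult.assoc)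
      moreover have "F r \<le> F 0" using mono[of 0 r] r by simp
      moreover have "K2 * (1 + r\<^sup>2) powr (- a / 2) \<le> (K1 + K2) * (1 + r\<^sup>2) powr (- a / 2)"
        using K12 by (intro mult_right_mono) auto
      ultimately show ?thesis by linarith
    qed
    then show "F r \<le> (K1 + K2) * (1 + r\<^sup>2) powr (- (real DIM('a) + s * p) / 2)" by (simp add: a_def)
  qed
qed

section \<open>Rescaling of the self-similar solutions and the two-sided bound\<close>

lemma Ubar_rescale:
  assumes M: "0 < M" and s: "0 < s" and p: "2 < p"
  shows "Ubar s p F M t x = M * Ubar s p F 1 (M powr (p - 2) * t) (x::'a::euclidean_space)"
proof -
  define b where "b = betaE s p DIM('a)"
  define al where "al = alphaE s p DIM('a)"
  have "0 < real DIM('a) * (p - 2) + s * p" using s p by (simp add: add_nonneg_pos)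
  then have "(real DIM('a) * (p - 2) + s * p) * b = 1" by (simp add: b_def betaE_def)
  \<comment> \<open>The relation \<open>s * p * \<beta> = 1 - (p - 2) * \<alpha>\<close> is what
    lets the amplitude exponent of \<open>U_M\<close> be read as a factor \<open>M\<close> and a
    change of clock.\<close>
  then have e: "s * p * b = 1 + (p - 2) * (- al)" by (simp add: al_def alphaE_def b_def[symmetric] algebra_simps)
  have "M * (M powr (p - 2) * t) powr (- al) = M powr (s * p * b) * t powr (- al)"
    unfolding e powr_add using M by (simp add: powr_mult powr_powr)
  moreover have "(M powr (p - 2) * t) powr (- b) = M powr (- (p - 2) * b) * t powr (- b)"
    by (simp only: powr_mult powr_powr) (simp add: algebra_simps)
  ultimately show ?thesis
    unfolding Ubar_def b_def[symmetric] al_def[symmetric] by (simp add: mult_ac)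
qed

lemma flow_Ubar:
  assumes prof: "is_profile s p TYPE('a::euclidean_space) F" and s: "0 < s" and p: "2 < p" and M: "0 < M"
  shows "flow s p (Ubar s p F M :: real \<Rightarrow> 'a \<Rightarrow> real)"
proof -
  have "flow s p (Ubar s p F 1 :: real \<Rightarrow> 'a \<Rightarrow> real)"
    using prof by (intro is_solution_pos_imp_flow) (simp add: is_profile_def)
  from flow_scale[OF this M p] show ?thesis
    unfolding Ubar_rescale[OF M s p, symmetric] .
qed

lemma L2_curve_continuous:
  assumes v: "L2_curve v" and t: "0 < t"
  shows "((\<lambda>h. L2norm (\<lambda>x. v (t + h) x - v t x)) \<longlongrightarrow> 0) (at_right 0)"
proof -
  obtain L where L: "\<forall>t1\<in>{t..t + 1}. \<forall>t2\<in>{t..t + 1}. L2norm (\<lambda>x. v t1 x - v t2 x) \<le> L * \<bar>t1 - t2\<bar>"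
    using v t unfolding L2_curve_def by blast
  have bound: "\<forall>\<^sub>F h in at_right 0. norm (L2norm (\<lambda>x. v (t + h) x - v t x)) \<le> L * h"
    unfolding eventually_at_right_field
  proof (intro exI[of _ 1] conjI allI impI)
    fix h :: real assume "0 < h" "h < 1"
    then show "norm (L2norm (\<lambda>x. v (t + h) x - v t x)) \<le> L * h"
      using bspec[OF bspec[OF L, of "t + h"], of t] by simp
  qed simp
  have "((\<lambda>h. L * h) \<longlongrightarrow> L * 0) (at_right 0)" by (intro tendsto_intros)
  then have "((\<lambda>h. L * h) \<longlongrightarrow> 0) (at_right 0)" by simp
  from Lim_null_comparison[OF bound this] show ?thesis .
qed

text \<open>For ordered data the positive part of \<open>u - v\<close> is at most the modulus of
  \<open>(u - u0) - (v - v0)\<close>, which tends to 0 in \<open>L2\<close>. A limit of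
  \<open>L2\<close> type at the start is therefore all that \<open>flow_comparison\<close>
  requires.\<close>

lemma flow_comparison_initial:
  fixes u v :: "real \<Rightarrow> 'a::euclidean_space \<Rightarrow> real"
  assumes u: "flow s p u" and v: "flow s p v" and p: "p > 2" and b: "0 < b"
    and u0: "in_L2 u0" and v0: "in_L2 v0"
    and limu: "((\<lambda>t. L2norm (\<lambda>x. u t x - u0 x)) \<longlongrightarrow> 0) (at_right 0)"
    and limv: "((\<lambda>t. L2norm (\<lambda>x. v t x - v0 x)) \<longlongrightarrow> 0) (at_right 0)"
    and le: "AE x in lborel. u0 x \<le> v0 x"
  shows "AE x in lborel. u b x \<le> v b x"
proof (rule flow_comparison[OF u v p b], rule Lim_null_comparison)
  show "\<forall>\<^sub>F t in at_right 0. norm (pos_part_sq UNIV (\<lambda>x. u t x - v t x)) \<le> (L2norm (\<lambda>x. u t x - u0 x) + L2norm (\<lambda>x. v t x - v0 x))\<^sup>2"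
    using eventually_at_right_less[of 0]
  proof eventually_elim
    case (elim t)
    have ut: "in_L2 (u t)" and vt: "in_L2 (v t)" using u v elim by (auto simp: flow_def L2_curve_def)
    have L: "in_L2 (\<lambda>x. u t x - u0 x)" "in_L2 (\<lambda>x. v t x - v0 x)" using in_L2_diff ut vt u0 v0 by auto
    have "AE x in lborel. x \<in> UNIV \<longrightarrow> u t x - v t x \<le> \<bar>(u t x - u0 x) - (v t x - v0 x)\<bar>"
      using le by eventually_elim auto
    then have "pos_part_sq UNIV (\<lambda>x. u t x - v t x) \<le> (L2norm (\<lambda>x. (u t x - u0 x) - (v t x - v0 x)))\<^sup>2"
      by (intro pos_part_sq_le_AE in_L2_diff[OF ut vt] in_L2_diff[OF L]) auto
    also have "\<dots> \<le> (L2norm (\<lambda>x. u t x - u0 x) + L2norm (\<lambda>x. v t x - v0 x))\<^sup>2"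
      by (intro power_mono L2norm_triangle_diff L) simp
    finally show ?case by (simp add: pos_part_sq_nonneg)
  qed
  have "((\<lambda>t. (L2norm (\<lambda>x. u t x - u0 x) + L2norm (\<lambda>x. v t x - v0 x))\<^sup>2) \<longlongrightarrow> (0 + 0)\<^sup>2) (at_right 0)"
    by (intro tendsto_intros limu limv)
  then show "((\<lambda>t. (L2norm (\<lambda>x. u t x - u0 x) + L2norm (\<lambda>x. v t x - v0 x))\<^sup>2) \<longlongrightarrow> 0) (at_right 0)" by simp
qed

theorem mainTheorem14:
  fixes s p R :: real and u0 :: "'a::euclidean_space \<Rightarrow> real"
    and u :: "real \<Rightarrow> 'a \<Rightarrow> real" and F :: "real \<Rightarrow> real"
  assumes "0 < s" "s < 1" "p > 2"
    and "is_profile s p TYPE('a) F"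
    and "in_Linf u0" "AE x in lborel. u0 x \<ge> 0" "\<not> (AE x in lborel. u0 x = 0)"
    and "R > 0" "\<exists>c. AE x in lborel. x \<notin> cball c R \<longrightarrow> u0 x = 0"
    and "is_solution s p u0 u"
  shows "\<forall>\<tau>>0. \<exists>M1 M2 c2. M1 > 0 \<and> M2 > 0 \<and> c2 > 0 \<and>
           (\<forall>t\<ge>\<tau>. AE x in lborel. Ubar s p F M1 t x \<le> u t x \<and> u t x \<le> Ubar s p F M2 (t + c2) x) \<and>
           M1 \<le> (\<integral>x. u0 x \<partial>lborel) \<and> (\<integral>x. u0 x \<partial>lborel) \<le> M2"
proof (intro allI impI)
  fix \<tau> :: real assume \<tau>: "\<tau> > 0"
  note s = assms(1,2) and p = assms(3) and prof = assms(4) and nn = assms(6) and nz = assms(7)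
  let ?b = "betaE s p DIM('a)" and ?al = "alphaE s p DIM('a)"
  define a where "a = real DIM('a) + s * p"
  define e where "e = s * p * ?b"
  have b0: "?b > 0" using s p by (simp add: betaE_def add_nonneg_pos)
  then have e0: "e > 0" using s p by (simp add: e_def)
  have pos: "\<And>r. 0 \<le> r \<Longrightarrow> 0 < F r" and mono: "\<And>r1 r2. 0 \<le> r1 \<Longrightarrow> r1 \<le> r2 \<Longrightarrow> F r2 \<le> F r1"
    using prof by (auto simp: is_profile_def)
  obtain c where supp: "AE x in lborel. x \<notin> cball c R \<longrightarrow> u0 x = 0" using assms(9) by blast
  obtain C where C: "AE x in lborel. \<bar>u0 x\<bar> \<le> C" using assms(5) by (auto simp: in_Linf_def)
  have u0m[measurable]: "u0 \<in> borel_measurable lborel" using assms(5) by (simp add: in_Linf_def)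
  have icb: "integrable lborel (\<lambda>x. d * indicator (cball c R) x :: real)" for d
    using emeasure_compact_finite[of "cball c R"]
    by (intro integrable_mult_right) (simp add: integrable_indicator_iff emeasure_lborel_cball_finite[simplified])
  have u0i: "integrable lborel u0"
    by (rule Bochner_Integration.integrable_bound[OF icb[of C] u0m])
      (use supp C in \<open>eventually_elim, auto simp: indicator_def\<close>)
  have u02: "in_L2 u0" unfolding in_L2_def
  proof
    show "integrable lborel (\<lambda>x. (u0 x)\<^sup>2)"
    proof (rule Bochner_Integration.integrable_bound[OF icb[of "C\<^sup>2"]])
      show "AE x in lborel. norm ((u0 x)\<^sup>2) \<le> norm (C\<^sup>2 * indicator (cball c R) x)"
        using supp C
      proof eventually_elim
        case (elim x)
        then show ?case using power_mono[of "\<bar>u0 x\<bar>" C 2] by (auto simp: indicator_def)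
      qed
    qed measurable
  qed (rule u0m)
  define m where "m = (\<integral>x. u0 x \<partial>lborel)"
  have m0: "m > 0"
  proof -
    have "m \<ge> 0" unfolding m_def using nn by (rule integral_nonneg_AE)
    moreover have "m \<noteq> 0" unfolding m_def using integral_nonneg_eq_0_iff_AE[OF u0i nn] nz by simp
    ultimately show ?thesis by simp
  qed
  have uf: "flow s p u" by (rule is_solution_imp_flow[OF assms(10)])
  have ulim: "((\<lambda>t. L2norm (\<lambda>x. u t x - u0 x)) \<longlongrightarrow> 0) (at_right 0)"
    using assms(10) by (simp add: is_solution_def)
  have curve: "L2_curve u" using uf by (simp add: flow_def)

  \<comment> \<open>The touching time must not exceed \<tau>, where the bound has to begin, nor 1:
    then \<open>t1 powr (- \<beta>)\<close> is at least 1 and the dilation in the argument of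
    \<open>F\<close> only lowers its value.\<close>
  have "0 < min \<tau> 1" using \<tau> by simp
  from flow_lower_barrier[OF s p uf u02 ulim nn nz this]
  obtain t1 c1 where t1: "0 < t1" "t1 \<le> min \<tau> 1" and c1: "0 < c1" and
    low: "AE x in lborel. c1 * bar a x \<le> u t1 x" unfolding a_def by blast
  obtain K where K: "K > 0" "\<And>r. 0 \<le> r \<Longrightarrow> F r \<le> K * (1 + r\<^sup>2) powr (- a / 2)"
    unfolding a_def using profile_tail[OF s p prof] by blast
  \<comment> \<open>The threshold for \<open>M1 powr e\<close> at which
    \<open>M1 powr e * t1 powr (- \<alpha>) * K\<close> equals \<open>c1\<close>.\<close>
  define q where "q = c1 * t1 powr ?al / K"
  have q0: "q > 0" using c1 t1 K by (simp add: q_def)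
  \<comment> \<open>The 1 makes the argument of \<open>F\<close> at least \<open>norm x\<close>,
    \<open>m\<close> yields the required mass inequality directly, and the last entry puts
    \<open>U_M1\<close> below the barrier at time \<open>t1\<close>.\<close>
  define M1 where "M1 = min (min 1 m) (q powr (1 / e))"
  have M1: "0 < M1" "M1 \<le> 1" "M1 \<le> m" "M1 \<le> q powr (1 / e)" using m0 q0 by (auto simp: M1_def)
  have lower: "AE x in lborel. Ubar s p F M1 t x \<le> u t x" if t: "\<tau> \<le> t" for t
  proof -
    have init: "Ubar s p F M1 t1 x \<le> c1 * bar a x" for x :: 'a
    proof -
      let ?r = "M1 powr (- (p - 2) * ?b) * norm x * t1 powr (- ?b)"
      have ge1: "1 \<le> M1 powr (- (p - 2) * ?b)" "1 \<le> t1 powr (- ?b)"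
        using M1 t1 b0 p powr_mono2'[of "- (p - 2) * ?b" M1 1] powr_mono2'[of "- ?b" t1 1] by (auto simp: mult_nonpos_nonneg)
      have r: "norm x \<le> ?r"
      proof -
        have "1 * norm x * 1 \<le> ?r" using ge1 by (intro mult_mono) auto
        then show ?thesis by simp
      qed
      then have r2: "(norm x)\<^sup>2 \<le> ?r\<^sup>2" by (intro power_mono) auto
      have a0: "0 \<le> a" using s p by (simp add: a_def)
      have "F ?r \<le> K * (1 + ?r\<^sup>2) powr (- a / 2)" by (rule K(2)) simp
      also have "\<dots> \<le> K * bar a x"
        unfolding bar_def using r2 a0 K(1) by (intro mult_left_mono powr_mono2') auto
      finally have Fr: "F ?r \<le> K * bar a x" .
      have "M1 powr e \<le> (q powr (1 / e)) powr e" using M1 e0 by (intro powr_mono2) auto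
      also have "\<dots> = q" using q0 e0 by (simp add: powr_powr)
      finally have "M1 powr e * t1 powr (- ?al) * F ?r \<le> q * t1 powr (- ?al) * (K * bar a x)"
        using Fr q0 pos[of ?r] by (intro mult_mono) (auto intro: less_imp_le)
      also have "\<dots> = c1 * bar a x"
      proof -
        have "t1 powr ?al * t1 powr (- ?al) = 1" using t1 by (simp add: powr_minus)
        moreover have "q * t1 powr (- ?al) * (K * bar a x) = c1 * (t1 powr ?al * t1 powr (- ?al)) * bar a x"
          using K by (simp add: q_def)
        ultimately show ?thesis by simp
      qed
      finally show ?thesis by (simp add: Ubar_def e_def)
    qed
    have le1: "AE x in lborel. Ubar s p F M1 t1 x \<le> u t1 x"
      using low by eventually_elim (use init order_trans in blast)
    show ?thesis
    \<comment> \<open>The comparison lemma only speaks of positive elapsed time; at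
      \<open>t1\<close> itself the initial inequality is the claim.\<close>
    proof (cases "t = t1")
      case False
      then have tt: "0 < t - t1" using t t1 by auto
      let ?v = "Ubar s p F M1 :: real \<Rightarrow> 'a \<Rightarrow> real"
      have vf: "flow s p ?v" by (rule flow_Ubar[OF prof s(1) p M1(1)])
      have vc: "L2_curve ?v" using vf by (simp add: flow_def)
      have "AE x in lborel. ?v (t1 + (t - t1)) x \<le> u (t1 + (t - t1)) x"
        by (rule flow_comparison_initial[where u = "\<lambda>t. ?v (t1 + t)" and v = "\<lambda>t. u (t1 + t)", OF
          flow_shift[OF vf] flow_shift[OF uf] p tt L2_curve_in_L2[OF vc t1(1)] L2_curve_in_L2[OF curve t1(1)]
          L2_curve_continuous[OF vc t1(1)] L2_curve_continuous[OF curve t1(1)] le1]) (use t1 in auto)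
      then show ?thesis by simp
    qed (use le1 in simp)
  qed

  \<comment> \<open>Radius of a ball about the origin that contains the support of
    \<open>u0\<close>, since \<open>U_M\<close> is centred there.\<close>
  define \<rho> where "\<rho> = norm c + R"
  have \<rho>0: "0 \<le> \<rho>" using assms(8) by (simp add: \<rho>_def)
  \<comment> \<open>On that ball \<open>U_M2\<close> at time 1 is at least
    \<open>M2 powr e * F \<rho>\<close>, so this threshold lifts it above the essential bound
    \<open>C\<close>; the maximum with 1 keeps it positive.\<close>
  define q2 where "q2 = max C 1 / F \<rho>"
  have q2: "q2 > 0" using pos[OF \<rho>0] by (simp add: q2_def)
  \<comment> \<open>Again 1 controls the argument of \<open>F\<close>, now from above by \<rho>,
    \<open>m\<close> gives the mass inequality, and the last entry gives domination of
    \<open>u0\<close>. The shift \<open>c2\<close> is the starting time 1 of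
    \<open>U_M2\<close>.\<close>
  define M2 where "M2 = max (max 1 m) (q2 powr (1 / e))"
  have M2: "1 \<le> M2" "m \<le> M2" "q2 powr (1 / e) \<le> M2" by (auto simp: M2_def)
  have upper: "AE x in lborel. u t x \<le> Ubar s p F M2 (t + 1) x" if t: "\<tau> \<le> t" for t
  proof -
    let ?v = "Ubar s p F M2 :: real \<Rightarrow> 'a \<Rightarrow> real"
    have vf: "flow s p ?v" using M2 by (intro flow_Ubar[OF prof s(1) p]) auto
    have vc: "L2_curve ?v" using vf by (simp add: flow_def)
    have init: "AE x in lborel. u0 x \<le> ?v 1 x"
      using supp C
    proof eventually_elim
      case (elim x)
      let ?r = "M2 powr (- (p - 2) * ?b) * norm x"
      have v1: "?v 1 x = M2 powr e * F ?r" by (simp add: Ubar_def e_def)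
      show ?case
      proof (cases "x \<in> cball c R")
        case True
        have "norm x \<le> norm c + dist c x" using norm_triangle_sub[of x c] by (simp add: dist_norm norm_minus_commute)
        then have "norm x \<le> \<rho>" using True by (simp add: \<rho>_def)
        moreover have "M2 powr (- (p - 2) * ?b) \<le> 1"
          using powr_mono2'[of "- (p - 2) * ?b" 1 M2] M2 b0 p by (simp add: mult_nonpos_nonneg)
        ultimately have "?r \<le> 1 * \<rho>" by (intro mult_mono) auto
        then have F: "F \<rho> \<le> F ?r" using \<rho>0 by (intro mono) auto
        have "q2 = (q2 powr (1 / e)) powr e" using q2 e0 by (simp add: powr_powr)
        also have "\<dots> \<le> M2 powr e" using M2 e0 by (intro powr_mono2) auto
        finally have "q2 * F \<rho> \<le> M2 powr e * F ?r" using F q2 pos[OF \<rho>0] by (intro mult_mono) auto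
        moreover have "q2 * F \<rho> = max C 1" using pos[OF \<rho>0] by (simp add: q2_def)
        ultimately show ?thesis using elim v1 by linarith
      next
        case False
        then show ?thesis using elim(1) v1 pos[of ?r] by simp
      qed
    qed
    have tt: "0 < t" using t \<tau> by simp
    have "AE x in lborel. u t x \<le> ?v (1 + t) x"
      by (rule flow_comparison_initial[where v = "\<lambda>t. ?v (1 + t)", OF
          uf flow_shift[OF vf] p tt u02 L2_curve_in_L2[OF vc zero_less_one] ulim
          L2_curve_continuous[OF vc zero_less_one] init]) simp
    then show ?thesis by (simp add: add.commute)
  qed

  show "\<exists>M1 M2 c2. M1 > 0 \<and> M2 > 0 \<and> c2 > 0 \<and>
           (\<forall>t\<ge>\<tau>. AE x in lborel. Ubar s p F M1 t x \<le> u t x \<and> u t x \<le> Ubar s p F M2 (t + c2) x) \<and>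
           M1 \<le> (\<integral>x. u0 x \<partial>lborel) \<and> (\<integral>x. u0 x \<partial>lborel) \<le> M2"
  proof (rule exI[of _ M1], rule exI[of _ M2], rule exI[of _ 1], intro conjI allI impI)
    fix t assume "\<tau> \<le> t"
    then show "AE x in lborel. Ubar s p F M1 t x \<le> u t x \<and> u t x \<le> Ubar s p F M2 (t + 1) x"
      using lower upper by simp
  qed (use M1 M2 in \<open>auto simp: m_def\<close>)
qed

end
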